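(* Let $\mathfrak{g}=(\mathfrak{g}_{-1}\xrightarrow{l_1}\mathfrak{g}_0,\ l_2=l_2^0+l_2^1,\ l_3)$ be a $2$-term $L_\infty$-algebra, let $l=l_1+(l_2^1+l_2^0)+l_3$, viewed as a degree $3$ function on $T^*[2]A[1]$, where $A=\mathfrak{g}_{-1}^*\times\mathfrak{g}_0^*\to\mathfrak{g}_{-1}^*$ is the trivial vector bundle. Then $(A,-l)$ is a Lie quasi-bialgebroid (with $\mu=-l_1$, $\gamma=-l_2^0-l_2^1$, $\phi=-l_3$), and the Courant algebroid $E=\mathfrak{g}_{-1}^*\times(\mathfrak{g}_0^*\oplus\mathfrak{g}_0)\to\mathfrak{g}_{-1}^*$ associated to $\mathfrak{g}$ is the double of the Lie quasi-bialgebroid $(A,-l)$.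
   Context: All vector spaces are real and finite-dimensional. A $2$-term $L_\infty$-algebra $(\mathfrak{g}_{-1}\xrightarrow{l_1}\mathfrak{g}_0,l_2=l_2^0+l_2^1,l_3)$ consists of a linear map $l_1:\mathfrak{g}_{-1}\to\mathfrak{g}_0$, maps $l_2^0:\wedge^2\mathfrak{g}_0\to\mathfrak{g}_0$, $l_2^1:\mathfrak{g}_0\otimes\mathfrak{g}_{-1}\to\mathfrak{g}_{-1}$ (with $l_2(m,x)=-l_2(x,m)$, $l_2(m,n)=0$) and $l_3:\wedge^3\mathfrak{g}_0\to\mathfrak{g}_{-1}$, with, for $x,y,z,x_i\in\mathfrak{g}_0$, $m,n\in\mathfrak{g}_{-1}$: $l_1l_2(x,m)=l_2(x,l_1m)$; $l_2(l_1m,n)=l_2(m,l_1n)$; $l_2(l_2(x,y),z)+c.p.+l_1l_3(x,y,z)=0$; $l_2(l_2(x,y),m)+l_2(l_2(y,m),x)+l_2(l_2(m,x),y)+l_3(x,y,l_1m)=0$; $\sum_{\sigma}\mathrm{sgn}(\sigma)l_3(l_2(x_{\sigma(1)},x_{\sigma(2)}),x_{\sigma(3)},x_{\sigma(4)})=\sum_{\tau}\mathrm{sgn}(\tau)l_2(l_3(x_{\tau(1)},x_{\tau(2)},x_{\tau(3)}),x_{\tau(4)})$, $\sigma$ over $(2,2)$- and $\tau$ over $(3,1)$-unshuffles. "$c.p.$" denotes cyclic permutations. For a vector bundle $A\to M$ with local coordinates $(x^i,\xi^a)$ on $A[1]$, the graded manifold $T^*[2]A[1]$ has local coordinates $(x^i,\xi^a,\theta_a,p_i)$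 of degrees $(0,1,1,2)$ and canonical degree $-2$ Poisson bracket (big bracket) with $\{x^i,p_j\}=\delta^i_j=-\{p_j,x^i\}$, $\{\xi^a,\theta_b\}=\delta^a_b=\{\theta_b,\xi^a\}$, $\{u,vw\}=\{u,v\}w+(-1)^{|u||v|}v\{u,w\}$, $\{u,v\}=-(-1)^{|u||v|}\{v,u\}$. Degree $0$ functions are $C^\infty(M)$; degree $1$ functions are $\Gamma(A\oplus A^* )$ ($\theta_a\leftrightarrow A$, $\xi^a\leftrightarrow A^*$). A Lie quasi-bialgebroid structure on $A$ is a degree $3$ function $\mu+\gamma+\phi$, locally $\mu=\rho^i_bp_i\xi^b+\frac12\mu^a_{bc}\xi^b\xi^c\theta_a$, $\gamma=\varrho^{ib}p_i\theta_b+\frac12\gamma_a^{bc}\xi^a\theta_b\theta_c$, $\phi=\frac16\phi^{abc}\theta_a\theta_b\theta_c$, with $\{\mu+\gamma+\phi,\mu+\gamma+\phi\}=0$, equivalently $\{\mu,\mu\}=0$, $\{\mu,\gamma\}=0$, $\frac12\{\gamma,\gamma\}+\{\mu,\phi\}=0$, $\{\gamma,\phi\}=0$. Its double is the Courant algebroid $A\oplus A^*$ with fibre metric the canonical symmetric pairing, anchor $\rho(e)f=\{\{e,\Theta\},f\}$ and Dorfman bracket $\lceil e_1,e_2\rceil=\{\{e_1,\Theta\},e_2\}$, where $\Theta=\mu+\gamma+\phi$. For $A=\mathfrak{g}_{-1}^*\times\mathfrak{g}_0^*$ we have $A[1]=\mathfrak{g}^*[1]$, and on $T^*[2]A[1]=T^*[2]\mathfrak{g}^*[1]$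 the elements $m\in\mathfrak{g}_{-1}$, $x\in\mathfrak{g}_0$, $\xi\in\mathfrak{g}_0^*$, $\alpha\in\mathfrak{g}_{-1}^*$ are functions of degrees $0,1,1,2$ (playing the roles of $x^i,\xi^a,\theta_a,p_i$), with $\{x,\xi\}=\{\xi,x\}=\langle\xi,x\rangle$ and $\{m,\alpha\}=-\{\alpha,m\}=\langle\alpha,m\rangle$. One regards $l_1\in\mathfrak{g}_{-1}^*\otimes\mathfrak{g}_0$, $l_2^0\in\wedge^2\mathfrak{g}_0^*\otimes\mathfrak{g}_0$, $l_2^1\in\mathfrak{g}_0^*\wedge\mathfrak{g}_{-1}^*\otimes\mathfrak{g}_{-1}$, $l_3\in\wedge^3\mathfrak{g}_0^*\otimes\mathfrak{g}_{-1}$ as degree $3$ functions, normalized so that $l_1(m)=\{m,l_1\}$, $l_2^0(x,y)=\{y,\{x,l_2^0\}\}$, $l_2^1(x,m)=\{m,\{x,l_2^1\}\}$, $l_3(x,y,\cdot)=\{y,\{x,l_3\}\}$. The Courant algebroid $E$ associated to $\mathfrak{g}$ has fibre metric the canonical pairing between $\mathfrak{g}_0$ and $\mathfrak{g}_0^*$ and anchor and Dorfman bracket given by the derived bracket formulas $\rho(e)f=\{\{e,-l\},f\}$, $\lceil e_1,e_2\rceil=\{\{e_1,-l\},e_2\}$ on $T^*[2]\mathfrak{g}^*[1]$. *)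

theory Defs
  imports
    "HOL-Analysis.Analysis"
    "HOL-Combinatorics.Permutations"
    "HOL-Library.Function_Algebras"
    "HOL-Library.Multiset"
begin

section \<open>2-term \<open>L\<^sub>\<infinity>\<close>-algebras\<close>

definition skew_bilinear :: "('x::real_vector \<Rightarrow> 'x \<Rightarrow> 'v::real_vector) \<Rightarrow> bool" where
  "skew_bilinear b \<longleftrightarrow> bilinear b \<and> (\<forall>x y. b y x = - b x y)"

definition skew_trilinear ::
    "('x::real_vector \<Rightarrow> 'x \<Rightarrow> 'x \<Rightarrow> 'v::real_vector) \<Rightarrow> bool" where
  "skew_trilinear t \<longleftrightarrow>
     (\<forall>y z. linear (\<lambda>x. t x y z)) \<and> (\<forall>x z. linear (\<lambda>y. t x y z)) \<and> (\<forall>x y. linear (t x y)) \<and>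
     (\<forall>x y z. t y x z = - t x y z \<and> t x z y = - t x y z)"

text \<open>
  The types \<open>'m\<close> and \<open>'x\<close> are \<open>\<gg>\<^sub>-\<^sub>1\<close> and \<open>\<gg>\<^sub>0\<close>; \<open>l20\<close>, \<open>l21\<close> are the two components of
  \<open>l\<^sub>2\<close>. The values \<open>l\<^sub>2(m,x) = - l21 x m\<close> and \<open>l\<^sub>2(m,n) = 0\<close> have been substituted in the axioms.
\<close>

locale two_term_Linf =
  fixes l1 :: "'m::real_vector \<Rightarrow> 'x::real_vector"
    and l20 :: "'x \<Rightarrow> 'x \<Rightarrow> 'x"
    and l21 :: "'x \<Rightarrow> 'm \<Rightarrow> 'm"
    and l3 :: "'x \<Rightarrow> 'x \<Rightarrow> 'x \<Rightarrow> 'm"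
  assumes l1_linear: "linear l1"
    and l20_skew_bilinear: "skew_bilinear l20"
    and l21_bilinear: "bilinear l21"
    and l3_skew_trilinear: "skew_trilinear l3"
    and l1_l2: "l1 (l21 x m) = l20 x (l1 m)"
    and l2_l1: "l21 (l1 m) m' = - l21 (l1 m') m"
    and jacobi0:
      "l20 (l20 x y) z + l20 (l20 y z) x + l20 (l20 z x) y + l1 (l3 x y z) = 0"
    and jacobi1:
      "l21 (l20 x y) m + (- l21 x (l21 y m)) + (- l21 y (- l21 x m)) + l3 x y (l1 m) = 0"
    and l2_l3:
      "(\<Sum>\<sigma> | \<sigma> permutes {..<4::nat} \<and> \<sigma> 0 < \<sigma> 1 \<and> \<sigma> 2 < \<sigma> 3.
          real_of_int (sign \<sigma>) *\<^sub>R l3 (l20 (u (\<sigma> 0)) (u (\<sigma> 1))) (u (\<sigma> 2)) (u (\<sigma> 3)))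
     = (\<Sum>\<tau> | \<tau> permutes {..<4::nat} \<and> \<tau> 0 < \<tau> 1 \<and> \<tau> 1 < \<tau> 2.
          real_of_int (sign \<tau>) *\<^sub>R (- l21 (u (\<tau> 3)) (l3 (u (\<tau> 0)) (u (\<tau> 1)) (u (\<tau> 2)))))"

section \<open>Bases and smooth maps\<close>

definition is_basis :: "nat \<Rightarrow> (nat \<Rightarrow> 'v::real_vector) \<Rightarrow> bool" where
  "is_basis n e \<longleftrightarrow>
     inj_on e {..<n} \<and> independent (e ` {..<n}) \<and> span (e ` {..<n}) = UNIV"

definition coord :: "nat \<Rightarrow> (nat \<Rightarrow> 'v::real_vector) \<Rightarrow> 'v \<Rightarrow> nat \<Rightarrow> real" where
  "coord n e v i = representation (e ` {..<n}) v (e i)"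

text \<open>
  The dual of a finite-dimensional normed space \<open>'v\<close> is \<open>'v \<Rightarrow>\<^sub>L real\<close>. Norms only serve
  to have differential calculus available; every finite-dimensional space (of any
  dimension, including 0) carries one and all norms are equivalent.
\<close>

definition dual_basis ::
    "nat \<Rightarrow> (nat \<Rightarrow> 'v::real_normed_vector) \<Rightarrow> nat \<Rightarrow> ('v \<Rightarrow>\<^sub>L real)" where
  "dual_basis n e i = Blinfun (\<lambda>v. coord n e v i)"

text \<open>
  On a finite-dimensional domain, \<open>Ck k\<close> is the usual class \<open>C\<^sup>k\<close>: the derivative is continuous
  as soon as all directional derivatives are.
\<close>

primrec Ck :: "nat \<Rightarrow> ('a::real_normed_vector \<Rightarrow> 'b::real_normed_vector) \<Rightarrow> bool" where
  "Ck 0 h \<longleftrightarrow> continuous_on UNIV h"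
| "Ck (Suc k) h \<longleftrightarrow>
     (\<forall>p. h differentiable (at p)) \<and> (\<forall>v. Ck k (\<lambda>p. frechet_derivative h (at p) v))"

definition smooth :: "('a::real_normed_vector \<Rightarrow> 'b::real_normed_vector) \<Rightarrow> bool" where
  "smooth h \<longleftrightarrow> (\<forall>k. Ck k h)"

section \<open>Functions on \<open>T\<^sup>*[2]A[1]\<close> and the big bracket\<close>

text \<open>
  Let \<open>A\<close> be a trivial vector bundle of rank \<open>r\<close> over the vector space \<open>'b\<close>, which has a basis
  \<open>\<epsilon> 0, \<dots>, \<epsilon> (n - 1)\<close> and associated linear coordinates \<open>x\<^sup>0, \<dots>\<close>. A function on \<open>T\<^sup>*[2]A[1]\<close>
  is \<open>\<Sum> F S K \<eta>\<^sub>S p\<^sub>K\<close>, where \<open>F S K\<close> is a function on \<open>'b\<close>, the multiset \<open>K\<close> gives the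
  monomial \<open>p\<^sub>K\<close>, and \<open>\<eta>\<^sub>S\<close> is the product, in increasing order, of the odd generators
  \<open>\<eta>\<^sub>j\<close>, \<open>j \<in> S\<close>, numbered by \<open>\<eta>\<^sub>2\<^sub>a = \<xi>\<^sup>a\<close> and \<open>\<eta>\<^sub>2\<^sub>a\<^sub>+\<^sub>1 = \<theta>\<^sub>a\<close>.
\<close>

type_synonym 'b gfun = "nat set \<Rightarrow> nat multiset \<Rightarrow> 'b \<Rightarrow> real"

definition gfunctions :: "nat \<Rightarrow> nat \<Rightarrow> ('b::real_normed_vector) gfun set" where
  "gfunctions n r = {F.
     (\<forall>S K. F S K \<noteq> 0 \<longrightarrow> S \<subseteq> {..<2 * r} \<and> set_mset K \<subseteq> {..<n}) \<and>
     finite {(S, K). F S K \<noteq> 0} \<and>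
     (\<forall>S K. smooth (F S K))}"

definition monomial :: "nat set \<Rightarrow> nat multiset \<Rightarrow> ('b \<Rightarrow> real) \<Rightarrow> 'b gfun" where
  "monomial S K h = (\<lambda>S' K'. if S' = S \<and> K' = K then h else (\<lambda>_. 0))"

definition fn :: "('b \<Rightarrow> real) \<Rightarrow> 'b gfun" where
  "fn h = monomial {} {#} h"

definition xi :: "nat \<Rightarrow> 'b gfun" where
  "xi a = monomial {2 * a} {#} (\<lambda>_. 1)"

definition theta :: "nat \<Rightarrow> 'b gfun" where
  "theta a = monomial {2 * a + 1} {#} (\<lambda>_. 1)"

definition pvar :: "nat \<Rightarrow> 'b gfun" where
  "pvar i = monomial {} {#i#} (\<lambda>_. 1)"

text \<open>For disjoint \<open>S\<close>, \<open>T\<close> one has \<open>\<eta>\<^sub>S \<eta>\<^sub>T = gsign S T \<eta>\<^bsub>S \<union> T\<^esub>\<close>.\<close>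

definition gsign :: "nat set \<Rightarrow> nat set \<Rightarrow> real" where
  "gsign S T = (-1) ^ card {(s, t). s \<in> S \<and> t \<in> T \<and> t < s}"

definition gmul :: "'b gfun \<Rightarrow> 'b gfun \<Rightarrow> 'b gfun"  (infixl "\<odot>" 70) where
  "F \<odot> G = (\<lambda>S K p. \<Sum>T\<in>Pow S. \<Sum>L | L \<subseteq># K.
     gsign T (S - T) * F T L p * G (S - T) (K - L) p)"

text \<open>Left and right derivative with respect to the odd generator \<open>\<eta>\<^sub>j\<close>.\<close>

definition dleft :: "nat \<Rightarrow> 'b gfun \<Rightarrow> 'b gfun" where
  "dleft j F = (\<lambda>S K p. if j \<in> S then 0 else (-1) ^ card {s\<in>S. s < j} * F (insert j S) K p)"

definition dright :: "nat \<Rightarrow> 'b gfun \<Rightarrow> 'b gfun" where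
  "dright j F = (\<lambda>S K p. if j \<in> S then 0 else (-1) ^ card {s\<in>S. j < s} * F (insert j S) K p)"

definition dp :: "nat \<Rightarrow> 'b gfun \<Rightarrow> 'b gfun" where
  "dp i F = (\<lambda>S K p. real (count K i + 1) * F S (add_mset i K) p)"

definition dx :: "(nat \<Rightarrow> 'b) \<Rightarrow> nat \<Rightarrow> ('b::real_normed_vector) gfun \<Rightarrow> 'b gfun" where
  "dx \<epsilon> i F = (\<lambda>S K p. frechet_derivative (F S K) (at p) (\<epsilon> i))"

text \<open>
  The coordinate expression of the graded Poisson bracket of degree \<open>-2\<close> determined by
  \<open>{x\<^sup>i, p\<^sub>j} = \<delta> = - {p\<^sub>j, x\<^sup>i}\<close>, \<open>{\<xi>\<^sup>a, \<theta>\<^sub>b} = \<delta> = {\<theta>\<^sub>b, \<xi>\<^sup>a}\<close>, the derivation rule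
  \<open>{u, v w} = {u, v} w + (-1)\<^bsup>|u||v|\<^esup> v {u, w}\<close> and \<open>{u, v} = - (-1)\<^bsup>|u||v|\<^esup> {v, u}\<close>.
  Right derivatives of the first argument account for all signs.
\<close>

definition big_bracket ::
    "nat \<Rightarrow> (nat \<Rightarrow> 'b) \<Rightarrow> nat \<Rightarrow> ('b::real_normed_vector) gfun \<Rightarrow> 'b gfun \<Rightarrow> 'b gfun" where
  "big_bracket n \<epsilon> r F G =
     (\<Sum>i<n. dx \<epsilon> i F \<odot> dp i G - dp i F \<odot> dx \<epsilon> i G) +
     (\<Sum>a<r. dright (2 * a) F \<odot> dleft (2 * a + 1) G + dright (2 * a + 1) F \<odot> dleft (2 * a) G)"

section \<open>Lie quasi-bialgebroids\<close>

text \<open>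
  \<open>has_type r C F\<close>: every monomial of \<open>F\<close> contains \<open>i\<close> variables \<open>p\<close>, \<open>j\<close> variables \<open>\<xi>\<close> and
  \<open>k\<close> variables \<open>\<theta>\<close> for some \<open>(i, j, k) \<in> C\<close>.
\<close>

definition has_type :: "nat \<Rightarrow> (nat \<times> nat \<times> nat) set \<Rightarrow> 'b gfun \<Rightarrow> bool" where
  "has_type r C F \<longleftrightarrow> (\<forall>S K. F S K \<noteq> 0 \<longrightarrow>
     (size K, card {a. a < r \<and> 2 * a \<in> S}, card {a. a < r \<and> 2 * a + 1 \<in> S}) \<in> C)"

text \<open>
  The three types are those of \<open>\<rho>\<^sup>i\<^sub>b p\<^sub>i \<xi>\<^sup>b + \<onehalf> \<mu>\<^sup>a\<^sub>b\<^sub>c \<xi>\<^sup>b \<xi>\<^sup>c \<theta>\<^sub>a\<close>,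
  \<open>\<rho>\<^sup>i\<^sup>b p\<^sub>i \<theta>\<^sub>b + \<onehalf> \<gamma>\<^sub>a\<^sup>b\<^sup>c \<xi>\<^sup>a \<theta>\<^sub>b \<theta>\<^sub>c\<close> and
  \<open>(1/6) \<phi>\<^sup>a\<^sup>b\<^sup>c \<theta>\<^sub>a \<theta>\<^sub>b \<theta>\<^sub>c\<close>, with coefficients smooth functions on the base.
\<close>

definition lie_quasi_bialgebroid ::
    "nat \<Rightarrow> (nat \<Rightarrow> 'b) \<Rightarrow> nat \<Rightarrow>
     ('b::real_normed_vector) gfun \<Rightarrow> 'b gfun \<Rightarrow> 'b gfun \<Rightarrow> bool" where
  "lie_quasi_bialgebroid n \<epsilon> r \<mu> \<gamma> \<phi> \<longleftrightarrow>
     \<mu> \<in> gfunctions n r \<and> has_type r {(1, 1, 0), (0, 2, 1)} \<mu> \<and>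
     \<gamma> \<in> gfunctions n r \<and> has_type r {(1, 0, 1), (0, 1, 2)} \<gamma> \<and>
     \<phi> \<in> gfunctions n r \<and> has_type r {(0, 0, 3)} \<phi> \<and>
     big_bracket n \<epsilon> r (\<mu> + \<gamma> + \<phi>) (\<mu> + \<gamma> + \<phi>) = 0"

section \<open>Courant algebroids\<close>

text \<open>
  Structure maps on the trivial vector bundle with base \<open>'b\<close> and fibre \<open>'f\<close>; sections are maps
  \<open>'b \<Rightarrow> 'f\<close>, and the anchor is given by the action \<open>\<rho>(e)f\<close> of sections on functions.
\<close>

record ('b, 'f) courant_data =
  cmetric :: "'b \<Rightarrow> 'f \<Rightarrow> 'f \<Rightarrow> real"
  canchor :: "('b \<Rightarrow> 'f) \<Rightarrow> ('b \<Rightarrow> real) \<Rightarrow> 'b \<Rightarrow> real"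
  cbracket :: "('b \<Rightarrow> 'f) \<Rightarrow> ('b \<Rightarrow> 'f) \<Rightarrow> 'b \<Rightarrow> 'f"

definition fibre_metric ::
    "('b::real_normed_vector \<Rightarrow> 'f::real_normed_vector \<Rightarrow> 'f \<Rightarrow> real) \<Rightarrow> bool" where
  "fibre_metric g \<longleftrightarrow>
     (\<forall>p. bilinear (g p) \<and> (\<forall>v w. g p v w = g p w v) \<and> (\<forall>v. (\<forall>w. g p v w = 0) \<longrightarrow> v = 0)) \<and>
     (\<forall>v w. smooth (\<lambda>p. g p v w))"

text \<open>The anchor comes from a smooth bundle map \<open>R\<close> to the tangent bundle of the base.\<close>

definition bundle_anchor ::
    "(('b::real_normed_vector \<Rightarrow> 'f::real_normed_vector) \<Rightarrow> ('b \<Rightarrow> real) \<Rightarrow> 'b \<Rightarrow> real) \<Rightarrow> bool"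
  where
  "bundle_anchor \<rho> \<longleftrightarrow> (\<exists>R :: 'b \<Rightarrow> 'f \<Rightarrow> 'b.
     (\<forall>p. linear (R p)) \<and> (\<forall>v. smooth (\<lambda>p. R p v)) \<and>
     (\<forall>s h. smooth s \<longrightarrow> smooth h \<longrightarrow>
        \<rho> s h = (\<lambda>p. frechet_derivative h (at p) (R p (s p)))))"

text \<open>
  The first of the last three axioms is \<open>[s, s] = \<onehalf> \<rho>\<^sup>* d\<langle>s, s\<rangle>\<close>, the bundle being identified
  with its dual by the fibre metric.
\<close>

definition courant_algebroid ::
    "('b::real_normed_vector, 'f::real_normed_vector) courant_data \<Rightarrow> bool" where
  "courant_algebroid C \<longleftrightarrow>
     (let g = (\<lambda>s t p. cmetric C p (s p) (t p)); \<rho> = canchor C; br = cbracket C in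
     fibre_metric (cmetric C) \<and> bundle_anchor \<rho> \<and>
     (\<forall>s t. smooth s \<longrightarrow> smooth t \<longrightarrow> smooth (br s t)) \<and>
     (\<forall>s s' t c. smooth s \<longrightarrow> smooth s' \<longrightarrow> smooth t \<longrightarrow>
        br (\<lambda>p. s p + s' p) t = (\<lambda>p. br s t p + br s' t p) \<and>
        br t (\<lambda>p. s p + s' p) = (\<lambda>p. br t s p + br t s' p) \<and>
        br (\<lambda>p. c *\<^sub>R s p) t = (\<lambda>p. c *\<^sub>R br s t p) \<and>
        br t (\<lambda>p. c *\<^sub>R s p) = (\<lambda>p. c *\<^sub>R br t s p)) \<and>
     (\<forall>s t. smooth s \<longrightarrow> smooth t \<longrightarrow>
        g (br s s) t = (\<lambda>p. 1/2 * \<rho> t (g s s) p)) \<and>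
     (\<forall>s t u. smooth s \<longrightarrow> smooth t \<longrightarrow> smooth u \<longrightarrow>
        \<rho> s (g t u) = (\<lambda>p. g (br s t) u p + g t (br s u) p)) \<and>
     (\<forall>s t u. smooth s \<longrightarrow> smooth t \<longrightarrow> smooth u \<longrightarrow>
        br s (br t u) = (\<lambda>p. br (br s t) u p + br t (br s u) p)))"

section \<open>Derived brackets and the double\<close>

text \<open>
  From here on \<open>A\<close> is the trivial bundle whose fibre is the dual of \<open>'x\<close>; the fibre of the dual
  bundle is \<open>'x\<close> itself, with frame a basis \<open>f\<close> of \<open>'x\<close>. Hence \<open>\<xi>\<^sup>a\<close> corresponds to \<open>f a\<close> and
  \<open>\<theta>\<^sub>a\<close> to the \<open>a\<close>-th element of the dual basis. Sections of the sum of \<open>A\<close> and its dual are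
  identified with functions of degree 1 as follows.
\<close>

definition section_gfun ::
    "nat \<Rightarrow> (nat \<Rightarrow> 'x::real_normed_vector) \<Rightarrow> ('b \<Rightarrow> ('x \<Rightarrow>\<^sub>L real) \<times> 'x) \<Rightarrow> 'b gfun" where
  "section_gfun r f s = (\<Sum>a<r.
     fn (\<lambda>p. blinfun_apply (fst (s p)) (f a)) \<odot> theta a +
     fn (\<lambda>p. coord r f (snd (s p)) a) \<odot> xi a)"

definition derived_anchor ::
    "nat \<Rightarrow> (nat \<Rightarrow> 'b) \<Rightarrow> nat \<Rightarrow> (nat \<Rightarrow> 'x::real_normed_vector) \<Rightarrow>
     ('b::real_normed_vector) gfun \<Rightarrow>
     ('b \<Rightarrow> ('x \<Rightarrow>\<^sub>L real) \<times> 'x) \<Rightarrow> ('b \<Rightarrow> real) \<Rightarrow> 'b \<Rightarrow> real" where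
  "derived_anchor n \<epsilon> r f \<Theta> s h =
     (THE h'. fn h' = big_bracket n \<epsilon> r (big_bracket n \<epsilon> r (section_gfun r f s) \<Theta>) (fn h))"

definition derived_bracket ::
    "nat \<Rightarrow> (nat \<Rightarrow> 'b) \<Rightarrow> nat \<Rightarrow> (nat \<Rightarrow> 'x::real_normed_vector) \<Rightarrow>
     ('b::real_normed_vector) gfun \<Rightarrow>
     ('b \<Rightarrow> ('x \<Rightarrow>\<^sub>L real) \<times> 'x) \<Rightarrow> ('b \<Rightarrow> ('x \<Rightarrow>\<^sub>L real) \<times> 'x) \<Rightarrow>
     'b \<Rightarrow> ('x \<Rightarrow>\<^sub>L real) \<times> 'x" where
  "derived_bracket n \<epsilon> r f \<Theta> s t =
     (THE u. section_gfun r f u =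
        big_bracket n \<epsilon> r (big_bracket n \<epsilon> r (section_gfun r f s) \<Theta>) (section_gfun r f t))"

definition canonical_pairing ::
    "('x::real_normed_vector \<Rightarrow>\<^sub>L real) \<times> 'x \<Rightarrow> ('x \<Rightarrow>\<^sub>L real) \<times> 'x \<Rightarrow> real" where
  "canonical_pairing v w = blinfun_apply (fst v) (snd w) + blinfun_apply (fst w) (snd v)"

definition double ::
    "nat \<Rightarrow> (nat \<Rightarrow> 'b) \<Rightarrow> nat \<Rightarrow> (nat \<Rightarrow> 'x::real_normed_vector) \<Rightarrow>
     ('b::real_normed_vector) gfun \<Rightarrow> 'b gfun \<Rightarrow> 'b gfun \<Rightarrow>
     ('b, ('x \<Rightarrow>\<^sub>L real) \<times> 'x) courant_data" where
  "double n \<epsilon> r f \<mu> \<gamma> \<phi> =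
     \<lparr> cmetric = (\<lambda>_. canonical_pairing),
       canchor = derived_anchor n \<epsilon> r f (\<mu> + \<gamma> + \<phi>),
       cbracket = derived_bracket n \<epsilon> r f (\<mu> + \<gamma> + \<phi>) \<rparr>"

section \<open>The functions and the Courant algebroid associated to a 2-term \<open>L\<^sub>\<infinity>\<close>-algebra\<close>

text \<open>
  The base is now the dual of \<open>'m\<close> with the basis dual to \<open>e\<close>, so that \<open>m\<close> in \<open>'m\<close> is the linear
  function \<open>\<lambda>p. p m\<close> and \<open>x\<^sup>i\<close> is \<open>e i\<close>.
\<close>

definition fun_m1 :: "'m::real_normed_vector \<Rightarrow> ('m \<Rightarrow>\<^sub>L real) gfun" where
  "fun_m1 m = fn (\<lambda>p. blinfun_apply p m)"

definition fun_0 :: "nat \<Rightarrow> (nat \<Rightarrow> 'x::real_normed_vector) \<Rightarrow> 'x \<Rightarrow> 'b gfun" where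
  "fun_0 r f x = (\<Sum>a<r. fn (\<lambda>_. coord r f x a) \<odot> xi a)"

text \<open>
  The four functions below are the elements of the respective tensor spaces determined by
  \<open>l\<^sub>1(m) = {m, l\<^sub>1}\<close>, \<open>l\<^sub>2(x, y) = {y, {x, l\<^sub>2}}\<close>, \<open>l\<^sub>2(x, m) = {m, {x, l\<^sub>2}}\<close> and
  \<open>l\<^sub>3(x, y, \<cdot>) = {y, {x, l\<^sub>3}}\<close>; note \<open>{x\<^sup>i, F} = \<partial>F/\<partial>p\<^sub>i\<close> and that \<open>{\<xi>\<^sup>a, F}\<close> is the left
  derivative of \<open>F\<close> by \<open>\<theta>\<^sub>a\<close>.
\<close>

definition fun_l1 ::
    "nat \<Rightarrow> (nat \<Rightarrow> 'm::real_normed_vector) \<Rightarrow> nat \<Rightarrow> (nat \<Rightarrow> 'x::real_normed_vector) \<Rightarrow>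
     ('m \<Rightarrow> 'x) \<Rightarrow> ('m \<Rightarrow>\<^sub>L real) gfun" where
  "fun_l1 n e r f l1 = (\<Sum>i<n. pvar i \<odot> fun_0 r f (l1 (e i)))"

definition fun_l20 ::
    "nat \<Rightarrow> (nat \<Rightarrow> 'x::real_normed_vector) \<Rightarrow> ('x \<Rightarrow> 'x \<Rightarrow> 'x) \<Rightarrow>
     ('m::real_normed_vector \<Rightarrow>\<^sub>L real) gfun" where
  "fun_l20 r f l20 =
     (\<Sum>a<r. \<Sum>b<r. fn (\<lambda>_. 1/2) \<odot> theta a \<odot> theta b \<odot> fun_0 r f (l20 (f a) (f b)))"

definition fun_l21 ::
    "nat \<Rightarrow> (nat \<Rightarrow> 'm::real_normed_vector) \<Rightarrow> nat \<Rightarrow> (nat \<Rightarrow> 'x::real_normed_vector) \<Rightarrow>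
     ('x \<Rightarrow> 'm \<Rightarrow> 'm) \<Rightarrow> ('m \<Rightarrow>\<^sub>L real) gfun" where
  "fun_l21 n e r f l21 =
     (\<Sum>a<r. \<Sum>i<n. theta a \<odot> pvar i \<odot> fun_m1 (l21 (f a) (e i)))"

definition fun_l3 ::
    "nat \<Rightarrow> (nat \<Rightarrow> 'x::real_normed_vector) \<Rightarrow> ('x \<Rightarrow> 'x \<Rightarrow> 'x \<Rightarrow> 'm::real_normed_vector) \<Rightarrow>
     ('m \<Rightarrow>\<^sub>L real) gfun" where
  "fun_l3 r f l3 = (\<Sum>a<r. \<Sum>b<r. \<Sum>c<r.
     fn (\<lambda>_. 1/6) \<odot> theta a \<odot> theta b \<odot> theta c \<odot> fun_m1 (l3 (f a) (f b) (f c)))"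

definition fun_l ::
    "nat \<Rightarrow> (nat \<Rightarrow> 'm::real_normed_vector) \<Rightarrow> nat \<Rightarrow> (nat \<Rightarrow> 'x::real_normed_vector) \<Rightarrow>
     ('m \<Rightarrow> 'x) \<Rightarrow> ('x \<Rightarrow> 'x \<Rightarrow> 'x) \<Rightarrow> ('x \<Rightarrow> 'm \<Rightarrow> 'm) \<Rightarrow> ('x \<Rightarrow> 'x \<Rightarrow> 'x \<Rightarrow> 'm) \<Rightarrow>
     ('m \<Rightarrow>\<^sub>L real) gfun" where
  "fun_l n e r f l1 l20 l21 l3 =
     fun_l1 n e r f l1 + (fun_l21 n e r f l21 + fun_l20 r f l20) + fun_l3 r f l3"

definition associated_courant ::
    "nat \<Rightarrow> (nat \<Rightarrow> 'm::real_normed_vector) \<Rightarrow> nat \<Rightarrow> (nat \<Rightarrow> 'x::real_normed_vector) \<Rightarrow>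
     ('m \<Rightarrow> 'x) \<Rightarrow> ('x \<Rightarrow> 'x \<Rightarrow> 'x) \<Rightarrow> ('x \<Rightarrow> 'm \<Rightarrow> 'm) \<Rightarrow> ('x \<Rightarrow> 'x \<Rightarrow> 'x \<Rightarrow> 'm) \<Rightarrow>
     ('m \<Rightarrow>\<^sub>L real, ('x \<Rightarrow>\<^sub>L real) \<times> 'x) courant_data" where
  "associated_courant n e r f l1 l20 l21 l3 =
     \<lparr> cmetric = (\<lambda>_. canonical_pairing),
       canchor = derived_anchor n (dual_basis n e) r f (- fun_l n e r f l1 l20 l21 l3),
       cbracket = derived_bracket n (dual_basis n e) r f (- fun_l n e r f l1 l20 l21 l3) \<rparr>"

end

theory Submission
  imports Defs
begin

text \<open>
  With \<open>\<Theta> = - l\<close>, the expression \<open>1/2 {\<Theta>, \<Theta>}\<close> is the sum of the products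
  \<open>\<partial>l/\<partial>x\<^sup>i \<partial>l/\<partial>p\<^sub>i\<close> and \<open>\<partial>l/\<partial>\<xi>\<^sup>a \<partial>l/\<partial>\<theta>\<^sub>a\<close>; its components in \<open>p p\<close>, \<open>p \<theta> \<xi>\<close>, \<open>p \<theta> \<theta>\<close>,
  \<open>\<theta> \<theta> \<theta> \<xi>\<close> and \<open>\<theta> \<theta> \<theta> \<theta>\<close> are the antisymmetrisations of the five axioms of a 2-term
  \<open>L\<^sub>\<infinity>\<close>-algebra. For the Courant algebroid the derived bracket is computed explicitly: a bracket of
  constant sections plus terms containing one derivative. Compatibility with the metric, the Leibniz
  rule and the fact that the anchor preserves brackets are read off this formula. They make the
  Jacobiator totally skew-symmetric and linear over functions, so it vanishes as soon as it
  vanishes on constant sections, which is again the content of the \<open>L\<^sub>\<infinity>\<close> axioms.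
\<close>

text \<open>The master equation and the Courant axioms are established by two independent
  computations from the same axioms; the equality of E with the double is then immediate, both being
  built from the same derived brackets. Two features of the setting shape the work. Finite dimension
  is given only by bases, so the continuity of linear maps, on which smoothness and the type
  \<open>'v \<Rightarrow>\<^sub>L real\<close> rest, has to be derived. Functions are coefficient
  arrays, for which multiplication by 1 fails at infinite index sets and base derivatives fail at
  nonsmooth coefficients, so predicates for well-behaved arrays travel along. Coordinates are
  removed early: contracting the coordinates of a vector with the values of a linear map on a basis
  gives the value on that vector. The structure functions become iterated contractions with
  anticommuting \<open>theta\<close> and commuting \<open>pvar\<close>, and swapping these produces
  the antisymmetrisations. The constants 1/2 and 1/6 are absorbed by counting, in the top component
  as 6 and 4 unshuffles with weight 1/24.\<close>

subsection \<open>Linear maps on finite-dimensional normed spaces\<close>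

text \<open>A new vector \<open>a\<close> has positive distance to \<open>span B\<close>: the
  coefficients of a sequence in \<open>span B\<close> tending to \<open>a\<close> would be Cauchy by
  the induction hypothesis, so the limit would lie in \<open>span B\<close>. Continuity of linear
  maps on a normed space with a finite basis rests on this.\<close>

lemma independent_coefficients_bounded:
  fixes B :: "'v::real_normed_vector set"
  assumes "finite B" "independent B"
  shows "\<exists>C\<ge>0. \<forall>c. \<forall>b\<in>B. \<bar>c b\<bar> \<le> C * norm (\<Sum>b\<in>B. c b *\<^sub>R b)"
  using assms
proof (induction B rule: finite_induct)
  case empty
  then show ?case by auto
next
  case (insert a B)
  then have "independent B" and a: "a \<notin> span B"
    using insert.hyps insert.prems by (simp_all add: independent_insert)
  with insert obtain C where C: "C \<ge> 0"
    "\<And>c b. b \<in> B \<Longrightarrow> \<bar>c b\<bar> \<le> C * norm (\<Sum>b\<in>B. c b *\<^sub>R b)"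
    by blast
  have "\<exists>d>0. \<forall>v\<in>span B. d \<le> norm (a - v)"
  proof (rule ccontr)
    assume "\<not> ?thesis"
    then have "\<exists>v\<in>span B. norm (a - v) < inverse (real (Suc k))" for k
      by (metis inverse_positive_iff_positive of_nat_0_less_iff zero_less_Suc not_le)
    then obtain v where v: "\<And>k. v k \<in> span B"
      "\<And>k. norm (a - v k) < inverse (real (Suc k))" by metis
    have "\<exists>c. v k = (\<Sum>b\<in>B. c b *\<^sub>R b)" for k
      using v(1)[of k] span_finite[OF insert.hyps(1)] by auto
    then obtain c where c: "\<And>k. v k = (\<Sum>b\<in>B. c k b *\<^sub>R b)" by metis
    have "(\<lambda>k. norm (a - v k)) \<longlonglongrightarrow> 0"
      by (rule tendsto_sandwich[OF _ _ tendsto_const LIMSEQ_inverse_real_of_nat])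
        (use v(2) in \<open>auto intro!: always_eventually less_imp_le simp del: of_nat_Suc\<close>)
    then have va: "v \<longlonglongrightarrow> a"
      by (subst tendsto_iff, simp add: tendsto_iff dist_norm norm_minus_commute)
    then have cv: "Cauchy v" by (rule LIMSEQ_imp_Cauchy)
    have "Cauchy (\<lambda>k. c k b)" if "b \<in> B" for b
    proof (rule metric_CauchyI)
      fix \<epsilon> :: real assume e: "\<epsilon> > 0"
      have "\<epsilon> / (C + 1) > 0" using e C(1) by simp
      from metric_CauchyD[OF cv this] obtain M where
        M: "\<And>i j. i \<ge> M \<Longrightarrow> j \<ge> M \<Longrightarrow> dist (v i) (v j) < \<epsilon> / (C + 1)" by blast
      have "dist (c i b) (c j b) < \<epsilon>" if "i \<ge> M" "j \<ge> M" for i j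
      proof -
        have "\<bar>c i b - c j b\<bar> \<le> C * norm (v i - v j)"
          using C(2)[OF \<open>b \<in> B\<close>, of "\<lambda>b. c i b - c j b"]
          by (simp add: c scaleR_diff_left sum_subtractf)
        also have "\<dots> \<le> C * (\<epsilon> / (C + 1))"
          using M[OF that] C(1) by (intro mult_left_mono) (auto simp: dist_norm)
        also have "\<dots> < \<epsilon>" using C(1) e by (simp add: field_simps)
        finally show ?thesis by (simp add: dist_real_def)
      qed
      then show "\<exists>M. \<forall>m\<ge>M. \<forall>n\<ge>M. dist (c m b) (c n b) < \<epsilon>" by blast
    qed
    then have "\<forall>b\<in>B. \<exists>l. (\<lambda>k. c k b) \<longlonglongrightarrow> l"
      by (meson Cauchy_convergent convergent_def)
    then obtain l where l: "\<And>b. b \<in> B \<Longrightarrow> (\<lambda>k. c k b) \<longlonglongrightarrow> l b" by metis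
    have "v \<longlonglongrightarrow> (\<Sum>b\<in>B. l b *\<^sub>R b)"
      unfolding c[abs_def] by (intro tendsto_sum tendsto_scaleR l tendsto_const)
    with va have "a = (\<Sum>b\<in>B. l b *\<^sub>R b)" by (rule LIMSEQ_unique)
    with a show False by (simp add: span_sum span_scale span_base)
  qed
  then obtain d where d: "d > 0" "\<And>v. v \<in> span B \<Longrightarrow> d \<le> norm (a - v)" by blast
  \<comment> \<open>\<open>1/d\<close> serves the coefficient of \<open>a\<close>, bounded through
    the distance to \<open>span B\<close>; the other entry comes from
    \<open>norm w \<le> N + \<bar>c a\<bar> * norm a\<close> and the bound \<open>C\<close> for
    \<open>B\<close>.\<close>
  define C' where "C' = max (1/d) (C * (1 + norm a / d))"
  have "\<bar>c b\<bar> \<le> C' * norm (\<Sum>b\<in>insert a B. c b *\<^sub>R b)" if "b \<in> insert a B" for c b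
  proof -
    define w where "w = (\<Sum>b\<in>B. c b *\<^sub>R b)"
    define N where "N = norm (c a *\<^sub>R a + w)"
    have ca: "\<bar>c a\<bar> \<le> N / d"
    proof (cases "c a = 0")
      case True then show ?thesis using d(1) by (simp add: N_def)
    next
      case False
      \<comment> \<open>Division by \<open>c a\<close> turns \<open>c a *\<^sub>R a + w\<close> into
        \<open>a\<close> minus a vector of \<open>span B\<close>.\<close>
      have "- (1 / c a) *\<^sub>R w \<in> span B"
        unfolding w_def by (intro span_scale span_sum span_base)
      from d(2)[OF this] have "\<bar>c a\<bar> * d \<le> \<bar>c a\<bar> * norm (a - (- (1 / c a) *\<^sub>R w))"
        by (intro mult_left_mono) auto
      also have "\<dots> = N"
        unfolding N_def norm_scaleR[symmetric] using False by (simp add: scaleR_add_right)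
      finally show ?thesis using d(1) by (simp add: field_simps)
    qed
    have sum: "(\<Sum>b\<in>insert a B. c b *\<^sub>R b) = c a *\<^sub>R a + w"
      using insert.hyps by (simp add: w_def)
    have N0: "N \<ge> 0" by (simp add: N_def)
    show ?thesis
    proof (cases "b = a")
      case True
      have "\<bar>c a\<bar> \<le> 1/d * N" using ca by simp
      also have "\<dots> \<le> C' * N" using N0 by (intro mult_right_mono) (auto simp: C'_def)
      finally show ?thesis by (simp add: True sum N_def)
    next
      case False
      then have "\<bar>c b\<bar> \<le> C * norm w" using C(2)[of b c] that by (simp add: w_def)
      also have "norm w \<le> N + \<bar>c a\<bar> * norm a"
        unfolding N_def using norm_triangle_ineq4[of "c a *\<^sub>R a + w" "c a *\<^sub>R a"] by simp
      also have "\<dots> \<le> N + N / d * norm a" using ca by (intro add_left_mono mult_right_mono) auto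
      also have "C * (N + N / d * norm a) = (C * (1 + norm a / d)) * N"
        by (simp add: algebra_simps)
      also have "\<dots> \<le> C' * N" using N0 by (intro mult_right_mono) (auto simp: C'_def)
      finally show ?thesis using C(1) by (simp add: sum N_def mult_left_mono)
    qed
  qed
  moreover have "C' \<ge> 0" using d(1) by (simp add: C'_def le_max_iff_disj)
  ultimately show ?case by blast
qed

lemma coord_sum:
  assumes "is_basis n e"
  shows "(\<Sum>i<n. coord n e v i *\<^sub>R e i) = v"
proof -
  have "(\<Sum>i<n. coord n e v i *\<^sub>R e i)
      = (\<Sum>b\<in>e ` {..<n}. representation (e ` {..<n}) v b *\<^sub>R b)"
    using assms by (subst sum.reindex) (auto simp: is_basis_def coord_def)
  also have "\<dots> = v"
    using assms by (intro sum_representation_eq) (auto simp: is_basis_def)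
  finally show ?thesis .
qed

lemma coord_linear:
  assumes "is_basis n e"
  shows "linear (\<lambda>v. coord n e v i)"
  using assms unfolding is_basis_def coord_def
  by (intro linearI) (simp_all add: representation_add representation_scale)

lemma coord_basis:
  assumes "is_basis n e" "i < n" "j < n"
  shows "coord n e (e i) j = (if i = j then 1 else 0)"
  using assms unfolding is_basis_def coord_def
  by (auto simp: representation_basis inj_on_def)

lemma linear_bounded_linear_basis:
  fixes e :: "nat \<Rightarrow> 'v::real_normed_vector" and g :: "'v \<Rightarrow> 'w::real_normed_vector"
  assumes e: "is_basis n e" and g: "linear g"
  shows "bounded_linear g"
proof -
  have "independent (e ` {..<n})" using e by (auto simp: is_basis_def)
  from independent_coefficients_bounded[OF _ this] obtain C where C: "C \<ge> 0"
    "\<And>c b. b \<in> e ` {..<n} \<Longrightarrow> \<bar>c b\<bar> \<le> C * norm (\<Sum>b\<in>e ` {..<n}. c b *\<^sub>R b)"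
    by auto
  have C': "\<bar>coord n e v i\<bar> \<le> C * norm v" if "i < n" for v i
  proof -
    have "(\<Sum>b\<in>e ` {..<n}. representation (e ` {..<n}) v b *\<^sub>R b) = v"
      using e by (intro sum_representation_eq) (auto simp: is_basis_def)
    then show ?thesis
      using C(2)[of "e i" "representation (e ` {..<n}) v"] that by (simp add: coord_def)
  qed
  have "norm (g v) \<le> norm v * (\<Sum>i<n. C * norm (g (e i)))" for v
  proof -
    have "g v = (\<Sum>i<n. coord n e v i *\<^sub>R g (e i))"
      by (subst coord_sum[OF e, of v, symmetric])
        (simp add: linear_sum[OF g] linear_scale[OF g])
    also have "norm \<dots> \<le> (\<Sum>i<n. C * norm v * norm (g (e i)))"
      by (intro sum_norm_le) (simp add: C' mult_right_mono)
    finally show ?thesis by (simp add: sum_distrib_left mult_ac)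
  qed
  then show ?thesis
    using g by (intro bounded_linear_intro[where K = "\<Sum>i<n. C * norm (g (e i))"])
      (auto simp: linear_add linear_scale)
qed

lemma linear_basis_expand:
  assumes "is_basis n e" "linear g"
  shows "g v = (\<Sum>i<n. coord n e v i *\<^sub>R g (e i))"
  by (subst coord_sum[OF assms(1), of v, symmetric])
    (simp add: linear_sum[OF assms(2)] linear_scale[OF assms(2)])

text \<open>\<open>Blinfun\<close> is inverse to application only on bounded linear maps, so
  automatic continuity of the coordinate functions is what makes \<open>dual_basis\<close> the dual
  basis.\<close>

lemma dual_basis_apply:
  assumes "is_basis n e"
  shows "blinfun_apply (dual_basis n e i) v = coord n e v i"
  unfolding dual_basis_def
  by (subst bounded_linear_Blinfun_apply)
    (auto intro!: linear_bounded_linear_basis[OF assms] coord_linear[OF assms])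

lemma blinfun_eq_on_basis:
  assumes "is_basis n e" "\<And>i. i < n \<Longrightarrow> blinfun_apply p (e i) = blinfun_apply q (e i)"
  shows "p = q"
proof (rule blinfun_eqI)
  fix v
  show "blinfun_apply p v = blinfun_apply q v"
    using linear_basis_expand[OF assms(1), of "blinfun_apply p" v]
      linear_basis_expand[OF assms(1), of "blinfun_apply q" v] assms(2)
    by (simp add: bounded_linear.linear[OF blinfun.bounded_linear_right])
qed

lemma dual_basis_expand:
  assumes "is_basis n e"
  shows "(q :: 'v::real_normed_vector \<Rightarrow>\<^sub>L real) = (\<Sum>i<n. blinfun_apply q (e i) *\<^sub>R dual_basis n e i)"
  by (rule blinfun_eq_on_basis[OF assms])
    (simp add: blinfun.sum_left blinfun.scaleR_left dual_basis_apply[OF assms]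
      coord_basis[OF assms] if_distrib cong: if_cong)

subsection \<open>Smooth maps\<close>

lemma frechet_derivativeI:
  "(h has_derivative h') (at p) \<Longrightarrow> frechet_derivative h (at p) = h'"
  using frechet_derivative_at by metis

lemma has_derivative_frechet:
  "h differentiable (at p) \<Longrightarrow> (h has_derivative frechet_derivative h (at p)) (at p)"
  using frechet_derivative_works by blast

lemma Ck_Suc_imp_Ck: "Ck (Suc k) h \<Longrightarrow> Ck k h"
proof (induction k arbitrary: h)
  case 0
  then show ?case
    by (auto intro!: continuous_at_imp_continuous_on differentiable_imp_continuous_within)
next
  case (Suc k)
  then show ?case by (metis Ck.simps(2))
qed

lemma smooth_differentiable: "smooth h \<Longrightarrow> h differentiable (at p)"
  unfolding smooth_def by (metis Ck.simps(2))

lemma smooth_continuous: "smooth h \<Longrightarrow> continuous_on UNIV h"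
  unfolding smooth_def by (metis Ck.simps(1))

lemma smooth_frechet_derivative: "smooth h \<Longrightarrow> smooth (\<lambda>p. frechet_derivative h (at p) v)"
  unfolding smooth_def by (metis Ck.simps(2))

lemma Ck_const: "Ck k (\<lambda>_. c)"
  by (induction k arbitrary: c) simp_all

lemma smooth_const [simp]: "smooth (\<lambda>_. c)"
  by (simp add: smooth_def Ck_const)

lemma Ck_add: "Ck k g \<Longrightarrow> Ck k h \<Longrightarrow> Ck k (\<lambda>p. g p + h p)"
proof (induction k arbitrary: g h)
  case 0
  then show ?case by (simp add: continuous_on_add)
next
  case (Suc k)
  then have d: "frechet_derivative (\<lambda>p. g p + h p) (at p)
      = (\<lambda>v. frechet_derivative g (at p) v + frechet_derivative h (at p) v)" for p
    by (intro frechet_derivativeI has_derivative_add has_derivative_frechet) auto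
  show ?case using Suc by (auto simp: d)
qed

lemma smooth_add: "smooth g \<Longrightarrow> smooth h \<Longrightarrow> smooth (\<lambda>p. g p + h p)"
  by (simp add: smooth_def Ck_add)

lemma (in bounded_linear) Ck_compose: "Ck k h \<Longrightarrow> Ck k (\<lambda>p. f (h p))"
proof (induction k arbitrary: h)
  case 0
  then show ?case by (simp add: continuous_on)
next
  case (Suc k)
  then have d: "((\<lambda>p. f (h p)) has_derivative (\<lambda>v. f (frechet_derivative h (at p) v))) (at p)" for p
    by (intro has_derivative has_derivative_frechet) auto
  show ?case using Suc
    by (auto simp: frechet_derivativeI[OF d] intro: differentiableI[OF d])
qed

lemma (in bounded_linear) smooth_compose: "smooth h \<Longrightarrow> smooth (\<lambda>p. f (h p))"
  by (simp add: smooth_def Ck_compose)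

lemma (in bounded_bilinear) Ck_prod:
  "Ck k g \<Longrightarrow> Ck k h \<Longrightarrow> Ck k (\<lambda>p. prod (g p) (h p))"
proof (induction k arbitrary: g h)
  case 0
  then show ?case by (simp add: continuous_on)
next
  case (Suc k)
  then have d: "((\<lambda>p. prod (g p) (h p)) has_derivative
      (\<lambda>v. prod (g p) (frechet_derivative h (at p) v)
        + prod (frechet_derivative g (at p) v) (h p))) (at p)" for p
    by (intro FDERIV has_derivative_frechet) auto
  \<comment> \<open>The derivative of the product contains the undifferentiated factors, which must
    be of class \<open>Ck k\<close> as well.\<close>
  have "Ck k g" "Ck k h" using Suc.prems Ck_Suc_imp_Ck by blast+
  then show ?case using Suc
    by (auto simp: frechet_derivativeI[OF d] intro!: Ck_add intro: differentiableI[OF d])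
qed

lemma (in bounded_bilinear) smooth_prod:
  "smooth g \<Longrightarrow> smooth h \<Longrightarrow> smooth (\<lambda>p. prod (g p) (h p))"
  by (simp add: smooth_def Ck_prod)

lemmas smooth_scaleR = bounded_bilinear.smooth_prod[OF bounded_bilinear_scaleR]
lemmas smooth_mult = bounded_bilinear.smooth_prod[OF bounded_bilinear_mult]
lemmas smooth_minus = bounded_linear.smooth_compose[OF bounded_linear_minus[OF bounded_linear_ident]]
lemmas smooth_fst = bounded_linear.smooth_compose[OF bounded_linear_fst]
lemmas smooth_snd = bounded_linear.smooth_compose[OF bounded_linear_snd]

lemma smooth_diff: "smooth g \<Longrightarrow> smooth h \<Longrightarrow> smooth (\<lambda>p. g p - h p)"
  using smooth_add[of g "\<lambda>p. - h p"] smooth_minus[of h] by simp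

lemma smooth_sum:
  "(\<And>i. i \<in> I \<Longrightarrow> smooth (g i)) \<Longrightarrow> smooth (\<lambda>p. \<Sum>i\<in>I. g i p)"
  by (induction I rule: infinite_finite_induct) (auto intro: smooth_add)

lemma Ck_ident: "Ck k (\<lambda>p. p)"
  by (cases k) (simp_all add: Ck_const)

lemma smooth_ident: "smooth (\<lambda>p. p)"
  by (simp add: smooth_def Ck_ident)

lemma smooth_linear: "bounded_linear g \<Longrightarrow> smooth g"
  using bounded_linear.smooth_compose[OF _ smooth_ident] .

subsection \<open>Symmetry of second derivatives\<close>

abbreviation dder :: "'a::real_normed_vector \<Rightarrow> ('a \<Rightarrow> 'c::real_normed_vector) \<Rightarrow> 'a \<Rightarrow> 'c"
  where "dder v h \<equiv> (\<lambda>p. frechet_derivative h (at p) v)"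

lemma smooth_line_derivative:
  fixes h :: "'a::real_normed_vector \<Rightarrow> real"
  assumes "smooth h"
  shows "((\<lambda>t. h (p + t *\<^sub>R u)) has_real_derivative dder u h (p + t *\<^sub>R u)) (at t)"
proof -
  have h: "(h has_derivative frechet_derivative h (at (p + t *\<^sub>R u))) (at (p + t *\<^sub>R u))"
    by (intro has_derivative_frechet smooth_differentiable assms)
  have "((\<lambda>t. h (p + t *\<^sub>R u)) has_derivative
      (\<lambda>s. frechet_derivative h (at (p + t *\<^sub>R u)) (s *\<^sub>R u))) (at t)"
    by (rule has_derivative_compose[where f = "\<lambda>t. p + t *\<^sub>R u" and g = h, OF _ h])
      (auto intro!: derivative_eq_intros)
  also have "(\<lambda>s. frechet_derivative h (at (p + t *\<^sub>R u)) (s *\<^sub>R u)) = (*) (dder u h (p + t *\<^sub>R u))"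
    using linear_scale[OF has_derivative_linear[OF h]] by (simp add: fun_eq_iff)
  finally show ?thesis
    unfolding has_field_derivative_def .
qed

text \<open>The mean value theorem is used twice: along \<open>u\<close> for the difference of
  \<open>h\<close> in direction \<open>v\<close>, then along \<open>v\<close> for the derivative of
  \<open>h\<close> in direction \<open>u\<close>. The left-hand side is symmetric in
  \<open>u\<close> and \<open>v\<close>, which is what Schwarz's theorem needs.\<close>

lemma second_difference:
  fixes h :: "'a::real_normed_vector \<Rightarrow> real"
  assumes h: "smooth h" and t: "t > 0"
  shows "\<exists>a b. 0 < a \<and> a < t \<and> 0 < b \<and> b < t \<and>
    h (p + t *\<^sub>R u + t *\<^sub>R v) - h (p + t *\<^sub>R u) - h (p + t *\<^sub>R v) + h p
      = t * t * dder v (dder u h) (p + a *\<^sub>R u + b *\<^sub>R v)"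
proof -
  define g where "g = (\<lambda>a. h (p + t *\<^sub>R v + a *\<^sub>R u) - h (p + a *\<^sub>R u))"
  have "\<exists>a. 0 < a \<and> a < t \<and> g t - g 0 = (t - 0) * (dder u h (p + t *\<^sub>R v + a *\<^sub>R u) - dder u h (p + a *\<^sub>R u))"
    by (rule MVT2[OF t]) (auto simp: g_def intro!: DERIV_diff smooth_line_derivative h)
  then obtain a where a: "0 < a" "a < t"
    "g t - g 0 = t * (dder u h (p + t *\<^sub>R v + a *\<^sub>R u) - dder u h (p + a *\<^sub>R u))" by auto
  define k where "k = (\<lambda>b. dder u h ((p + a *\<^sub>R u) + b *\<^sub>R v))"
  have "\<exists>b. 0 < b \<and> b < t \<and> k t - k 0 = (t - 0) * dder v (dder u h) (p + a *\<^sub>R u + b *\<^sub>R v)"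
    by (rule MVT2[OF t])
      (auto simp: k_def intro!: smooth_line_derivative smooth_frechet_derivative h)
  then obtain b where b: "0 < b" "b < t"
    "k t - k 0 = t * dder v (dder u h) (p + a *\<^sub>R u + b *\<^sub>R v)" by auto
  have "g t - g 0 = t * (k t - k 0)" by (simp add: a(3) k_def algebra_simps)
  with a b show ?thesis
    by (intro exI[of _ a] exI[of _ b]) (simp add: g_def algebra_simps)
qed

text \<open>Both mixed derivatives are the limit of the second difference divided by
  \<open>t k * t k\<close>; only continuity of iterated directional derivatives enters. It makes the
  second-order terms cancel in the commutator of two anchors.\<close>

lemma second_derivative_symmetric:
  fixes h :: "'a::real_normed_vector \<Rightarrow> real"
  assumes h: "smooth h"
  shows "dder v (dder u h) p = dder u (dder v h) p"
proof -
  define t where "t k = inverse (real (Suc k))" for k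
  have t: "\<And>k. t k > 0" "t \<longlonglongrightarrow> 0"
    using LIMSEQ_inverse_real_of_nat by (simp_all add: t_def[abs_def] del: of_nat_Suc)
  have *: "\<exists>c d. \<forall>k. 0 < c k \<and> c k < t k \<and> 0 < d k \<and> d k < t k \<and>
    h (p + t k *\<^sub>R u + t k *\<^sub>R v) - h (p + t k *\<^sub>R u) - h (p + t k *\<^sub>R v) + h p
      = t k * t k * dder v (dder u h) (p + c k *\<^sub>R u + d k *\<^sub>R v)" for u v
    using second_difference[OF h t(1), where p = p and u = u and v = v] by metis
  have lim: "(\<lambda>k. dder v (dder u h) (p + c k *\<^sub>R u + d k *\<^sub>R v)) \<longlonglongrightarrow> dder v (dder u h) p"
    if "\<And>k. 0 < c k" "\<And>k. c k < t k" "\<And>k. 0 < d k" "\<And>k. d k < t k" for u v c d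
  proof -
    have "c \<longlonglongrightarrow> 0" "d \<longlonglongrightarrow> 0"
      by (rule tendsto_sandwich[OF _ _ tendsto_const t(2)];
          auto intro!: always_eventually less_imp_le that)+
    then have "(\<lambda>k. p + c k *\<^sub>R u + d k *\<^sub>R v) \<longlonglongrightarrow> p + 0 *\<^sub>R u + 0 *\<^sub>R v"
      by (intro tendsto_intros)
    moreover have "isCont (dder v (dder u h)) p"
      using smooth_continuous[OF smooth_frechet_derivative[OF smooth_frechet_derivative[OF h]]]
      by (simp add: continuous_on_eq_continuous_at)
    ultimately show ?thesis using isCont_tendsto_compose by fastforce
  qed
  obtain c d where cd: "\<And>k. 0 < c k" "\<And>k. c k < t k" "\<And>k. 0 < d k" "\<And>k. d k < t k"
    "\<And>k. h (p + t k *\<^sub>R u + t k *\<^sub>R v) - h (p + t k *\<^sub>R u) - h (p + t k *\<^sub>R v) + h p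
      = t k * t k * dder v (dder u h) (p + c k *\<^sub>R u + d k *\<^sub>R v)" using *[of u v] by blast
  obtain c' d' where cd': "\<And>k. 0 < c' k" "\<And>k. c' k < t k" "\<And>k. 0 < d' k" "\<And>k. d' k < t k"
    "\<And>k. h (p + t k *\<^sub>R v + t k *\<^sub>R u) - h (p + t k *\<^sub>R v) - h (p + t k *\<^sub>R u) + h p
      = t k * t k * dder u (dder v h) (p + c' k *\<^sub>R v + d' k *\<^sub>R u)" using *[of v u] by blast
  have "dder v (dder u h) (p + c k *\<^sub>R u + d k *\<^sub>R v)
      = dder u (dder v h) (p + c' k *\<^sub>R v + d' k *\<^sub>R u)" for k
  proof -
    have "t k * t k * dder v (dder u h) (p + c k *\<^sub>R u + d k *\<^sub>R v)
      = t k * t k * dder u (dder v h) (p + c' k *\<^sub>R v + d' k *\<^sub>R u)"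
      unfolding cd(5)[symmetric] cd'(5)[symmetric] by (simp add: algebra_simps)
    then show ?thesis using t(1)[of k] by simp
  qed
  then show ?thesis
    using lim[OF cd(1-4), where u = u and v = v] lim[OF cd'(1-4), where u = v and v = u] by (simp add: LIMSEQ_unique)
qed

subsection \<open>Products of odd generators\<close>

text \<open>\<open>gsign\<close> is -1 to the number of inversions, and inversions add up over a
  disjoint union.\<close>

lemma gsign_Un_left:
  assumes "finite A" "finite B" "finite C" "A \<inter> B = {}"
  shows "gsign (A \<union> B) C = gsign A C * gsign B C"
proof -
  have fin: "finite {(s, t). s \<in> D \<and> t \<in> C \<and> t < s}" if "finite D" for D
    by (rule finite_subset[of _ "D \<times> C"]) (use assms that in auto)
  have "{(s, t). s \<in> A \<union> B \<and> t \<in> C \<and> t < s}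
      = {(s, t). s \<in> A \<and> t \<in> C \<and> t < s} \<union> {(s, t). s \<in> B \<and> t \<in> C \<and> t < s}" by auto
  moreover have "card \<dots> = card {(s, t). s \<in> A \<and> t \<in> C \<and> t < s}
      + card {(s, t). s \<in> B \<and> t \<in> C \<and> t < s}"
    by (rule card_Un_disjoint) (use assms fin in auto)
  ultimately show ?thesis by (simp add: gsign_def power_add)
qed

lemma gsign_Un_right:
  assumes "finite A" "finite B" "finite C" "B \<inter> C = {}"
  shows "gsign A (B \<union> C) = gsign A B * gsign A C"
proof -
  have fin: "finite {(s, t). s \<in> A \<and> t \<in> D \<and> t < s}" if "finite D" for D
    by (rule finite_subset[of _ "A \<times> D"]) (use assms that in auto)
  have "{(s, t). s \<in> A \<and> t \<in> B \<union> C \<and> t < s}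
      = {(s, t). s \<in> A \<and> t \<in> B \<and> t < s} \<union> {(s, t). s \<in> A \<and> t \<in> C \<and> t < s}" by auto
  moreover have "card \<dots> = card {(s, t). s \<in> A \<and> t \<in> B \<and> t < s}
      + card {(s, t). s \<in> A \<and> t \<in> C \<and> t < s}"
    by (rule card_Un_disjoint) (use assms fin in auto)
  ultimately show ?thesis by (simp add: gsign_def power_add)
qed

text \<open>Each pair in \<open>A \<times> B\<close> is an inversion for exactly one of the two
  orders, so the two inversion counts add up to \<open>card A * card B\<close>.\<close>

lemma gsign_swap:
  assumes "finite A" "finite B" "A \<inter> B = {}"
  shows "gsign A B = (-1) ^ (card A * card B) * gsign B A"
proof -
  have fin: "finite {(s, t). s \<in> A \<and> t \<in> B \<and> t < s}" "finite {(s, t). s \<in> A \<and> t \<in> B \<and> s < t}"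
    by (rule finite_subset[of _ "A \<times> B"]; use assms in auto)+
  have "card (A \<times> B) = card ({(s, t). s \<in> A \<and> t \<in> B \<and> t < s} \<union> {(s, t). s \<in> A \<and> t \<in> B \<and> s < t})"
    using assms(3) by (intro arg_cong[where f = card]) force
  also have "\<dots> = card {(s, t). s \<in> A \<and> t \<in> B \<and> t < s} + card {(s, t). s \<in> A \<and> t \<in> B \<and> s < t}"
    by (rule card_Un_disjoint) (use fin in auto)
  also have "card {(s, t). s \<in> A \<and> t \<in> B \<and> s < t} = card {(s, t). s \<in> B \<and> t \<in> A \<and> t < s}"
    by (rule bij_betw_same_card[of prod.swap]) (auto simp: bij_betw_def inj_on_def image_iff)
  finally have "card A * card B = card {(s, t). s \<in> A \<and> t \<in> B \<and> t < s}
      + card {(s, t). s \<in> B \<and> t \<in> A \<and> t < s}"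
    by (simp add: card_cartesian_product)
  then show ?thesis by (simp add: gsign_def power_add mult.assoc flip: power_mult_distrib)
qed

text \<open>The sign for moving the j-th odd generator to the front of an ordered product. It
  governs both left multiplication and left derivative, and as its square is 1, the derivative
  undoes the multiplication.\<close>

definition sign_below :: "nat \<Rightarrow> nat set \<Rightarrow> real" where
  "sign_below j S = (-1) ^ card {s \<in> S. s < j}"

lemma gsign_singleton: "gsign {j} S = sign_below j S"
proof -
  have "{(s, t). s \<in> {j} \<and> t \<in> S \<and> t < s} = Pair j ` {s \<in> S. s < j}" by auto
  then show ?thesis by (simp add: gsign_def sign_below_def card_image inj_on_def)
qed

lemma sign_below_insert:
  assumes "finite S" "k \<notin> S"
  shows "sign_below j (insert k S) = (if k < j then - sign_below j S else sign_below j S)"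
proof -
  have "{s \<in> insert k S. s < j} = (if k < j then insert k {s \<in> S. s < j} else {s \<in> S. s < j})"
    by auto
  then show ?thesis using assms by (simp add: sign_below_def)
qed

lemma sign_below_remove:
  assumes "finite S" "k \<in> S"
  shows "sign_below j (S - {k}) = (if k < j then - sign_below j S else sign_below j S)"
  using sign_below_insert[of "S - {k}" k j] assms by (auto simp: insert_absorb)

lemma sign_below_square [simp]: "sign_below j S * sign_below j S = 1" "sign_below j S * (sign_below j S * c) = c"
  by (simp_all add: sign_below_def mult.assoc[symmetric] flip: power_mult_distrib)

text \<open>Keeps the inner sums of \<open>gmul\<close> genuine: a sum over an infinite set would be
  0 by convention.\<close>

lemma finite_submultisets: "finite {L. L \<subseteq># (K :: 'a multiset)}"
proof (induction K)
  case (add a K)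
  have "{L. L \<subseteq># add_mset a K} \<subseteq> {L. L \<subseteq># K} \<union> add_mset a ` {L. L \<subseteq># K}"
  proof
    fix L assume L: "L \<in> {L. L \<subseteq># add_mset a K}"
    show "L \<in> {L. L \<subseteq># K} \<union> add_mset a ` {L. L \<subseteq># K}"
    proof (cases "a \<in># L")
      case True
      then show ?thesis using L
        by (auto simp: image_iff insert_subset_eq_iff dest!: multi_member_split)
    next
      case False
      then have "L \<subseteq># K" using L
        by (metis diff_single_trivial mem_Collect_eq subset_eq_diff_conv add_mset_add_single)
      then show ?thesis by simp
    qed
  qed
  then show ?case by (rule finite_subset) (use add in auto)
qed simp

subsection \<open>The graded algebra\<close>

lemma gmul_infinite: "infinite S \<Longrightarrow> (F \<odot> G) S K p = 0"
  by (simp add: gmul_def)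

lemma gmul_add_left: "(F + G) \<odot> H = F \<odot> H + G \<odot> H"
  by (simp add: fun_eq_iff gmul_def sum.distrib algebra_simps)

lemma gmul_add_right: "F \<odot> (G + H) = F \<odot> G + F \<odot> H"
  by (simp add: fun_eq_iff gmul_def sum.distrib algebra_simps)

lemma gmul_minus_left: "(- F) \<odot> G = - (F \<odot> G)"
  by (simp add: fun_eq_iff gmul_def sum_negf)

lemma gmul_minus_right: "F \<odot> (- G) = - (F \<odot> G)"
  by (simp add: fun_eq_iff gmul_def sum_negf)

lemma gmul_zero_left [simp]: "0 \<odot> F = 0"
  by (simp add: fun_eq_iff gmul_def)

lemma gmul_zero_right [simp]: "F \<odot> 0 = 0"
  by (simp add: fun_eq_iff gmul_def)

lemma gmul_diff_right: "F \<odot> (G - H) = F \<odot> G - F \<odot> H"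
  using gmul_add_right[of F G "- H"] by (simp add: gmul_minus_right)

lemma additive_sum:
  assumes "h 0 = 0" "\<And>x y. h (x + y) = h x + h y"
  shows "h (\<Sum>i\<in>I. F i) = (\<Sum>i\<in>I. h (F i))"
  using sum_comp_morphism[of h F I] assms by (simp add: o_def)

lemma gmul_sum_left: "(\<Sum>i\<in>I. F i) \<odot> G = (\<Sum>i\<in>I. F i \<odot> G)"
  by (rule additive_sum[where h = "\<lambda>F. F \<odot> G"]) (simp_all add: gmul_add_left)

lemma gmul_sum_right: "F \<odot> (\<Sum>i\<in>I. G i) = (\<Sum>i\<in>I. F \<odot> G i)"
  by (rule additive_sum[where h = "\<lambda>G. F \<odot> G"]) (simp_all add: gmul_add_right)

text \<open>The substitution \<open>(T, U) \<mapsto> (U, T - U)\<close> turns nested subsets into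
  two disjoint ones, as associativity of \<open>gmul\<close> requires.\<close>

lemma sum_Pow_reindex:
  fixes g :: "'a set \<Rightarrow> 'a set \<Rightarrow> real"
  assumes "finite S"
  shows "(\<Sum>T\<in>Pow S. \<Sum>U\<in>Pow T. g U T) = (\<Sum>U\<in>Pow S. \<Sum>V\<in>Pow (S - U). g U (U \<union> V))"
proof -
  have fin: "finite (Pow T)" if "T \<subseteq> S" for T using assms that by (simp add: finite_subset)
  have "(\<Sum>T\<in>Pow S. \<Sum>U\<in>Pow T. g U T) = (\<Sum>(T, U)\<in>Sigma (Pow S) Pow. g U T)"
    by (rule sum.Sigma) (use assms fin in auto)
  also have "\<dots> = (\<Sum>(U, V)\<in>Sigma (Pow S) (\<lambda>U. Pow (S - U)). g U (U \<union> V))"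
    by (rule sum.reindex_bij_witness[of _ "\<lambda>(U, V). (U \<union> V, U)" "\<lambda>(T, U). (U, T - U)"])
      (auto simp: Un_absorb1)
  also have "\<dots> = (\<Sum>U\<in>Pow S. \<Sum>V\<in>Pow (S - U). g U (U \<union> V))"
    by (rule sum.Sigma[symmetric]) (use assms in auto)
  finally show ?thesis .
qed

lemma submultiset_diff_mono: "L \<subseteq># K \<Longrightarrow> L - M \<subseteq># K - (M :: 'a multiset)"
  by (simp add: subseteq_mset_def diff_le_mono)

lemma sum_submultiset_reindex:
  fixes g :: "'a multiset \<Rightarrow> 'a multiset \<Rightarrow> real"
  shows "(\<Sum>L | L \<subseteq># K. \<Sum>M | M \<subseteq># L. g M L) = (\<Sum>M | M \<subseteq># K. \<Sum>N | N \<subseteq># K - M. g M (M + N))"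
proof -
  have "(\<Sum>L | L \<subseteq># K. \<Sum>M | M \<subseteq># L. g M L)
      = (\<Sum>(L, M)\<in>Sigma {L. L \<subseteq># K} (\<lambda>L. {M. M \<subseteq># L}). g M L)"
    by (rule sum.Sigma) (auto simp: finite_submultisets)
  also have "\<dots> = (\<Sum>(M, N)\<in>Sigma {L. L \<subseteq># K} (\<lambda>M. {N. N \<subseteq># K - M}). g M (M + N))"
    by (rule sum.reindex_bij_witness[of _ "\<lambda>(M, N). (M + N, M)" "\<lambda>(L, M). (M, L - M)"])
      (auto simp: subset_mset.le_diff_conv2 subset_mset.add_diff_inverse add.commute
        intro: subset_mset.order_trans submultiset_diff_mono)
  also have "\<dots> = (\<Sum>M | M \<subseteq># K. \<Sum>N | N \<subseteq># K - M. g M (M + N))"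
    by (rule sum.Sigma[symmetric]) (auto simp: finite_submultisets)
  finally show ?thesis .
qed

text \<open>Both sides become sums over splittings of \<open>S\<close> into three ordered parts and
  of \<open>K\<close> into three submultisets. The signs agree because each counts the inversions
  between the three parts.\<close>

lemma gmul_assoc: "(F \<odot> G) \<odot> H = F \<odot> (G \<odot> H)"
proof (intro ext)
  fix S K p
  show "((F \<odot> G) \<odot> H) S K p = (F \<odot> (G \<odot> H)) S K p"
  proof (cases "finite S")
    case False
    then show ?thesis by (simp add: gmul_infinite)
  next
    case S: True
    \<comment> \<open>The summand for the parts \<open>U\<close>, \<open>V\<close>,
      \<open>S - U - V\<close>, to which both sides are brought.\<close>
    define A where "A U V M N = gsign (U \<union> V) (S - U - V) * (gsign U V * F U M p * G V N p)
      * H (S - U - V) (K - M - N) p" for U V M N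
    have "((F \<odot> G) \<odot> H) S K p = (\<Sum>T\<in>Pow S. \<Sum>L | L \<subseteq># K. \<Sum>U\<in>Pow T. \<Sum>M | M \<subseteq># L.
        gsign T (S - T) * (gsign U (T - U) * F U M p * G (T - U) (L - M) p) * H (S - T) (K - L) p)"
      by (simp add: gmul_def sum_distrib_left sum_distrib_right)
    also have "\<dots> = (\<Sum>T\<in>Pow S. \<Sum>U\<in>Pow T. \<Sum>L | L \<subseteq># K. \<Sum>M | M \<subseteq># L.
        gsign T (S - T) * (gsign U (T - U) * F U M p * G (T - U) (L - M) p) * H (S - T) (K - L) p)"
      by (intro sum.cong refl sum.swap)
    also have "\<dots> = (\<Sum>U\<in>Pow S. \<Sum>V\<in>Pow (S - U). \<Sum>M | M \<subseteq># K. \<Sum>N | N \<subseteq># K - M. A U V M N)"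
      unfolding sum_Pow_reindex[OF S] sum_submultiset_reindex
    proof (intro sum.cong refl)
      fix U V M N assume "U \<in> Pow S" "V \<in> Pow (S - U)"
      then have "U \<union> V - U = V" "S - (U \<union> V) = S - U - V" by auto
      then show "gsign (U \<union> V) (S - (U \<union> V)) *
          (gsign U (U \<union> V - U) * F U M p * G (U \<union> V - U) (M + N - M) p) *
          H (S - (U \<union> V)) (K - (M + N)) p = A U V M N"
        by (simp add: A_def)
    qed
    also have "\<dots> = (\<Sum>U\<in>Pow S. \<Sum>M | M \<subseteq># K. \<Sum>V\<in>Pow (S - U). \<Sum>N | N \<subseteq># K - M. A U V M N)"
      by (intro sum.cong refl sum.swap)
    also have "\<dots> = (F \<odot> (G \<odot> H)) S K p"
      unfolding gmul_def sum_distrib_left sum_distrib_right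
    proof (intro sum.cong refl)
      fix U V M N assume UV: "U \<in> Pow S" "V \<in> Pow (S - U)"
      have fin: "finite U" "finite V" "finite (S - U - V)"
        using S UV by (auto intro: finite_subset)
      have "gsign (U \<union> V) (S - U - V) = gsign U (S - U - V) * gsign V (S - U - V)"
        using fin UV by (intro gsign_Un_left) auto
      moreover have "gsign U (V \<union> (S - U - V)) = gsign U V * gsign U (S - U - V)"
        using fin UV by (intro gsign_Un_right) auto
      moreover have "V \<union> (S - U - V) = S - U" using UV by auto
      ultimately show "A U V M N = gsign U (S - U) * F U M p *
          (gsign V (S - U - V) * G V N p * H (S - U - V) (K - M - N) p)"
        by (simp add: A_def mult_ac)
    qed
    finally show ?thesis .
  qed
qed

lemma monomial_gmul:
  "(monomial S K h \<odot> F) S' K' p =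
     (if finite S' \<and> S \<subseteq> S' \<and> K \<subseteq># K' then gsign S (S' - S) * h p * F (S' - S) (K' - K) p else 0)"
proof (cases "finite S'")
  case True
  have "(monomial S K h \<odot> F) S' K' p =
      (\<Sum>T\<in>Pow S'. \<Sum>L | L \<subseteq># K'. if T = S then
        if L = K then gsign S (S' - S) * h p * F (S' - S) (K' - K) p else 0 else 0)"
    unfolding gmul_def monomial_def by (intro sum.cong refl) auto
  also have "\<dots> = (\<Sum>T\<in>Pow S'. if T = S then
      \<Sum>L | L \<subseteq># K'. if L = K then gsign S (S' - S) * h p * F (S' - S) (K' - K) p else 0 else 0)"
    by (intro sum.cong refl) auto
  also have "\<dots> = (if finite S' \<and> S \<subseteq> S' \<and> K \<subseteq># K' then gsign S (S' - S) * h p * F (S' - S) (K' - K) p else 0)"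
    using True by (simp add: sum.delta' sum.delta finite_submultisets)
  finally show ?thesis .
qed (simp add: gmul_infinite)

definition eta :: "nat \<Rightarrow> 'b gfun" where
  "eta j = monomial {j} {#} (\<lambda>_. 1)"

lemma xi_eta: "xi a = eta (2 * a)" and theta_eta: "theta a = eta (Suc (2 * a))"
  by (simp_all add: xi_def theta_def eta_def)

text \<open>\<open>Pow S\<close> is infinite for infinite \<open>S\<close>, so every product
  vanishes there; the constant 1 is a unit only for arrays that vanish at infinite index
  sets.\<close>

definition odd_finite :: "'b gfun \<Rightarrow> bool" where
  "odd_finite F \<longleftrightarrow> (\<forall>S K. infinite S \<longrightarrow> F S K = 0)"

lemma odd_finite_gmul [simp]: "odd_finite (F \<odot> G)"
  by (auto simp: odd_finite_def gmul_infinite)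

lemma odd_finite_simps [simp]:
  "odd_finite 0" "odd_finite (fn h)" "odd_finite (eta j)" "odd_finite (pvar i)"
  by (auto simp: odd_finite_def fn_def eta_def pvar_def monomial_def)

lemma odd_finite_add [simp]: "odd_finite F \<Longrightarrow> odd_finite G \<Longrightarrow> odd_finite (F + G)"
  and odd_finite_minus [simp]: "odd_finite F \<Longrightarrow> odd_finite (- F)"
  by (auto simp: odd_finite_def)

lemma odd_finite_sum [simp]: "(\<And>i. i \<in> I \<Longrightarrow> odd_finite (F i)) \<Longrightarrow> odd_finite (\<Sum>i\<in>I. F i)"
  by (induction I rule: infinite_finite_induct) auto

lemma fn_gmul: "(fn h \<odot> F) S K p = (if finite S then h p * F S K p else 0)"
  by (simp add: fn_def monomial_gmul gsign_def)

lemma eta_gmul: "(eta j \<odot> F) S K p =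
    (if finite S \<and> j \<in> S then sign_below j S * F (S - {j}) K p else 0)"
  by (auto simp: eta_def monomial_gmul gsign_singleton sign_below_remove)

lemma pvar_gmul: "(pvar i \<odot> F) S K p = (if finite S \<and> i \<in># K then F S (K - {#i#}) p else 0)"
  by (simp add: pvar_def monomial_gmul gsign_def)

lemma fn_one_gmul: "odd_finite F \<Longrightarrow> fn (\<lambda>_. 1) \<odot> F = F"
  by (auto simp: fun_eq_iff fn_gmul odd_finite_def)

lemma fn_fn: "fn g \<odot> fn h = fn (\<lambda>p. g p * h p)"
  by (auto simp: fun_eq_iff fn_gmul) (auto simp: fn_def monomial_def)

lemma fn_add: "fn (\<lambda>p. g p + h p) = fn g + fn h"
  by (auto simp: fun_eq_iff fn_def monomial_def)

lemma fn_minus: "fn (\<lambda>p. - h p) = - fn h"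
  by (auto simp: fun_eq_iff fn_def monomial_def)

lemma fn_zero: "fn (\<lambda>_. 0) = 0"
  by (auto simp: fun_eq_iff fn_def monomial_def)

lemma fn_sum: "fn (\<lambda>p. \<Sum>i\<in>I. h i p) = (\<Sum>i\<in>I. fn (h i))"
  by (induction I rule: infinite_finite_induct) (simp_all add: fn_add fn_zero)

text \<open>The trailing factor \<open>F\<close> is there for rewriting inside right-nested
  products. For \<open>j = k\<close> both sides are 0.\<close>

lemma eta_anticommute: "eta j \<odot> (eta k \<odot> F) = - (eta k \<odot> (eta j \<odot> F))"
proof (intro ext)
  fix S K p
  have "S - {j} - {k} = S - {k} - {j}" by auto
  then show "(eta j \<odot> (eta k \<odot> F)) S K p = (- (eta k \<odot> (eta j \<odot> F))) S K p"
    by (cases j k rule: linorder_cases) (auto simp: eta_gmul sign_below_remove)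
qed

lemma fn_eta_commute: "fn h \<odot> (eta j \<odot> F) = eta j \<odot> (fn h \<odot> F)"
  by (auto simp: fun_eq_iff eta_gmul fn_gmul)

lemma fn_pvar_commute: "fn h \<odot> (pvar i \<odot> F) = pvar i \<odot> (fn h \<odot> F)"
  by (auto simp: fun_eq_iff pvar_gmul fn_gmul)

lemma pvar_eta_commute: "pvar i \<odot> (eta j \<odot> F) = eta j \<odot> (pvar i \<odot> F)"
  by (auto simp: fun_eq_iff pvar_gmul eta_gmul)

lemma pvar_pvar_commute: "pvar i \<odot> (pvar j \<odot> F) = pvar j \<odot> (pvar i \<odot> F)"
  by (auto simp: fun_eq_iff pvar_gmul in_diff_count add_mset_commute)

subsection \<open>Parity\<close>

text \<open>\<open>True\<close> means even. Since the variables \<open>x\<close> and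
  \<open>p\<close> have even degree, this is the parity of the total degree. Finiteness of
  \<open>S\<close> is included because an infinite set has cardinality 0 and would count as
  even.\<close>

definition parity :: "bool \<Rightarrow> 'b gfun \<Rightarrow> bool" where
  "parity b F \<longleftrightarrow> (\<forall>S K. F S K \<noteq> 0 \<longrightarrow> finite S \<and> even (card S) = b)"

lemma parity_add: "parity b F \<Longrightarrow> parity b G \<Longrightarrow> parity b (F + G)"
  unfolding parity_def by (metis add.right_neutral plus_fun_apply)

lemma parity_zero: "parity b 0"
  by (simp add: parity_def)

lemma parity_minus: "parity b F \<Longrightarrow> parity b (- F)"
  by (simp add: parity_def)

lemma parity_sum: "(\<And>i. i \<in> I \<Longrightarrow> parity b (F i)) \<Longrightarrow> parity b (\<Sum>i\<in>I. F i)"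
  by (induction I rule: infinite_finite_induct) (auto intro: parity_add parity_zero)

lemma gmul_nonzero:
  assumes "(F \<odot> G) S K \<noteq> 0"
  obtains T L where "finite S" "T \<subseteq> S" "L \<subseteq># K" "F T L \<noteq> 0" "G (S - T) (K - L) \<noteq> 0"
proof -
  obtain p where p: "(F \<odot> G) S K p \<noteq> 0" using assms by (auto simp: fun_eq_iff)
  then have "finite S" using gmul_infinite by metis
  from p obtain T where "T \<in> Pow S"
    "(\<Sum>L | L \<subseteq># K. gsign T (S - T) * F T L p * G (S - T) (K - L) p) \<noteq> 0"
    unfolding gmul_def by (rule sum.not_neutral_contains_not_neutral)
  moreover from this(2) obtain L where "L \<subseteq># K" "gsign T (S - T) * F T L p * G (S - T) (K - L) p \<noteq> 0"
    by (rule sum.not_neutral_contains_not_neutral) auto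
  ultimately show ?thesis using that[of T L] \<open>finite S\<close> by (auto simp: fun_eq_iff)
qed

lemma parity_gmul:
  assumes "parity a F" "parity b G"
  shows "parity (a = b) (F \<odot> G)"
  unfolding parity_def
proof (intro allI impI)
  fix S K assume "(F \<odot> G) S K \<noteq> 0"
  then obtain T L where T: "finite S" "T \<subseteq> S" "F T L \<noteq> 0" "G (S - T) (K - L) \<noteq> 0"
    by (rule gmul_nonzero)
  then have "card S = card T + card (S - T)"
    by (metis card_Diff_subset card_mono finite_subset le_add_diff_inverse)
  then show "finite S \<and> even (card S) = (a = b)"
    using assms T unfolding parity_def by (metis even_add)
qed

lemma parity_fn: "parity True (fn h)"
  and parity_eta: "parity False (eta j)"
  and parity_pvar: "parity True (pvar i)"
  by (auto simp: parity_def fn_def eta_def pvar_def monomial_def split: if_splits)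

lemma multiset_double_diff: "L \<subseteq># K \<Longrightarrow> K - (K - L) = (L :: 'a multiset)"
  by (simp add: multiset_eq_iff subseteq_mset_def)

text \<open>Complementation \<open>T \<mapsto> S - T\<close>, \<open>L \<mapsto> K - L\<close>
  exchanges the factors, and \<open>gsign_swap\<close> gives a sign that depends only on the two
  parities.\<close>

lemma graded_commute:
  assumes "parity a F" "parity b G"
  shows "F \<odot> G = (if a \<or> b then G \<odot> F else - (G \<odot> F))"
proof (intro ext)
  fix S K p
  define c :: real where "c = (if a \<or> b then 1 else -1)"
  have "(F \<odot> G) S K p = c * (G \<odot> F) S K p"
  proof (cases "finite S")
    case S: True
    have "(F \<odot> G) S K p = (\<Sum>T\<in>Pow S. \<Sum>L | L \<subseteq># K.
        gsign (S - T) T * F (S - T) (K - L) p * G T L p)"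
      unfolding gmul_def
    proof (rule sum.reindex_bij_witness[of _ "\<lambda>T. S - T" "\<lambda>T. S - T"])
      fix T assume T: "T \<in> Pow S"
      then have "S - (S - T) = T" by auto
      then show "(\<Sum>L | L \<subseteq># K. gsign (S - (S - T)) (S - T) * F (S - (S - T)) (K - L) p * G (S - T) L p)
        = (\<Sum>L | L \<subseteq># K. gsign T (S - T) * F T L p * G (S - T) (K - L) p)"
        by (intro sum.reindex_bij_witness[of _ "\<lambda>L. K - L" "\<lambda>L. K - L"])
          (auto simp: multiset_double_diff)
    qed auto
    also have "\<dots> = (\<Sum>T\<in>Pow S. \<Sum>L | L \<subseteq># K. c * (gsign T (S - T) * G T L p * F (S - T) (K - L) p))"
    proof (intro sum.cong refl)
      fix T L assume T: "T \<in> Pow S"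
      show "gsign (S - T) T * F (S - T) (K - L) p * G T L p
        = c * (gsign T (S - T) * G T L p * F (S - T) (K - L) p)"
      proof (cases "F (S - T) (K - L) = 0 \<or> G T L = 0")
        case False
        then have "even (card (S - T)) = a" "even (card T) = b" using assms by (auto simp: parity_def)
        moreover have "gsign (S - T) T = (-1) ^ (card (S - T) * card T) * gsign T (S - T)"
          using S T by (intro gsign_swap) (auto intro: finite_subset)
        ultimately show ?thesis by (simp add: c_def mult_ac minus_one_power_iff)
      qed auto
    qed
    finally show ?thesis by (simp add: gmul_def sum_distrib_left)
  qed (simp add: gmul_infinite)
  then show "(F \<odot> G) S K p = (if a \<or> b then G \<odot> F else - (G \<odot> F)) S K p"
    by (auto simp: c_def)
qed

subsection \<open>Derivatives of products with a generator\<close>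

lemma dleft_eq: "dleft j F = (\<lambda>S K p. if j \<in> S then 0 else sign_below j S * F (insert j S) K p)"
  by (auto simp: fun_eq_iff dleft_def sign_below_def)

lemma dleft_add: "dleft j (F + G) = dleft j F + dleft j G"
  by (simp add: fun_eq_iff dleft_eq algebra_simps)

lemma dleft_minus: "dleft j (- F) = - dleft j F"
  by (simp add: fun_eq_iff dleft_eq)

lemma dleft_zero [simp]: "dleft j 0 = 0"
  by (simp add: fun_eq_iff dleft_eq)

lemma dleft_sum: "dleft j (\<Sum>i\<in>I. F i) = (\<Sum>i\<in>I. dleft j (F i))"
  by (rule additive_sum[where h = "dleft j"]) (simp_all add: dleft_add)

lemma dleft_fn [simp]: "dleft j (fn h) = 0"
  by (auto simp: fun_eq_iff dleft_eq fn_def monomial_def)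

lemma dleft_eta: "dleft j (eta k) = (if j = k then fn (\<lambda>_. 1) else 0)"
  by (auto simp: fun_eq_iff dleft_eq eta_def fn_def monomial_def sign_below_def)

lemma dleft_fn_gmul: "dleft j (fn h \<odot> F) = fn h \<odot> dleft j F"
  by (auto simp: fun_eq_iff dleft_eq fn_gmul)

lemma dleft_pvar_gmul: "dleft j (pvar i \<odot> F) = pvar i \<odot> dleft j F"
  by (auto simp: fun_eq_iff dleft_eq pvar_gmul)

text \<open>Moving the derivative past \<open>eta k\<close> costs a sign. \<open>odd_finite\<close>
  enters because multiplication by \<open>eta k\<close> erases components at infinite index sets,
  from which \<open>F\<close> could not be recovered.\<close>

lemma dleft_eta_gmul:
  assumes "odd_finite F"
  shows "dleft j (eta k \<odot> F) = (if j = k then F else 0) - eta k \<odot> dleft j F"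
proof (intro ext)
  fix S K p
  show "dleft j (eta k \<odot> F) S K p = ((if j = k then F else 0) - eta k \<odot> dleft j F) S K p"
  proof (cases "finite S")
    case False
    then show ?thesis using assms by (simp add: dleft_eq eta_gmul odd_finite_def)
  next
    case S: True
    have *: "insert j S - {k} = insert j (S - {k})" if "j \<noteq> k" using that by auto
    show ?thesis
      using S by (auto simp: dleft_eq eta_gmul sign_below_insert sign_below_remove insert_absorb *)
  qed
qed

text \<open>Bringing the generator from one end of a monomial to the other passes all remaining odd
  generators; their number is odd if \<open>F\<close> is even, and even if \<open>F\<close> is
  odd.\<close>

lemma dright_parity:
  assumes "parity b F"
  shows "dright j F = (if b then - dleft j F else dleft j F)"
proof (intro ext)
  fix S K p
  show "dright j F S K p = (if b then - dleft j F else dleft j F) S K p"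
  proof (cases "j \<in> S \<or> F (insert j S) K = 0")
    case True
    then show ?thesis by (auto simp: dright_def dleft_def)
  next
    case False
    then have S: "finite S" "even (card (insert j S)) = b" "j \<notin> S"
      using assms by (auto simp: parity_def)
    have "s < j \<or> j < s" if "s \<in> S" for s
      using that S(3) by (cases s j rule: linorder_cases) auto
    then have "{s \<in> S. s < j} \<union> {s \<in> S. j < s} = S" by blast
    moreover have "card ({s \<in> S. s < j} \<union> {s \<in> S. j < s}) = card {s \<in> S. s < j} + card {s \<in> S. j < s}"
      by (rule card_Un_disjoint) (use S(1) in auto)
    ultimately have "card S = card {s \<in> S. s < j} + card {s \<in> S. j < s}" by simp
    then show ?thesis using S by (auto simp: dright_def dleft_def minus_one_power_iff)
  qed
qed

lemma dp_add: "dp i (F + G) = dp i F + dp i G"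
  by (simp add: fun_eq_iff dp_def algebra_simps)

lemma dp_minus: "dp i (- F) = - dp i F"
  by (simp add: fun_eq_iff dp_def)

lemma dp_zero [simp]: "dp i 0 = 0"
  by (simp add: fun_eq_iff dp_def)

lemma dp_sum: "dp i (\<Sum>j\<in>I. F j) = (\<Sum>j\<in>I. dp i (F j))"
  by (rule additive_sum[where h = "dp i"]) (simp_all add: dp_add)

lemma dp_fn [simp]: "dp i (fn h) = 0"
  by (auto simp: fun_eq_iff dp_def fn_def monomial_def)

lemma dp_eta [simp]: "dp i (eta h) = 0"
  by (auto simp: fun_eq_iff dp_def eta_def monomial_def)

lemma dp_fn_gmul: "dp i (fn h \<odot> F) = fn h \<odot> dp i F"
  by (auto simp: fun_eq_iff dp_def fn_gmul)

lemma dp_eta_gmul: "dp i (eta j \<odot> F) = eta j \<odot> dp i F"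
  by (auto simp: fun_eq_iff dp_def eta_gmul)

lemma dp_pvar_gmul:
  assumes "odd_finite F"
  shows "dp i (pvar k \<odot> F) = (if i = k then F else 0) + pvar k \<odot> dp i F"
proof (intro ext)
  fix S K p
  show "dp i (pvar k \<odot> F) S K p = ((if i = k then F else 0) + pvar k \<odot> dp i F) S K p"
  proof (cases "finite S")
    case False
    then show ?thesis using assms by (simp add: dp_def pvar_gmul odd_finite_def)
  next
    case S: True
    show ?thesis
    proof (cases "k \<in># K")
      case True
      then obtain K' where "K = add_mset k K'" by (meson multi_member_split)
      then show ?thesis using S by (auto simp: dp_def pvar_gmul algebra_simps)
    next
      case False
      then have "count K k = 0" by (simp add: not_in_iff)
      with S False show ?thesis by (simp add: dp_def pvar_gmul)
    qed
  qed
qed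

text \<open>The arrays on which \<open>dx\<close> is additive and satisfies the Leibniz rule,
  \<open>frechet_derivative\<close> being meaningful only for differentiable coefficients. It
  follows from membership in \<open>gfunctions\<close> and is stable under sums and
  products.\<close>

definition regular :: "('b::real_normed_vector) gfun \<Rightarrow> bool" where
  "regular F \<longleftrightarrow> odd_finite F \<and> (\<forall>S K. smooth (F S K))"

lemma regular_smooth: "regular F \<Longrightarrow> smooth (F S K)"
  and regular_odd_finite [simp]: "regular F \<Longrightarrow> odd_finite F"
  by (simp_all add: regular_def)

lemma smooth_zero_fun [simp]: "smooth 0"
  using smooth_const[of 0] by (simp add: zero_fun_def)

lemma regular_zero: "regular 0"
  by (simp add: regular_def)

lemma smooth_uminus_fun: "smooth h \<Longrightarrow> smooth (- h)"
  using smooth_minus[of h] by (simp add: fun_Compl_def)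

lemma smooth_plus_fun: "smooth g \<Longrightarrow> smooth h \<Longrightarrow> smooth (g + h)"
  using smooth_add[of g h] by (simp add: plus_fun_def)

lemma regular_add: "regular F \<Longrightarrow> regular G \<Longrightarrow> regular (F + G)"
  by (simp add: regular_def smooth_plus_fun)

lemma regular_minus: "regular F \<Longrightarrow> regular (- F)"
  by (simp add: regular_def smooth_uminus_fun)

lemma regular_sum: "(\<And>i. i \<in> I \<Longrightarrow> regular (F i)) \<Longrightarrow> regular (\<Sum>i\<in>I. F i)"
  by (induction I rule: infinite_finite_induct) (auto intro: regular_add regular_zero)

lemma regular_gmul: "regular F \<Longrightarrow> regular G \<Longrightarrow> regular (F \<odot> G)"
  unfolding regular_def gmul_def[of F G]
  by (intro conjI odd_finite_gmul[unfolded gmul_def] allI smooth_sum smooth_mult smooth_const) auto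

lemma smooth_monomial: "smooth h \<Longrightarrow> smooth (monomial S K h S' K')"
  by (simp add: monomial_def)

lemma regular_fn: "smooth h \<Longrightarrow> regular (fn h)"
  and regular_eta: "regular (eta j)"
  and regular_pvar: "regular (pvar i)"
  by (auto simp: regular_def) (auto simp: fn_def eta_def pvar_def intro!: smooth_monomial)

lemma dx_add: "regular F \<Longrightarrow> regular G \<Longrightarrow> dx \<epsilon> i (F + G) = dx \<epsilon> i F + dx \<epsilon> i G"
proof -
  assume FG: "regular F" "regular G"
  have "frechet_derivative (\<lambda>p. F S K p + G S K p) (at p)
    = (\<lambda>v. frechet_derivative (F S K) (at p) v + frechet_derivative (G S K) (at p) v)" for S K p
    by (intro frechet_derivativeI has_derivative_add has_derivative_frechet
        smooth_differentiable regular_smooth FG)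
  then show ?thesis by (simp add: fun_eq_iff dx_def plus_fun_def)
qed

lemma dx_zero [simp]: "dx \<epsilon> i 0 = 0"
  by (simp add: fun_eq_iff dx_def zero_fun_def)

lemma dx_sum: "(\<And>j. j \<in> I \<Longrightarrow> regular (F j)) \<Longrightarrow> dx \<epsilon> i (\<Sum>j\<in>I. F j) = (\<Sum>j\<in>I. dx \<epsilon> i (F j))"
  by (induction I rule: infinite_finite_induct) (simp_all add: dx_add regular_sum)

lemma dx_fn: "dx \<epsilon> i (fn h) = fn (dder (\<epsilon> i) h)"
  by (auto simp: fun_eq_iff dx_def fn_def monomial_def)

lemma dx_eta [simp]: "dx \<epsilon> i (eta j) = 0"
  by (auto simp: fun_eq_iff dx_def eta_def monomial_def)

lemma frechet_derivative_cmult: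
  fixes h :: "'b::real_normed_vector \<Rightarrow> real"
  assumes "smooth h"
  shows "frechet_derivative (\<lambda>p. c * h p) (at p) = (\<lambda>v. c * frechet_derivative h (at p) v)"
  by (intro frechet_derivativeI has_derivative_mult_right has_derivative_frechet
      smooth_differentiable assms)

lemma frechet_derivative_mult:
  fixes g h :: "'b::real_normed_vector \<Rightarrow> real"
  assumes "smooth g" "smooth h"
  shows "frechet_derivative (\<lambda>p. g p * h p) (at p)
    = (\<lambda>v. g p * frechet_derivative h (at p) v + frechet_derivative g (at p) v * h p)"
  by (intro frechet_derivativeI has_derivative_mult has_derivative_frechet
      smooth_differentiable assms)

lemma dx_eta_gmul:
  assumes "regular F"
  shows "dx \<epsilon> i (eta j \<odot> F) = eta j \<odot> dx \<epsilon> i F"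
proof (intro ext)
  fix S K p
  have "(eta j \<odot> F) S K = (\<lambda>p. (if finite S \<and> j \<in> S then sign_below j S else 0) * F (S - {j}) K p)"
    by (auto simp: eta_gmul)
  then show "dx \<epsilon> i (eta j \<odot> F) S K p = (eta j \<odot> dx \<epsilon> i F) S K p"
    by (simp add: dx_def frechet_derivative_cmult[OF regular_smooth[OF assms]] eta_gmul)
qed

lemma dx_pvar_gmul:
  assumes "regular F"
  shows "dx \<epsilon> i (pvar j \<odot> F) = pvar j \<odot> dx \<epsilon> i F"
proof (intro ext)
  fix S K p
  have "(pvar j \<odot> F) S K = (\<lambda>p. (if finite S \<and> j \<in># K then 1 else 0) * F S (K - {#j#}) p)"
    by (auto simp: pvar_gmul)
  then show "dx \<epsilon> i (pvar j \<odot> F) S K p = (pvar j \<odot> dx \<epsilon> i F) S K p"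
    by (simp add: dx_def frechet_derivative_cmult[OF regular_smooth[OF assms]] pvar_gmul)
qed

lemma dx_fn_gmul:
  assumes "regular F" "smooth h"
  shows "dx \<epsilon> i (fn h \<odot> F) = fn (dder (\<epsilon> i) h) \<odot> F + fn h \<odot> dx \<epsilon> i F"
proof (intro ext)
  fix S K p
  have "(fn h \<odot> F) S K = (if finite S then (\<lambda>p. h p * F S K p) else (\<lambda>_. 0))"
    by (auto simp: fn_gmul)
  then show "dx \<epsilon> i (fn h \<odot> F) S K p = (fn (dder (\<epsilon> i) h) \<odot> F + fn h \<odot> dx \<epsilon> i F) S K p"
    by (simp add: dx_def frechet_derivative_mult[OF assms(2) regular_smooth[OF assms(1)]] fn_gmul)
qed

subsection \<open>Contractions with the generators\<close>

text \<open>Every structure function is an iterated \<open>tsum\<close> or \<open>psum\<close> of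
  values of \<open>fun_0\<close> or \<open>fun_m1\<close>, so tensors can be compared coefficient by
  coefficient while \<open>tsum_swap\<close> and \<open>psum_swap\<close> take care of the order of
  the generators.\<close>

definition tsum :: "nat \<Rightarrow> (nat \<Rightarrow> 'b gfun) \<Rightarrow> 'b gfun" where
  "tsum r \<phi> = (\<Sum>a<r. theta a \<odot> \<phi> a)"

definition psum :: "nat \<Rightarrow> (nat \<Rightarrow> 'b gfun) \<Rightarrow> 'b gfun" where
  "psum n \<phi> = (\<Sum>i<n. pvar i \<odot> \<phi> i)"

lemma tsum_cong: "(\<And>a. a < r \<Longrightarrow> \<phi> a = \<psi> a) \<Longrightarrow> tsum r \<phi> = tsum r \<psi>"
  by (simp add: tsum_def)

lemma psum_cong: "(\<And>a. a < r \<Longrightarrow> \<phi> a = \<psi> a) \<Longrightarrow> psum r \<phi> = psum r \<psi>"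
  by (simp add: psum_def)

lemma tsum_add: "tsum r (\<lambda>a. \<phi> a + \<psi> a) = tsum r \<phi> + tsum r \<psi>"
  by (simp only: tsum_def gmul_add_right sum.distrib)

lemma psum_add: "psum r (\<lambda>a. \<phi> a + \<psi> a) = psum r \<phi> + psum r \<psi>"
  by (simp only: psum_def gmul_add_right sum.distrib)

lemma tsum_minus: "tsum r (\<lambda>a. - \<phi> a) = - tsum r \<phi>"
  by (simp only: tsum_def gmul_minus_right sum_negf)

lemma psum_minus: "psum r (\<lambda>a. - \<phi> a) = - psum r \<phi>"
  by (simp only: psum_def gmul_minus_right sum_negf)

lemma tsum_zero [simp]: "tsum r (\<lambda>_. 0) = 0"
  by (simp only: tsum_def gmul_zero_right sum.neutral_const)

lemma psum_zero [simp]: "psum r (\<lambda>_. 0) = 0"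
  by (simp only: psum_def gmul_zero_right sum.neutral_const)

lemma tsum_sum: "tsum r (\<lambda>a. \<Sum>i\<in>I. \<phi> i a) = (\<Sum>i\<in>I. tsum r (\<phi> i))"
  by (simp only: tsum_def gmul_sum_right sum.swap[of _ I])

lemma psum_sum: "psum r (\<lambda>a. \<Sum>i\<in>I. \<phi> i a) = (\<Sum>i\<in>I. psum r (\<phi> i))"
  by (simp only: psum_def gmul_sum_right sum.swap[of _ I])

lemma tsum_gmul: "tsum r \<phi> \<odot> F = tsum r (\<lambda>a. \<phi> a \<odot> F)"
  by (simp only: tsum_def gmul_sum_left gmul_assoc)

lemma psum_gmul: "psum r \<phi> \<odot> F = psum r (\<lambda>a. \<phi> a \<odot> F)"
  by (simp only: psum_def gmul_sum_left gmul_assoc)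

lemma fn_tsum: "fn h \<odot> tsum r \<phi> = tsum r (\<lambda>a. fn h \<odot> \<phi> a)"
  by (simp only: tsum_def theta_eta gmul_sum_right fn_eta_commute)

lemma fn_psum: "fn h \<odot> psum r \<phi> = psum r (\<lambda>a. fn h \<odot> \<phi> a)"
  by (simp only: psum_def gmul_sum_right fn_pvar_commute)

lemma psum_tsum: "psum n (\<lambda>i. tsum r (\<phi> i)) = tsum r (\<lambda>a. psum n (\<lambda>i. \<phi> i a))"
  unfolding tsum_def psum_def gmul_sum_right theta_eta pvar_eta_commute by (rule sum.swap)

text \<open>The double sum is reordered and the two \<open>theta\<close> anticommute; all
  antisymmetrisations over \<open>theta\<close> indices rest on this rule.\<close>

lemma tsum_swap: "tsum r (\<lambda>a. tsum r (\<lambda>b. \<phi> a b)) = - tsum r (\<lambda>a. tsum r (\<lambda>b. \<phi> b a))"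
proof -
  have "tsum r (\<lambda>a. tsum r (\<lambda>b. \<phi> a b)) = (\<Sum>b<r. \<Sum>a<r. theta a \<odot> (theta b \<odot> \<phi> a b))"
    unfolding tsum_def gmul_sum_right by (rule sum.swap)
  also have "\<dots> = (\<Sum>b<r. \<Sum>a<r. - (theta b \<odot> (theta a \<odot> \<phi> a b)))"
    unfolding theta_eta by (intro sum.cong refl eta_anticommute)
  finally show ?thesis
    unfolding tsum_def gmul_sum_right sum_negf .
qed

lemma psum_swap: "psum n (\<lambda>a. psum n (\<lambda>b. \<phi> a b)) = psum n (\<lambda>a. psum n (\<lambda>b. \<phi> b a))"
  unfolding psum_def gmul_sum_right
  by (subst sum.swap) (intro sum.cong refl pvar_pvar_commute)

lemma odd_finite_tsum [simp]: "odd_finite (tsum r \<phi>)"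
  and odd_finite_psum [simp]: "odd_finite (psum r \<phi>)"
  unfolding tsum_def psum_def by (intro odd_finite_sum odd_finite_gmul)+

lemma sum_if_eq_left:
  fixes \<phi> :: "nat \<Rightarrow> 'v::comm_monoid_add"
  assumes "c < r" shows "(\<Sum>a<r. if c = a then \<phi> a else 0) = \<phi> c"
  using assms by simp

lemma dleft_theta_tsum:
  assumes "c < r" "\<And>a. odd_finite (\<phi> a)"
  shows "dleft (Suc (2 * c)) (tsum r \<phi>) = \<phi> c - tsum r (\<lambda>a. dleft (Suc (2 * c)) (\<phi> a))"
proof -
  have "dleft (Suc (2 * c)) (theta a \<odot> \<phi> a)
      = (if c = a then \<phi> a else 0) - theta a \<odot> dleft (Suc (2 * c)) (\<phi> a)" for a
    by (subst theta_eta, subst dleft_eta_gmul[OF assms(2)]) (simp add: theta_eta)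
  then show ?thesis
    unfolding tsum_def dleft_sum by (simp only: sum_subtractf sum_if_eq_left[OF assms(1)])
qed

lemma dleft_xi_tsum:
  assumes "\<And>a. odd_finite (\<phi> a)"
  shows "dleft (2 * c) (tsum r \<phi>) = - tsum r (\<lambda>a. dleft (2 * c) (\<phi> a))"
proof -
  have "2 * c \<noteq> Suc (2 * a)" for a by presburger
  then have "dleft (2 * c) (theta a \<odot> \<phi> a) = - (theta a \<odot> dleft (2 * c) (\<phi> a))" for a
    by (subst theta_eta, subst dleft_eta_gmul[OF assms]) (simp only: if_False diff_0 theta_eta)
  then show ?thesis
    unfolding tsum_def dleft_sum by (simp only: sum_negf)
qed

lemma dleft_psum: "dleft j (psum n \<phi>) = psum n (\<lambda>i. dleft j (\<phi> i))"
  by (simp only: psum_def dleft_sum dleft_pvar_gmul)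

lemma dp_tsum: "dp i (tsum r \<phi>) = tsum r (\<lambda>a. dp i (\<phi> a))"
  by (simp only: tsum_def dp_sum theta_eta dp_eta_gmul)

lemma dp_psum:
  assumes "i < n" "\<And>a. odd_finite (\<phi> a)"
  shows "dp i (psum n \<phi>) = \<phi> i + psum n (\<lambda>k. dp i (\<phi> k))"
  unfolding psum_def dp_sum dp_pvar_gmul[OF assms(2)]
  by (simp only: sum.distrib sum_if_eq_left[OF assms(1)])

lemma regular_tsum: "(\<And>a. regular (\<phi> a)) \<Longrightarrow> regular (tsum r \<phi>)"
  unfolding tsum_def theta_eta by (intro regular_sum regular_gmul regular_eta)

lemma regular_psum: "(\<And>a. regular (\<phi> a)) \<Longrightarrow> regular (psum r \<phi>)"
  unfolding psum_def by (intro regular_sum regular_gmul regular_pvar)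

lemma dx_tsum:
  assumes "\<And>a. regular (\<phi> a)"
  shows "dx \<epsilon> i (tsum r \<phi>) = tsum r (\<lambda>a. dx \<epsilon> i (\<phi> a))"
  unfolding tsum_def theta_eta
  by (subst dx_sum) (auto intro!: regular_gmul regular_eta assms sum.cong dx_eta_gmul)

lemma dx_psum:
  assumes "\<And>a. regular (\<phi> a)"
  shows "dx \<epsilon> i (psum r \<phi>) = psum r (\<lambda>a. dx \<epsilon> i (\<phi> a))"
  unfolding psum_def
  by (subst dx_sum) (auto intro!: regular_gmul regular_pvar assms sum.cong dx_pvar_gmul)

lemma parity_tsum: "(\<And>a. parity b (\<phi> a)) \<Longrightarrow> parity (\<not> b) (tsum r \<phi>)"
  unfolding tsum_def theta_eta
  by (intro parity_sum parity_gmul[OF parity_eta, of b, simplified]) simp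

lemma parity_psum: "(\<And>a. parity b (\<phi> a)) \<Longrightarrow> parity b (psum r \<phi>)"
  unfolding psum_def
  by (intro parity_sum parity_gmul[OF parity_pvar, of b, simplified]) simp

text \<open>Scalars act through multiplication by constant functions, the form in which coordinates
  occur in the structure functions.\<close>

definition glinear :: "('v::real_vector \<Rightarrow> 'b gfun) \<Rightarrow> bool" where
  "glinear \<Phi> \<longleftrightarrow> (\<forall>v w. \<Phi> (v + w) = \<Phi> v + \<Phi> w) \<and> (\<forall>c v. \<Phi> (c *\<^sub>R v) = fn (\<lambda>_. c) \<odot> \<Phi> v)"

lemma glinear_add: "glinear \<Phi> \<Longrightarrow> \<Phi> (v + w) = \<Phi> v + \<Phi> w"
  and glinear_scaleR: "glinear \<Phi> \<Longrightarrow> \<Phi> (c *\<^sub>R v) = fn (\<lambda>_. c) \<odot> \<Phi> v"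
  by (simp_all add: glinear_def)

lemma glinear_zero: "glinear \<Phi> \<Longrightarrow> \<Phi> 0 = 0"
  using glinear_add[of \<Phi> 0 0] by simp

lemma glinear_minus: "glinear \<Phi> \<Longrightarrow> \<Phi> (- v) = - \<Phi> v"
  using glinear_add[of \<Phi> v "- v"] glinear_zero[of \<Phi>] by (simp add: eq_neg_iff_add_eq_0 add.commute)

lemma glinear_sum: "glinear \<Phi> \<Longrightarrow> \<Phi> (\<Sum>i\<in>I. v i) = (\<Sum>i\<in>I. \<Phi> (v i))"
  by (intro additive_sum glinear_zero glinear_add)

text \<open>Replaces a contraction over coordinates by insertion of the vector itself; through it no
  coordinate functions survive in the master equation.\<close>

lemma glinear_coord:
  assumes "is_basis n e" "glinear \<Phi>"
  shows "(\<Sum>i<n. fn (\<lambda>_. coord n e v i) \<odot> \<Phi> (e i)) = \<Phi> v"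
  using coord_sum[OF assms(1), of v] glinear_sum[OF assms(2), of "\<lambda>i. coord n e v i *\<^sub>R e i" "{..<n}"]
  by (simp only: glinear_scaleR[OF assms(2)])

lemma glinear_compose: "glinear \<Phi> \<Longrightarrow> linear g \<Longrightarrow> glinear (\<lambda>v. \<Phi> (g v))"
  by (simp add: glinear_def linear_add linear_scale)

lemma glinear_plus: "glinear \<Phi> \<Longrightarrow> glinear \<Psi> \<Longrightarrow> glinear (\<lambda>v. \<Phi> v + \<Psi> v)"
  by (simp add: glinear_def gmul_add_right algebra_simps)

lemma glinear_tsum: "(\<And>a. glinear (\<lambda>v. \<Phi> v a)) \<Longrightarrow> glinear (\<lambda>v. tsum r (\<Phi> v))"
  unfolding glinear_def fn_tsum tsum_add[symmetric] by (auto intro!: tsum_cong)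

lemma glinear_psum: "(\<And>a. glinear (\<lambda>v. \<Phi> v a)) \<Longrightarrow> glinear (\<lambda>v. psum r (\<Phi> v))"
  unfolding glinear_def fn_psum psum_add[symmetric] by (auto intro!: psum_cong)

lemma glinear_fn: "linear g \<Longrightarrow> glinear (\<lambda>v. fn (\<lambda>_. g v))"
  by (simp add: glinear_def linear_add linear_scale fn_fn flip: fn_add)

lemma glinear_fun_0:
  assumes "is_basis r f"
  shows "glinear (fun_0 r f)"
  unfolding glinear_def fun_0_def
  by (simp add: linear_add[OF coord_linear[OF assms]] linear_scale[OF coord_linear[OF assms]]
      fn_add gmul_add_left sum.distrib gmul_sum_right flip: gmul_assoc fn_fn)

lemma glinear_fun_m1: "glinear fun_m1"
  unfolding glinear_def fun_m1_def
  by (simp add: blinfun.add_right blinfun.scaleR_right fn_add fn_fn)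

lemma fun_0_regular: "regular (fun_0 r f x)"
  unfolding fun_0_def xi_eta by (intro regular_sum regular_gmul regular_fn regular_eta smooth_const)

lemma smooth_blinfun_apply: "smooth (\<lambda>p. blinfun_apply p m)"
  by (intro smooth_linear blinfun.bounded_linear_left)

lemma fun_m1_regular: "regular (fun_m1 m)"
  unfolding fun_m1_def by (intro regular_fn smooth_blinfun_apply)

lemma parity_fun_0: "parity False (fun_0 r f x)"
  unfolding fun_0_def xi_eta by (intro parity_sum) (use parity_gmul[OF parity_fn parity_eta] in simp)

lemma parity_fun_m1: "parity True (fun_m1 m)"
  unfolding fun_m1_def by (rule parity_fn)

lemma dp_fun_0 [simp]: "dp i (fun_0 r f x) = 0"
  unfolding fun_0_def xi_eta by (simp only: dp_sum dp_fn_gmul dp_eta gmul_zero_right sum.neutral_const)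

lemma dp_fun_m1 [simp]: "dp i (fun_m1 m) = 0"
  unfolding fun_m1_def by simp

lemma dleft_fun_m1 [simp]: "dleft j (fun_m1 m) = 0"
  unfolding fun_m1_def by simp

lemma fn_gmul_fn_one: "fn h \<odot> fn (\<lambda>_. 1) = fn h"
  by (simp add: fn_fn)

lemma dleft_xi_fun_0: "c < r \<Longrightarrow> dleft (2 * c) (fun_0 r f x) = fn (\<lambda>_. coord r f x c)"
  unfolding fun_0_def xi_eta dleft_sum dleft_fn_gmul dleft_eta
  by (simp add: if_distrib[where f = "\<lambda>F. _ \<odot> F"] fn_gmul_fn_one cong: if_cong)

lemma dleft_theta_fun_0: "dleft (Suc (2 * c)) (fun_0 r f x) = 0"
proof -
  have "Suc (2 * c) \<noteq> 2 * a" for a by presburger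
  then show ?thesis
    unfolding fun_0_def xi_eta dleft_sum dleft_fn_gmul dleft_eta
    by (simp only: if_False gmul_zero_right sum.neutral_const)
qed

lemma dx_fun_0 [simp]: "dx \<epsilon> i (fun_0 r f x) = 0"
proof -
  have "dx \<epsilon> i (fun_0 r f x) = (\<Sum>a<r. dx \<epsilon> i (fn (\<lambda>_. coord r f x a) \<odot> eta (2 * a)))"
    unfolding fun_0_def xi_eta
    by (rule dx_sum) (intro regular_gmul regular_fn regular_eta smooth_const)
  also have "\<dots> = 0"
    by (simp only: dx_fn_gmul[OF regular_eta smooth_const] dx_eta frechet_derivative_const
        fn_zero gmul_zero_left gmul_zero_right add_0_left sum.neutral_const)
  finally show ?thesis .
qed

lemma dx_fun_m1:
  fixes m :: "'m::real_normed_vector"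
  assumes "is_basis n e"
  shows "dx (dual_basis n e) i (fun_m1 m) = fn (\<lambda>_. coord n e m i)"
proof -
  have "frechet_derivative (\<lambda>p. blinfun_apply p m) (at p) = (\<lambda>q. blinfun_apply q m)" for p :: "'m \<Rightarrow>\<^sub>L real"
    by (intro frechet_derivativeI bounded_linear.has_derivative[OF blinfun.bounded_linear_left]
        has_derivative_ident)
  then have "dder v (\<lambda>p. blinfun_apply p m) = (\<lambda>_. blinfun_apply v m)" for v :: "'m \<Rightarrow>\<^sub>L real"
    by (simp add: fun_eq_iff)
  then show ?thesis
    unfolding fun_m1_def dx_fn by (simp add: dual_basis_apply[OF assms])
qed

subsection \<open>Sums over unshuffles\<close>

text \<open>Names a permutation of \<open>{..<4}\<close> by its values; outside this set it must be
  the identity, as \<open>permutes\<close> demands.\<close>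

definition perm4 :: "nat \<Rightarrow> nat \<Rightarrow> nat \<Rightarrow> nat \<Rightarrow> nat \<Rightarrow> nat" where
  "perm4 a b c d = (\<lambda>i. if i = 0 then a else if i = 1 then b else if i = 2 then c
     else if i = 3 then d else i)"

lemma perm4_simps [simp]:
  "perm4 a b c d 0 = a" "perm4 a b c d (Suc 0) = b" "perm4 a b c d 2 = c" "perm4 a b c d 3 = d"
  by (simp_all add: perm4_def)

lemma perm4_eq_iff: "perm4 a b c d = perm4 a' b' c' d' \<longleftrightarrow> a = a' \<and> b = b' \<and> c = c' \<and> d = d'"
  by (metis perm4_simps)

lemma permutes_perm4:
  assumes "\<sigma> permutes {..<4::nat}"
  shows "\<sigma> = perm4 (\<sigma> 0) (\<sigma> 1) (\<sigma> 2) (\<sigma> 3)"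
proof
  fix i
  have "i = 0 \<or> i = 1 \<or> i = 2 \<or> i = 3 \<or> i \<notin> {..<4::nat}" by (simp, linarith)
  then show "\<sigma> i = perm4 (\<sigma> 0) (\<sigma> 1) (\<sigma> 2) (\<sigma> 3) i"
    using permutes_not_in[OF assms, of i] by (auto simp: perm4_def)
qed

text \<open>One factorisation into transpositions per unshuffle yields both that it permutes
  \<open>{..<4}\<close> and its sign.\<close>

lemma perm4_transpositions:
  "perm4 0 1 2 3 = id"
  "perm4 0 2 1 3 = Transposition.transpose 1 2"
  "perm4 0 3 1 2 = Transposition.transpose 1 2 \<circ> Transposition.transpose 1 3"
  "perm4 1 2 0 3 = Transposition.transpose 0 1 \<circ> Transposition.transpose 1 2"
  "perm4 1 3 0 2 = Transposition.transpose 0 1 \<circ> (Transposition.transpose 1 2 \<circ> Transposition.transpose 1 3)"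
  "perm4 2 3 0 1 = Transposition.transpose 0 2 \<circ> Transposition.transpose 1 3"
  "perm4 0 1 3 2 = Transposition.transpose 2 3"
  "perm4 0 2 3 1 = Transposition.transpose 1 2 \<circ> Transposition.transpose 2 3"
  "perm4 1 2 3 0 = Transposition.transpose 0 1 \<circ> (Transposition.transpose 1 2 \<circ> Transposition.transpose 2 3)"
  by (auto simp: fun_eq_iff perm4_def transpose_def)

lemma perm4_permutes:
  "perm4 0 1 2 3 permutes {..<4}" "perm4 0 2 1 3 permutes {..<4}" "perm4 0 3 1 2 permutes {..<4}"
  "perm4 1 2 0 3 permutes {..<4}" "perm4 1 3 0 2 permutes {..<4}" "perm4 2 3 0 1 permutes {..<4}"
  "perm4 0 1 3 2 permutes {..<4}" "perm4 0 2 3 1 permutes {..<4}" "perm4 1 2 3 0 permutes {..<4}"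
  unfolding perm4_transpositions
  by (auto intro!: permutes_compose permutes_swap_id permutes_id)

lemma perm4_sign:
  "sign (perm4 0 1 2 3) = 1" "sign (perm4 0 2 1 3) = -1" "sign (perm4 0 3 1 2) = 1"
  "sign (perm4 1 2 0 3) = 1" "sign (perm4 1 3 0 2) = -1" "sign (perm4 2 3 0 1) = 1"
  "sign (perm4 0 1 3 2) = -1" "sign (perm4 0 2 3 1) = 1" "sign (perm4 1 2 3 0) = -1"
  unfolding perm4_transpositions
  by (simp_all add: sign_compose sign_swap_id permutation_swap_id permutation_compose)

lemma two_pairs_below_4:
  fixes a b c d :: nat
  assumes "a < b" "c < d" "b < 4" "d < 4" "a \<noteq> c" "a \<noteq> d" "b \<noteq> c" "b \<noteq> d"
  shows "a = 0 \<and> b = 1 \<and> c = 2 \<and> d = 3 \<or> a = 0 \<and> b = 2 \<and> c = 1 \<and> d = 3 \<or>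
    a = 0 \<and> b = 3 \<and> c = 1 \<and> d = 2 \<or> a = 1 \<and> b = 2 \<and> c = 0 \<and> d = 3 \<or>
    a = 1 \<and> b = 3 \<and> c = 0 \<and> d = 2 \<or> a = 2 \<and> b = 3 \<and> c = 0 \<and> d = 1"
proof -
  have "a = 0 \<or> a = 1 \<or> a = 2" "b = 1 \<or> b = 2 \<or> b = 3" "c = 0 \<or> c = 1 \<or> c = 2" "d = 1 \<or> d = 2 \<or> d = 3"
    using assms by arith+
  then show ?thesis using assms by (elim disjE) simp_all
qed

lemma triple_below_4:
  fixes a b c d :: nat
  assumes "a < b" "b < c" "c < 4" "d < 4" "a \<noteq> d" "b \<noteq> d" "c \<noteq> d"
  shows "a = 0 \<and> b = 1 \<and> c = 2 \<and> d = 3 \<or> a = 0 \<and> b = 1 \<and> c = 3 \<and> d = 2 \<or>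
    a = 0 \<and> b = 2 \<and> c = 3 \<and> d = 1 \<or> a = 1 \<and> b = 2 \<and> c = 3 \<and> d = 0"
proof -
  have "a = 0 \<or> a = 1" "b = 1 \<or> b = 2" "c = 2 \<or> c = 3" "d = 0 \<or> d = 1 \<or> d = 2 \<or> d = 3"
    using assms by arith+
  then show ?thesis using assms by (elim disjE) simp_all
qed

lemma unshuffles_2_2:
  "{\<sigma>. \<sigma> permutes {..<4::nat} \<and> \<sigma> 0 < \<sigma> 1 \<and> \<sigma> 2 < \<sigma> 3} =
    {perm4 0 1 2 3, perm4 0 2 1 3, perm4 0 3 1 2, perm4 1 2 0 3, perm4 1 3 0 2, perm4 2 3 0 1}"
  (is "?A = ?B")
proof
  show "?A \<subseteq> ?B"
  proof
    fix \<sigma> assume \<sigma>: "\<sigma> \<in> ?A"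
    then have perm: "\<sigma> permutes {..<4}" by simp
    have "\<sigma> i < 4" if "i < 4" for i
      using permutes_in_image[OF perm, of i] that by simp
    then have lt: "\<sigma> 0 < 4" "\<sigma> 1 < 4" "\<sigma> 2 < 4" "\<sigma> 3 < 4" by simp_all
    have ne: "\<sigma> 0 \<noteq> \<sigma> 2" "\<sigma> 0 \<noteq> \<sigma> 3" "\<sigma> 1 \<noteq> \<sigma> 2" "\<sigma> 1 \<noteq> \<sigma> 3"
      by (simp_all add: inj_eq[OF permutes_inj[OF perm]])
    have ord: "\<sigma> 0 < \<sigma> 1" "\<sigma> 2 < \<sigma> 3" using \<sigma> by simp_all
    define a b c d where "a = \<sigma> 0" and "b = \<sigma> 1" and "c = \<sigma> 2" and "d = \<sigma> 3"
    have "a = 0 \<and> b = 1 \<and> c = 2 \<and> d = 3 \<or> a = 0 \<and> b = 2 \<and> c = 1 \<and> d = 3 \<or>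
        a = 0 \<and> b = 3 \<and> c = 1 \<and> d = 2 \<or> a = 1 \<and> b = 2 \<and> c = 0 \<and> d = 3 \<or>
        a = 1 \<and> b = 3 \<and> c = 0 \<and> d = 2 \<or> a = 2 \<and> b = 3 \<and> c = 0 \<and> d = 1"
      using lt ne ord
      by (intro two_pairs_below_4) (simp_all add: a_def b_def c_def d_def)
    moreover have "\<sigma> = perm4 a b c d"
      unfolding a_def b_def c_def d_def by (rule permutes_perm4[OF perm])
    ultimately show "\<sigma> \<in> ?B" by (elim disjE) simp_all
  qed
  show "?B \<subseteq> ?A"
    by (simp add: perm4_permutes[simplified])
qed

lemma unshuffles_3_1:
  "{\<sigma>. \<sigma> permutes {..<4::nat} \<and> \<sigma> 0 < \<sigma> 1 \<and> \<sigma> 1 < \<sigma> 2} =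
    {perm4 0 1 2 3, perm4 0 1 3 2, perm4 0 2 3 1, perm4 1 2 3 0}"
  (is "?A = ?B")
proof
  show "?A \<subseteq> ?B"
  proof
    fix \<sigma> assume \<sigma>: "\<sigma> \<in> ?A"
    then have perm: "\<sigma> permutes {..<4}" by simp
    have "\<sigma> i < 4" if "i < 4" for i
      using permutes_in_image[OF perm, of i] that by simp
    then have lt: "\<sigma> 0 < 4" "\<sigma> 1 < 4" "\<sigma> 2 < 4" "\<sigma> 3 < 4" by simp_all
    have ne: "\<sigma> 0 \<noteq> \<sigma> 3" "\<sigma> 1 \<noteq> \<sigma> 3" "\<sigma> 2 \<noteq> \<sigma> 3"
      by (simp_all add: inj_eq[OF permutes_inj[OF perm]])
    have ord: "\<sigma> 0 < \<sigma> 1" "\<sigma> 1 < \<sigma> 2" using \<sigma> by simp_all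
    define a b c d where "a = \<sigma> 0" and "b = \<sigma> 1" and "c = \<sigma> 2" and "d = \<sigma> 3"
    have "a = 0 \<and> b = 1 \<and> c = 2 \<and> d = 3 \<or> a = 0 \<and> b = 1 \<and> c = 3 \<and> d = 2 \<or>
        a = 0 \<and> b = 2 \<and> c = 3 \<and> d = 1 \<or> a = 1 \<and> b = 2 \<and> c = 3 \<and> d = 0"
      using lt ne ord
      by (intro triple_below_4) (simp_all add: a_def b_def c_def d_def)
    moreover have "\<sigma> = perm4 a b c d"
      unfolding a_def b_def c_def d_def by (rule permutes_perm4[OF perm])
    ultimately show "\<sigma> \<in> ?B" by (elim disjE) simp_all
  qed
  show "?B \<subseteq> ?A"
    by (simp add: perm4_permutes[simplified])
qed

section \<open>The axioms for chosen bases, in expanded form\<close>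

locale based_Linf = two_term_Linf l1 l20 l21 l3
  for l1 :: "'m::real_normed_vector \<Rightarrow> 'x::real_normed_vector"
    and l20 :: "'x \<Rightarrow> 'x \<Rightarrow> 'x"
    and l21 :: "'x \<Rightarrow> 'm \<Rightarrow> 'm"
    and l3 :: "'x \<Rightarrow> 'x \<Rightarrow> 'x \<Rightarrow> 'm" +
  fixes n r :: nat and e :: "nat \<Rightarrow> 'm" and f :: "nat \<Rightarrow> 'x"
  assumes e: "is_basis n e" and f: "is_basis r f"
begin

lemma l20_linear: "linear (l20 x)" "linear (\<lambda>x. l20 x y)" and l20_skew: "l20 y x = - l20 x y"
  using l20_skew_bilinear unfolding skew_bilinear_def bilinear_def by blast+

lemma l21_linear: "linear (l21 x)" "linear (\<lambda>x. l21 x m)"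
  using l21_bilinear unfolding bilinear_def by blast+

lemma l3_linear: "linear (l3 x y)" "linear (\<lambda>y. l3 x y z)" "linear (\<lambda>x. l3 x y z)"
  and l3_skew: "l3 y x z = - l3 x y z" "l3 x z y = - l3 x y z"
  using l3_skew_trilinear unfolding skew_trilinear_def by blast+

lemmas multilinear_add = linear_add[OF l1_linear] linear_add[OF l20_linear(1)]
  linear_add[OF l20_linear(2)] linear_add[OF l21_linear(1)] linear_add[OF l21_linear(2)]
  linear_add[OF l3_linear(1)] linear_add[OF l3_linear(2)] linear_add[OF l3_linear(3)]

lemmas multilinear_scale = linear_scale[OF l1_linear] linear_scale[OF l20_linear(1)]
  linear_scale[OF l20_linear(2)] linear_scale[OF l21_linear(1)] linear_scale[OF l21_linear(2)]
  linear_scale[OF l3_linear(1)] linear_scale[OF l3_linear(2)] linear_scale[OF l3_linear(3)]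

lemmas multilinear_neg = linear_neg[OF l1_linear] linear_neg[OF l20_linear(1)]
  linear_neg[OF l20_linear(2)] linear_neg[OF l21_linear(1)] linear_neg[OF l21_linear(2)]
  linear_neg[OF l3_linear(1)] linear_neg[OF l3_linear(2)] linear_neg[OF l3_linear(3)]

text \<open>Leibniz form of the Jacobi identity: \<open>l20 x\<close> is a derivation up to the
  homotopy \<open>l1 (l3 x y z)\<close>. The Jacobi identity of the Dorfman bracket has this
  shape.\<close>

lemma jacobi0': "l20 x (l20 y z) = l20 (l20 x y) z + l20 y (l20 x z) + l1 (l3 x y z)"
proof -
  have "l20 (l20 y z) x = - l20 x (l20 y z)" "l20 (l20 z x) y = l20 y (l20 x z)"
    using l20_skew[of x "l20 y z"] l20_skew[of y "l20 z x"] l20_skew[of x z]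
    by (simp_all add: multilinear_neg)
  then show ?thesis using jacobi0[of x y z] by (simp add: algebra_simps)
qed

lemma jacobi1': "l21 x (l21 y m) = l21 (l20 x y) m + l21 y (l21 x m) + l3 x y (l1 m)"
  using jacobi1[of x y m] by (simp add: multilinear_neg algebra_simps)

text \<open>The two unshuffle sums written out, with six and four terms. The signs on the right
  combine the sign of the unshuffle with that of \<open>l2(m, x) = - l2(x, m)\<close>.\<close>

lemma jacobi3:
  "l3 (l20 x y) z w - l3 (l20 x z) y w + l3 (l20 x w) y z
    + l3 (l20 y z) x w - l3 (l20 y w) x z + l3 (l20 z w) x y
   = - l21 w (l3 x y z) + l21 z (l3 x y w) - l21 y (l3 x z w) + l21 x (l3 y z w)"
proof -
  define u where "u = (\<lambda>i::nat. if i = 0 then x else if i = 1 then y else if i = 2 then z else w)"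
  have u: "u 0 = x" "u 1 = y" "u (Suc 0) = y" "u 2 = z" "u 3 = w" by (simp_all add: u_def)
  show ?thesis
    using l2_l3[of u] unfolding unshuffles_2_2 unshuffles_3_1
    by (simp add: perm4_eq_iff perm4_sign[simplified] u algebra_simps)
qed

end

subsection \<open>The master equation\<close>

lemma parity_dx: "parity b F \<Longrightarrow> parity b (dx \<epsilon> i F)"
proof -
  assume F: "parity b F"
  have "F S K \<noteq> 0" if "dx \<epsilon> i F S K \<noteq> 0" for S K
  proof
    assume "F S K = 0"
    then have "F S K = (\<lambda>_. 0)" by (simp add: zero_fun_def)
    then have "dx \<epsilon> i F S K = 0" by (simp add: dx_def zero_fun_def)
    with that show False by simp
  qed
  with F show ?thesis unfolding parity_def by meson
qed

lemma parity_dp: "parity b F \<Longrightarrow> parity b (dp i F)"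
  unfolding parity_def dp_def by (auto simp: fun_eq_iff)

lemma parity_dleft: "parity b F \<Longrightarrow> parity (\<not> b) (dleft j F)"
proof -
  assume F: "parity b F"
  have "finite S \<and> even (card S) = (\<not> b)" if nz: "dleft j F S K \<noteq> 0" for S K
  proof -
    have j: "j \<notin> S" "F (insert j S) K \<noteq> 0"
      using nz by (auto simp: dleft_def zero_fun_def)
    have fin: "finite (insert j S)" and ev: "even (card (insert j S)) = b"
      using F[unfolded parity_def, rule_format, OF j(2)] by (rule conjunct1, rule conjunct2)
    have "card (insert j S) = Suc (card S)" using j(1) fin by simp
    with ev fin show ?thesis by auto
  qed
  then show ?thesis by (simp add: parity_def)
qed

text \<open>For odd \<open>F\<close> the derivatives along the base and by \<open>p\<close> are odd
  and anticommute, while those by odd generators are even and commute, so the two halves of the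
  bracket coincide and it is enough to show that one of them vanishes.\<close>

lemma big_bracket_self:
  assumes F: "parity False F"
  shows "big_bracket n \<epsilon> r F F =
    ((\<Sum>i<n. dx \<epsilon> i F \<odot> dp i F) + (\<Sum>a<r. dleft (2 * a) F \<odot> dleft (Suc (2 * a)) F))
    + ((\<Sum>i<n. dx \<epsilon> i F \<odot> dp i F) + (\<Sum>a<r. dleft (2 * a) F \<odot> dleft (Suc (2 * a)) F))"
proof -
  have 1: "dp i F \<odot> dx \<epsilon> i F = - (dx \<epsilon> i F \<odot> dp i F)" for i
    using graded_commute[OF parity_dp[OF F] parity_dx[OF F]] by simp
  have 2: "dleft (Suc (2 * a)) F \<odot> dleft (2 * a) F = dleft (2 * a) F \<odot> dleft (Suc (2 * a)) F" for a
    using graded_commute[OF parity_dleft[OF F] parity_dleft[OF F], of "Suc (2 * a)" "2 * a"] by simp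
  show ?thesis
    unfolding big_bracket_def 1 dright_parity[OF F] Suc_eq_plus1[symmetric] if_False 2 diff_minus_eq_add
      sum.distrib
    by (simp only: ac_simps)
qed

lemma gfun_self_inverse_eq_zero: "(F :: 'b gfun) = - F \<Longrightarrow> F = 0"
  by (simp add: fun_eq_iff)

lemma tsum_diff: "tsum r (\<lambda>a. \<phi> a - \<psi> a) = tsum r \<phi> - tsum r \<psi>"
  by (simp only: tsum_def gmul_diff_right sum_subtractf)

lemma glinear_diff: "glinear \<Phi> \<Longrightarrow> \<Phi> (v - w) = \<Phi> v - \<Phi> w"
  using glinear_add[of \<Phi> v "- w"] glinear_minus[of \<Phi> w] by simp

text \<open>Symmetric coefficients cancel against anticommuting generators.\<close>

lemma tsum2_zero:
  assumes "\<And>a b. \<phi> a b = \<phi> b a"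
  shows "tsum r (\<lambda>a. tsum r (\<lambda>b. \<phi> a b)) = 0"
  using tsum_swap[of r \<phi>] by (intro gfun_self_inverse_eq_zero) (simp only: assms[symmetric])

text \<open>A cyclic permutation of three indices is even and leaves the total unchanged, so three
  times the total is the total of the cyclic sum.\<close>

lemma tsum3_zero:
  assumes "\<And>a b c. \<phi> a b c + \<phi> b c a + \<phi> c a b = 0"
  shows "tsum r (\<lambda>a. tsum r (\<lambda>b. tsum r (\<lambda>c. \<phi> a b c))) = 0" (is "?T \<phi> = 0")
proof -
  have s1: "?T \<psi> = - ?T (\<lambda>a b c. \<psi> b a c)" for \<psi>
    by (rule tsum_swap)
  have s2: "?T \<psi> = - ?T (\<lambda>a b c. \<psi> a c b)" for \<psi>
    by (subst tsum_minus[symmetric], rule tsum_cong, rule tsum_swap)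
  have "?T (\<lambda>a b c. \<phi> b c a) = ?T \<phi>"
    by (subst s1, subst s2) simp
  moreover have "?T (\<lambda>a b c. \<phi> c a b) = ?T \<phi>"
    by (subst s2, subst s1) simp
  moreover have "?T \<phi> + ?T (\<lambda>a b c. \<phi> b c a) + ?T (\<lambda>a b c. \<phi> c a b) = 0"
    by (simp only: tsum_add[symmetric] assms tsum_zero)
  ultimately have "?T \<phi> + ?T \<phi> + ?T \<phi> = 0" by simp
  then show ?thesis by (simp add: fun_eq_iff)
qed

text \<open>Permuting the indices multiplies the total by the sign of the permutation, so every
  signed unshuffle term has the same total: six of them for type (2,2), four for type (3,1). The
  multiples are written as repeated sums.\<close>

lemma tsum4_unshuffle:
  fixes \<phi> :: "nat \<Rightarrow> nat \<Rightarrow> nat \<Rightarrow> nat \<Rightarrow> 'b gfun" and r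
  defines "T \<equiv> (\<lambda>\<phi>. tsum r (\<lambda>a. tsum r (\<lambda>b. tsum r (\<lambda>c. tsum r (\<lambda>d. \<phi> a b c d)))))"
  shows "T (\<lambda>a b c d. \<phi> a b c d + \<phi> a b c d + \<phi> a b c d + \<phi> a b c d + \<phi> a b c d + \<phi> a b c d)
      = T (\<lambda>a b c d. \<phi> a b c d - \<phi> a c b d + \<phi> a d b c + \<phi> b c a d - \<phi> b d a c + \<phi> c d a b)" (is ?six)
    and "T (\<lambda>a b c d. \<phi> a b c d + \<phi> a b c d + \<phi> a b c d + \<phi> a b c d)
      = T (\<lambda>a b c d. \<phi> a b c d - \<phi> a b d c + \<phi> a c d b - \<phi> b c d a)" (is ?four)
proof -
  have s1: "T (\<lambda>a b c d. \<psi> b a c d) = - T \<psi>" for \<psi>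
    unfolding T_def by (rule tsum_swap)
  have s2: "T (\<lambda>a b c d. \<psi> a c b d) = - T \<psi>" for \<psi>
    unfolding T_def
    by (subst tsum_minus[symmetric], rule tsum_cong, rule tsum_swap)
  have s3: "T (\<lambda>a b c d. \<psi> a b d c) = - T \<psi>" for \<psi>
    unfolding T_def
    by (subst tsum_minus[symmetric], rule tsum_cong, subst tsum_minus[symmetric], rule tsum_cong,
        rule tsum_swap)
  \<comment> \<open>Each arrangement arises from an earlier one by one adjacent transposition
    \<open>s1\<close>, \<open>s2\<close> or \<open>s3\<close>.\<close>
  have acbd: "T (\<lambda>a b c d. \<phi> a c b d) = - T \<phi>" by (rule s2)
  have adbc: "T (\<lambda>a b c d. \<phi> a d b c) = T \<phi>"
    using s3[of "\<lambda>a b c d. \<phi> a c b d"] acbd by simp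
  have bcad: "T (\<lambda>a b c d. \<phi> b c a d) = T \<phi>"
    using s1[of "\<lambda>a b c d. \<phi> a c b d"] acbd by simp
  have bdac: "T (\<lambda>a b c d. \<phi> b d a c) = - T \<phi>"
    using s1[of "\<lambda>a b c d. \<phi> a d b c"] adbc by simp
  have cdab: "T (\<lambda>a b c d. \<phi> c d a b) = T \<phi>"
    using s2[of "\<lambda>a b c d. \<phi> b d a c"] bdac by simp
  have abdc: "T (\<lambda>a b c d. \<phi> a b d c) = - T \<phi>" by (rule s3)
  have acdb: "T (\<lambda>a b c d. \<phi> a c d b) = T \<phi>"
    using s2[of "\<lambda>a b c d. \<phi> a b d c"] abdc by simp
  have bcda: "T (\<lambda>a b c d. \<phi> b c d a) = - T \<phi>"
    using s1[of "\<lambda>a b c d. \<phi> a c d b"] acdb by simp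
  have add: "T (\<lambda>a b c d. \<psi> a b c d + \<psi>' a b c d) = T \<psi> + T \<psi>'"
    and diff: "T (\<lambda>a b c d. \<psi> a b c d - \<psi>' a b c d) = T \<psi> - T \<psi>'" for \<psi> \<psi>'
    by (simp_all only: T_def tsum_add tsum_diff)
  show ?six unfolding add diff acbd adbc bcad bdac cdab by simp
  show ?four unfolding add diff abdc acdb bcda by simp
qed

section \<open>The structure function of the algebra and its first derivatives\<close>

context based_Linf
begin

abbreviation X :: "'x \<Rightarrow> ('m \<Rightarrow>\<^sub>L real) gfun" where "X \<equiv> fun_0 r f"
abbreviation M :: "'m \<Rightarrow> ('m \<Rightarrow>\<^sub>L real) gfun" where "M \<equiv> fun_m1"
abbreviation L :: "('m \<Rightarrow>\<^sub>L real) gfun" where "L \<equiv> fun_l n e r f l1 l20 l21 l3"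
abbreviation \<epsilon> :: "nat \<Rightarrow> ('m \<Rightarrow>\<^sub>L real)" where "\<epsilon> \<equiv> dual_basis n e"

text \<open>\<open>sigma m = {m, l}\<close> and \<open>Psi x = {x, l}\<close>.\<close>

definition sigma :: "'m \<Rightarrow> ('m \<Rightarrow>\<^sub>L real) gfun" where
  "sigma m = X (l1 m) + tsum r (\<lambda>a. M (l21 (f a) m))"

definition Psi :: "'x \<Rightarrow> ('m \<Rightarrow>\<^sub>L real) gfun" where
  "Psi x = tsum r (\<lambda>b. X (l20 x (f b))) + psum n (\<lambda>k. M (l21 x (e k)))
    + tsum r (\<lambda>b. tsum r (\<lambda>c. M ((1/2) *\<^sub>R l3 x (f b) (f c))))"

text \<open>
  The derivatives of \<open>l\<close> by \<open>x\<^sup>i\<close> and by \<open>\<xi>\<^sup>c\<close> are \<open>l_dx\<close> and \<open>l_dxi\<close> of the \<open>i\<close>-th and \<open>c\<close>-th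
  coordinate; contracting them with \<open>\<Phi> (e i)\<close> or \<open>\<Phi> (f c)\<close> therefore amounts to inserting the linear
  map \<open>\<Phi>\<close> in place of the coordinates.
\<close>

definition l_dx :: "('m \<Rightarrow> ('m \<Rightarrow>\<^sub>L real) gfun) \<Rightarrow> ('m \<Rightarrow>\<^sub>L real) gfun" where
  "l_dx \<phi> = tsum r (\<lambda>a. psum n (\<lambda>k. \<phi> (l21 (f a) (e k))))
    + tsum r (\<lambda>a. tsum r (\<lambda>b. tsum r (\<lambda>c. \<phi> ((1/6) *\<^sub>R l3 (f a) (f b) (f c)))))"

definition l_dxi :: "('x \<Rightarrow> ('m \<Rightarrow>\<^sub>L real) gfun) \<Rightarrow> ('m \<Rightarrow>\<^sub>L real) gfun" where
  "l_dxi \<phi> = psum n (\<lambda>i. \<phi> (l1 (e i)))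
    + tsum r (\<lambda>a. tsum r (\<lambda>b. \<phi> ((1/2) *\<^sub>R l20 (f a) (f b))))"

lemma glinear_sigma: "glinear sigma"
  unfolding sigma_def[abs_def]
  by (intro glinear_plus glinear_tsum glinear_compose[OF glinear_fun_0[OF f]]
      glinear_compose[OF glinear_fun_m1] l1_linear l21_linear)

lemma glinear_Psi: "glinear Psi"
  unfolding Psi_def[abs_def]
  by (intro glinear_plus glinear_tsum glinear_psum glinear_compose[OF glinear_fun_0[OF f]]
      glinear_compose[OF glinear_fun_m1] linear_compose_scale_right l20_linear l21_linear l3_linear)

lemma fun_l1_eq: "fun_l1 n e r f l1 = psum n (\<lambda>i. X (l1 (e i)))"
  by (simp only: fun_l1_def psum_def)

lemma fun_l21_eq: "fun_l21 n e r f l21 = tsum r (\<lambda>a. psum n (\<lambda>i. M (l21 (f a) (e i))))"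
  by (simp only: fun_l21_def psum_def tsum_def gmul_sum_right gmul_assoc)

lemma fun_l20_eq:
  "fun_l20 r f l20 = tsum r (\<lambda>a. tsum r (\<lambda>b. X ((1/2) *\<^sub>R l20 (f a) (f b))))"
  by (simp only: fun_l20_def tsum_def gmul_sum_right gmul_assoc theta_eta fn_eta_commute
      glinear_scaleR[OF glinear_fun_0[OF f]])

lemma fun_l3_eq:
  "fun_l3 r f l3 = tsum r (\<lambda>a. tsum r (\<lambda>b. tsum r (\<lambda>c. M ((1/6) *\<^sub>R l3 (f a) (f b) (f c)))))"
  by (simp only: fun_l3_def tsum_def gmul_sum_right gmul_assoc theta_eta fn_eta_commute
      glinear_scaleR[OF glinear_fun_m1])

lemma L_eq: "L = psum n (\<lambda>i. X (l1 (e i)))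
    + (tsum r (\<lambda>a. psum n (\<lambda>i. M (l21 (f a) (e i))))
      + tsum r (\<lambda>a. tsum r (\<lambda>b. X ((1/2) *\<^sub>R l20 (f a) (f b)))))
    + tsum r (\<lambda>a. tsum r (\<lambda>b. tsum r (\<lambda>c. M ((1/6) *\<^sub>R l3 (f a) (f b) (f c)))))"
  by (simp only: fun_l_def fun_l1_eq fun_l20_eq fun_l21_eq fun_l3_eq)

lemmas regular_intros = regular_add regular_tsum regular_psum fun_0_regular fun_m1_regular

lemma regular_XM [simp]: "regular (X x)" "regular (M m)"
  by (rule fun_0_regular fun_m1_regular)+

lemma L_regular: "regular L"
  unfolding L_eq by (intro regular_intros)

lemma parity_L: "parity False L"
proof -
  have "parity False (X x)" "parity True (M m)" for x m
    by (rule parity_fun_0 parity_fun_m1)+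
  then show ?thesis
    unfolding L_eq
    by (intro parity_add parity_psum parity_tsum[where b = True, simplified]
        parity_tsum[where b = False, simplified]) auto
qed

text \<open>Only the \<open>l21\<close> and \<open>l3\<close> parts have coefficients that depend on
  the base point, through \<open>fun_m1\<close>.\<close>

lemma dx_L: "dx \<epsilon> i L = l_dx (\<lambda>m. fn (\<lambda>_. coord n e m i))"
proof -
  have z: "psum n (\<lambda>_. 0) = 0" "tsum r (\<lambda>_. 0) = (0 :: ('m \<Rightarrow>\<^sub>L real) gfun)" by simp_all
  show ?thesis
    unfolding L_eq l_dx_def
    by (subst dx_add dx_tsum dx_psum, (intro regular_intros)+)+
      (simp only: z dx_fun_0 dx_fun_m1[OF e] add_0_left add_0_right)
qed

lemma dp_L: "i < n \<Longrightarrow> dp i L = sigma (e i)"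
  unfolding L_eq sigma_def
  by (simp add: dp_add dp_psum dp_tsum)

text \<open>Only the \<open>l1\<close> and \<open>l20\<close> parts contain \<open>xi\<close>; the
  signs from passing two \<open>theta\<close> cancel.\<close>

lemma dleft_xi_L: "c < r \<Longrightarrow> dleft (2 * c) L = l_dxi (\<lambda>x. fn (\<lambda>_. coord r f x c))"
  unfolding L_eq l_dxi_def
  by (simp add: dleft_add dleft_psum dleft_xi_tsum dleft_xi_fun_0 tsum_minus)

text \<open>The derivative may hit any of the \<open>theta\<close> factors, and skewness makes the
  contributions equal: two times 1/2 gives 1 for \<open>l20\<close>, three times 1/6 gives 1/2 for
  \<open>l3\<close>.\<close>

lemma dleft_theta_L: "c < r \<Longrightarrow> dleft (Suc (2 * c)) L = Psi (f c)"
proof -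
  assume c: "c < r"
  have 1: "X (l20 (f c) (f b)) = X ((1/2) *\<^sub>R l20 (f c) (f b)) - X ((1/2) *\<^sub>R l20 (f b) (f c))" for b
    unfolding glinear_diff[OF glinear_fun_0[OF f], symmetric]
    by (subst (3) l20_skew) (simp flip: scaleR_add_left)
  have 2: "M ((1/2) *\<^sub>R l3 (f c) (f a) (f b)) = M ((1/6) *\<^sub>R l3 (f c) (f a) (f b))
      - (M ((1/6) *\<^sub>R l3 (f a) (f c) (f b)) - M ((1/6) *\<^sub>R l3 (f a) (f b) (f c)))" for a b
  proof -
    have "(1/2) *\<^sub>R v = (1/6) *\<^sub>R v - (- ((1/6) *\<^sub>R v) - (1/6) *\<^sub>R v)" for v :: 'm
      by (simp flip: scaleR_minus_left scaleR_diff_left)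
    moreover have "l3 (f a) (f c) (f b) = - l3 (f c) (f a) (f b)" "l3 (f a) (f b) (f c) = l3 (f c) (f a) (f b)"
      using l3_skew by metis+
    ultimately show ?thesis
      by (simp only: glinear_diff[OF glinear_fun_m1, symmetric] scaleR_minus_right)
  qed
  show ?thesis
    unfolding L_eq Psi_def 1 2
    by (simp add: dleft_add dleft_psum dleft_theta_tsum dleft_theta_fun_0 c tsum_diff)
qed

text \<open>The right factor moves inside the contractions, where \<open>glinear_coord\<close>
  recombines coordinates and basis values.\<close>

lemma l_dx_contract:
  assumes "glinear \<Phi>"
  shows "(\<Sum>i<n. l_dx (\<lambda>m. fn (\<lambda>_. coord n e m i)) \<odot> \<Phi> (e i)) = l_dx \<Phi>"
  unfolding l_dx_def gmul_add_left sum.distrib tsum_gmul psum_gmul tsum_sum[symmetric]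
    psum_sum[symmetric] glinear_coord[OF e assms] ..

lemma l_dxi_contract:
  assumes "glinear \<Phi>"
  shows "(\<Sum>c<r. l_dxi (\<lambda>x. fn (\<lambda>_. coord r f x c)) \<odot> \<Phi> (f c)) = l_dxi \<Phi>"
  unfolding l_dxi_def gmul_add_left sum.distrib tsum_gmul psum_gmul tsum_sum[symmetric]
    psum_sum[symmetric] glinear_coord[OF f assms] ..

section \<open>The components of the master equation by type of monomial\<close>

lemma l_dx_sigma: "l_dx sigma =
    tsum r (\<lambda>a. psum n (\<lambda>k. X (l1 (l21 (f a) (e k)))))
    + tsum r (\<lambda>a. tsum r (\<lambda>b. psum n (\<lambda>k. M (l21 (f b) (l21 (f a) (e k))))))
    + (tsum r (\<lambda>a. tsum r (\<lambda>b. tsum r (\<lambda>c. X (l1 ((1/6) *\<^sub>R l3 (f a) (f b) (f c))))))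
    + tsum r (\<lambda>a. tsum r (\<lambda>b. tsum r (\<lambda>c. tsum r (\<lambda>d.
        M (l21 (f d) ((1/6) *\<^sub>R l3 (f a) (f b) (f c))))))))"
  by (simp only: l_dx_def sigma_def tsum_add psum_add psum_tsum)

lemma l_dxi_Psi: "l_dxi Psi =
    tsum r (\<lambda>a. psum n (\<lambda>k. X (l20 (l1 (e k)) (f a))))
    + psum n (\<lambda>i. psum n (\<lambda>k. M (l21 (l1 (e i)) (e k))))
    + tsum r (\<lambda>a. tsum r (\<lambda>b. psum n (\<lambda>k. M ((1/2) *\<^sub>R l3 (l1 (e k)) (f a) (f b)))))
    + (tsum r (\<lambda>a. tsum r (\<lambda>b. tsum r (\<lambda>c. X (l20 ((1/2) *\<^sub>R l20 (f a) (f b)) (f c)))))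
    + tsum r (\<lambda>a. tsum r (\<lambda>b. psum n (\<lambda>k. M (l21 ((1/2) *\<^sub>R l20 (f a) (f b)) (e k)))))
    + tsum r (\<lambda>a. tsum r (\<lambda>b. tsum r (\<lambda>c. tsum r (\<lambda>d.
        M ((1/2) *\<^sub>R l3 ((1/2) *\<^sub>R l20 (f a) (f b)) (f c) (f d)))))))"
  by (simp only: l_dxi_def Psi_def tsum_add psum_add psum_tsum)

text \<open>In the names, \<open>p\<close> stands for \<open>pvar\<close>, \<open>t\<close> for
  \<open>theta\<close> and \<open>x\<close> for \<open>xi\<close>; \<open>ttx_part\<close> and
  \<open>ttt_part\<close> have one \<open>theta\<close> more than shown. Here the coefficients
  already cancel, by \<open>l1_l2\<close> and skewness of \<open>l20\<close>.\<close>

lemma ptx_part: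
  "tsum r (\<lambda>a. psum n (\<lambda>k. X (l1 (l21 (f a) (e k)))))
    + tsum r (\<lambda>a. psum n (\<lambda>k. X (l20 (l1 (e k)) (f a)))) = 0"
proof -
  have "X (l1 (l21 (f a) (e k))) + X (l20 (l1 (e k)) (f a)) = 0" for a k
    unfolding glinear_add[OF glinear_fun_0[OF f], symmetric] l1_l2
    using l20_skew[of "l1 (e k)" "f a"] glinear_zero[OF glinear_fun_0[OF f]] by simp
  then show ?thesis
    by (simp only: tsum_add[symmetric] psum_add[symmetric] psum_zero tsum_zero)
qed

text \<open>The axiom \<open>l2_l1\<close> makes the coefficient skew in \<open>i\<close> and
  \<open>k\<close>, whereas the \<open>pvar\<close> commute.\<close>

lemma pp_part: "psum n (\<lambda>i. psum n (\<lambda>k. M (l21 (l1 (e i)) (e k)))) = 0"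
proof (rule gfun_self_inverse_eq_zero)
  have eq: "M (l21 (l1 (e k)) (e i)) = - M (l21 (l1 (e i)) (e k))" for i k
    using l2_l1[of "e k" "e i"] glinear_minus[OF glinear_fun_m1] by metis
  have "psum n (\<lambda>i. psum n (\<lambda>k. M (l21 (l1 (e i)) (e k))))
      = psum n (\<lambda>i. psum n (\<lambda>k. M (l21 (l1 (e k)) (e i))))"
    by (rule psum_swap)
  also have "\<dots> = psum n (\<lambda>i. psum n (\<lambda>k. - M (l21 (l1 (e i)) (e k))))"
    by (rule psum_cong, rule psum_cong, rule eq)
  finally show "psum n (\<lambda>i. psum n (\<lambda>k. M (l21 (l1 (e i)) (e k))))
      = - psum n (\<lambda>i. psum n (\<lambda>k. M (l21 (l1 (e i)) (e k))))"
    by (simp only: psum_minus)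
qed

text \<open>By \<open>jacobi1'\<close> the total coefficient is symmetric in \<open>a\<close> and
  \<open>b\<close>, so \<open>tsum2_zero\<close> applies.\<close>

lemma ptt_part:
  "tsum r (\<lambda>a. tsum r (\<lambda>b. psum n (\<lambda>k. M (l21 (f b) (l21 (f a) (e k))))))
    + tsum r (\<lambda>a. tsum r (\<lambda>b. psum n (\<lambda>k. M ((1/2) *\<^sub>R l3 (l1 (e k)) (f a) (f b)))))
    + tsum r (\<lambda>a. tsum r (\<lambda>b. psum n (\<lambda>k. M (l21 ((1/2) *\<^sub>R l20 (f a) (f b)) (e k))))) = 0"
proof -
  have "l21 (f b) (l21 (f a) (e k)) + (1/2) *\<^sub>R l3 (l1 (e k)) (f a) (f b)
        + l21 ((1/2) *\<^sub>R l20 (f a) (f b)) (e k)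
      = l21 (f a) (l21 (f b) (e k)) + (1/2) *\<^sub>R l3 (l1 (e k)) (f b) (f a)
        + l21 ((1/2) *\<^sub>R l20 (f b) (f a)) (e k)" for a b k
  proof -
    have "l3 (l1 (e k)) (f a) (f b) = l3 (f a) (f b) (l1 (e k))"
      "l3 (l1 (e k)) (f b) (f a) = - l3 (f a) (f b) (l1 (e k))"
      using l3_skew by metis+
    then show ?thesis
      using jacobi1'[of "f a" "f b" "e k"] l20_skew[of "f b" "f a"]
      by (simp add: multilinear_scale multilinear_neg algebra_simps flip: scaleR_add_left)
  qed
  then show ?thesis
    unfolding tsum_add[symmetric] psum_add[symmetric] glinear_add[OF glinear_fun_m1, symmetric]
    by (intro tsum2_zero) simp
qed

text \<open>The cyclic sum of the coefficients is half of \<open>jacobi0\<close>: three times 1/6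
  makes 1/2 for the \<open>l3\<close> term, matching the 1/2 in front of \<open>l20\<close>.\<close>

lemma ttx_part:
  "tsum r (\<lambda>a. tsum r (\<lambda>b. tsum r (\<lambda>c. X (l1 ((1/6) *\<^sub>R l3 (f a) (f b) (f c))))))
    + tsum r (\<lambda>a. tsum r (\<lambda>b. tsum r (\<lambda>c. X (l20 ((1/2) *\<^sub>R l20 (f a) (f b)) (f c))))) = 0"
proof -
  have "(l1 ((1/6) *\<^sub>R l3 x y z) + l20 ((1/2) *\<^sub>R l20 x y) z)
      + (l1 ((1/6) *\<^sub>R l3 y z x) + l20 ((1/2) *\<^sub>R l20 y z) x)
      + (l1 ((1/6) *\<^sub>R l3 z x y) + l20 ((1/2) *\<^sub>R l20 z x) y) = 0" for x y z
  proof -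
    have "l3 y z x = l3 x y z" "l3 z x y = l3 x y z" using l3_skew by metis+
    then have "(l1 ((1/6) *\<^sub>R l3 x y z) + l20 ((1/2) *\<^sub>R l20 x y) z)
      + (l1 ((1/6) *\<^sub>R l3 y z x) + l20 ((1/2) *\<^sub>R l20 y z) x)
      + (l1 ((1/6) *\<^sub>R l3 z x y) + l20 ((1/2) *\<^sub>R l20 z x) y)
      = (1/2) *\<^sub>R (l20 (l20 x y) z + l20 (l20 y z) x + l20 (l20 z x) y)
        + ((1/6) + (1/6) + (1/6)) *\<^sub>R l1 (l3 x y z)"
      by (simp only: multilinear_scale scaleR_add_right scaleR_add_left ac_simps)
    also have "\<dots> = (1/2) *\<^sub>R (l20 (l20 x y) z + l20 (l20 y z) x + l20 (l20 z x) y + l1 (l3 x y z))"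
      by (simp add: scaleR_add_right)
    finally show ?thesis by (simp add: jacobi0)
  qed
  then show ?thesis
    unfolding tsum_add[symmetric] glinear_add[OF glinear_fun_0[OF f], symmetric]
    by (intro tsum3_zero) (simp add: glinear_zero[OF glinear_fun_0[OF f]]
      flip: glinear_add[OF glinear_fun_0[OF f]])
qed

text \<open>Since 1/6 = 4/24 and 1/4 = 6/24, each of the 4 and 6 unshuffle terms receives the same
  weight 1/24, and \<open>jacobi3\<close> applies.\<close>

lemma ttt_part:
  "tsum r (\<lambda>a. tsum r (\<lambda>b. tsum r (\<lambda>c. tsum r (\<lambda>d.
        M (l21 (f d) ((1/6) *\<^sub>R l3 (f a) (f b) (f c)))))))
    + tsum r (\<lambda>a. tsum r (\<lambda>b. tsum r (\<lambda>c. tsum r (\<lambda>d.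
        M ((1/2) *\<^sub>R l3 ((1/2) *\<^sub>R l20 (f a) (f b)) (f c) (f d)))))) = 0"
proof -
  define A where "A a b c d = (1/24) *\<^sub>R l3 (l20 (f a) (f b)) (f c) (f d)" for a b c d
  define B where "B a b c d = (1/24) *\<^sub>R l21 (f d) (l3 (f a) (f b) (f c))" for a b c d
  note add = glinear_add[OF glinear_fun_m1] and diff = glinear_diff[OF glinear_fun_m1]
  have B: "M (l21 (f d) ((1/6) *\<^sub>R l3 (f a) (f b) (f c)))
      = M (B a b c d) + M (B a b c d) + M (B a b c d) + M (B a b c d)" for a b c d
    by (simp add: B_def multilinear_scale flip: add scaleR_add_left)
  have A: "M ((1/2) *\<^sub>R l3 ((1/2) *\<^sub>R l20 (f a) (f b)) (f c) (f d))
      = M (A a b c d) + M (A a b c d) + M (A a b c d) + M (A a b c d) + M (A a b c d) + M (A a b c d)"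
    for a b c d
    by (simp add: A_def multilinear_scale flip: add scaleR_add_left)
  have "(B a b c d - B a b d c + B a c d b - B b c d a)
      + (A a b c d - A a c b d + A a d b c + A b c a d - A b d a c + A c d a b) = 0" for a b c d
    using arg_cong[OF jacobi3[of "f a" "f b" "f c" "f d"], of "\<lambda>v. (1/24) *\<^sub>R v"]
    by (simp add: A_def B_def scaleR_add_right scaleR_diff_right algebra_simps)
  then show ?thesis
    unfolding A B
    unfolding tsum4_unshuffle
    unfolding tsum_add[symmetric] add[symmetric] diff[symmetric]
    by (simp add: glinear_zero[OF glinear_fun_m1])
qed

text \<open>One half of \<open>{l, l}\<close> is \<open>l_dx sigma + l_dxi Psi\<close>: the
  derivatives by \<open>p\<close> and \<open>theta\<close> are inserted into those by
  \<open>x\<close> and \<open>xi\<close>.\<close>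

lemma master_equation: "big_bracket n \<epsilon> r L L = 0"
proof -
  have "(\<Sum>i<n. dx \<epsilon> i L \<odot> dp i L) = l_dx sigma"
    unfolding l_dx_contract[OF glinear_sigma, symmetric] by (simp add: dx_L dp_L)
  moreover have "(\<Sum>a<r. dleft (2 * a) L \<odot> dleft (Suc (2 * a)) L) = l_dxi Psi"
    unfolding l_dxi_contract[OF glinear_Psi, symmetric] by (simp add: dleft_xi_L dleft_theta_L)
  moreover have "l_dx sigma + l_dxi Psi = 0"
  proof -
    \<comment> \<open>The summands are regrouped by type, so that each group is one of the five
      component lemmas.\<close>
    have "l_dx sigma + l_dxi Psi = (A1 + B1) + B2 + (A2 + B3 + C2) + (A3 + C1) + (A4 + C3)"
      if "l_dx sigma = A1 + A2 + (A3 + A4)" "l_dxi Psi = B1 + B2 + B3 + (C1 + C2 + C3)"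
      for A1 A2 A3 A4 B1 B2 B3 C1 C2 C3
      unfolding that by (simp only: ac_simps)
    from this[OF l_dx_sigma l_dxi_Psi] show ?thesis
      unfolding ptx_part pp_part ptt_part ttx_part ttt_part by simp
  qed
  ultimately show ?thesis
    unfolding big_bracket_self[OF parity_L] by simp
qed

end

subsection \<open>Types of the structure functions\<close>

lemma gfunctions_zero: "0 \<in> gfunctions n r"
  by (simp add: gfunctions_def)

lemma gfunctionsD:
  assumes "F \<in> gfunctions n r"
  shows "F S K \<noteq> 0 \<Longrightarrow> S \<subseteq> {..<2 * r} \<and> set_mset K \<subseteq> {..<n}"
    and "finite {(S, K). F S K \<noteq> 0}" and "smooth (F S K)"
  using assms by (auto simp: gfunctions_def)

lemma gfunctionsI:
  assumes "\<And>S K. F S K \<noteq> 0 \<Longrightarrow> S \<subseteq> {..<2 * r} \<and> set_mset K \<subseteq> {..<n}"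
    and "finite {(S, K). F S K \<noteq> 0}" and "\<And>S K. smooth (F S K)"
  shows "F \<in> gfunctions n r"
  using assms by (simp add: gfunctions_def)

lemma gfunctions_add:
  assumes "F \<in> gfunctions n r" "G \<in> gfunctions n r"
  shows "F + G \<in> gfunctions n r"
proof -
  have "{(S, K). (F + G) S K \<noteq> 0} \<subseteq> {(S, K). F S K \<noteq> 0} \<union> {(S, K). G S K \<noteq> 0}" by auto
  then have fin: "finite {(S, K). (F + G) S K \<noteq> 0}"
    by (rule finite_subset) (intro finite_UnI gfunctionsD(2)[OF assms(1)] gfunctionsD(2)[OF assms(2)])
  have nz: "F S K \<noteq> 0 \<or> G S K \<noteq> 0" if "(F + G) S K \<noteq> 0" for S K
    using that by auto
  have sm: "smooth ((F + G) S K)" for S K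
    using smooth_plus_fun[OF gfunctionsD(3)[OF assms(1)] gfunctionsD(3)[OF assms(2)]] by simp
  show ?thesis
    by (rule gfunctionsI[OF _ fin sm]) (use nz gfunctionsD(1)[OF assms(1)] gfunctionsD(1)[OF assms(2)] in blast)
qed

lemma gfunctions_minus: "F \<in> gfunctions n r \<Longrightarrow> - F \<in> gfunctions n r"
  by (simp add: gfunctions_def smooth_uminus_fun)

lemma gfunctions_sum: "(\<And>i. i \<in> I \<Longrightarrow> F i \<in> gfunctions n r) \<Longrightarrow> (\<Sum>i\<in>I. F i) \<in> gfunctions n r"
  by (induction I rule: infinite_finite_induct) (auto intro: gfunctions_add gfunctions_zero)

lemma gfunctions_regular: "F \<in> gfunctions n r \<Longrightarrow> regular F"
  unfolding gfunctions_def regular_def odd_finite_def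
  by (auto dest: finite_subset)

text \<open>The support of the product lies in the image of the product of the two supports under
  union of sets and sum of multisets, hence is finite.\<close>

lemma gfunctions_gmul:
  assumes F: "F \<in> gfunctions n r" and G: "G \<in> gfunctions n r"
  shows "F \<odot> G \<in> gfunctions n r"
proof -
  have sub: "\<exists>T L. F T L \<noteq> 0 \<and> G (S - T) (K - L) \<noteq> 0 \<and> S = T \<union> (S - T) \<and> K = L + (K - L)"
    if "(F \<odot> G) S K \<noteq> 0" for S K
  proof -
    from that obtain T L where "T \<subseteq> S" "L \<subseteq># K" "F T L \<noteq> 0" "G (S - T) (K - L) \<noteq> 0"
      by (rule gmul_nonzero)
    then show ?thesis by (intro exI[of _ T] exI[of _ L]) (auto simp: subset_mset.add_diff_inverse)
  qed
  have "{(S, K). (F \<odot> G) S K \<noteq> 0} \<subseteq> (\<lambda>((T, L), (T', L')). (T \<union> T', L + L')) `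
      ({(S, K). F S K \<noteq> 0} \<times> {(S, K). G S K \<noteq> 0})"
  proof (rule subsetI, clarify)
    fix S K assume "(F \<odot> G) S K \<noteq> 0"
    from sub[OF this] obtain T L where
      TL: "F T L \<noteq> 0" "G (S - T) (K - L) \<noteq> 0" "S = T \<union> (S - T)" "K = L + (K - L)"
      by (elim exE conjE)
    have "((T, L), (S - T, K - L)) \<in> {(S, K). F S K \<noteq> 0} \<times> {(S, K). G S K \<noteq> 0}"
      using TL(1,2) by simp
    moreover have "(S, K) = (\<lambda>((T, L), (T', L')). (T \<union> T', L + L')) ((T, L), (S - T, K - L))"
      unfolding prod.case by (rule arg_cong2[OF TL(3,4)])
    ultimately show "(S, K) \<in> (\<lambda>((T, L), (T', L')). (T \<union> T', L + L')) `
      ({(S, K). F S K \<noteq> 0} \<times> {(S, K). G S K \<noteq> 0})" by (rule rev_image_eqI)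
  qed
  then have "finite {(S, K). (F \<odot> G) S K \<noteq> 0}"
    by (rule finite_subset) (intro finite_imageI finite_cartesian_product gfunctionsD(2)[OF F] gfunctionsD(2)[OF G])
  moreover have "S \<subseteq> {..<2 * r} \<and> set_mset K \<subseteq> {..<n}" if "(F \<odot> G) S K \<noteq> 0" for S K
  proof -
    from sub[OF that] obtain T L where
      TL: "F T L \<noteq> 0" "G (S - T) (K - L) \<noteq> 0" "S = T \<union> (S - T)" "K = L + (K - L)"
      by (elim exE conjE)
    then have "T \<subseteq> {..<2 * r}" "S - T \<subseteq> {..<2 * r}" "set_mset L \<subseteq> {..<n}" "set_mset (K - L) \<subseteq> {..<n}"
      using gfunctionsD(1)[OF F TL(1)] gfunctionsD(1)[OF G TL(2)] by simp_all
    moreover have "set_mset K = set_mset L \<union> set_mset (K - L)"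
      using arg_cong[OF TL(4), of set_mset] by simp
    ultimately show ?thesis using TL(3) by blast
  qed
  moreover have "smooth ((F \<odot> G) S K)" for S K
    using regular_gmul[OF gfunctions_regular[OF F] gfunctions_regular[OF G]] by (rule regular_smooth)
  ultimately show ?thesis by (intro gfunctionsI)
qed

lemma gfunctions_monomial:
  assumes "S \<subseteq> {..<2 * r}" "set_mset K \<subseteq> {..<n}" "smooth h"
  shows "monomial S K h \<in> gfunctions n r"
proof -
  have nz: "S' = S \<and> K' = K" if "monomial S K h S' K' \<noteq> 0" for S' K'
    using that by (auto simp: monomial_def zero_fun_def split: if_splits)
  then have "{(S', K'). monomial S K h S' K' \<noteq> 0} \<subseteq> {(S, K)}" by auto
  then have "finite {(S', K'). monomial S K h S' K' \<noteq> 0}" by (rule finite_subset) simp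
  then show ?thesis
  proof (rule gfunctionsI[rotated])
    show "smooth (monomial S K h S' K')" for S' K' by (rule smooth_monomial[OF assms(3)])
    show "S' \<subseteq> {..<2 * r} \<and> set_mset K' \<subseteq> {..<n}" if "monomial S K h S' K' \<noteq> 0" for S' K'
      using nz[OF that] assms by simp
  qed
qed

lemma gfunctions_fn: "smooth h \<Longrightarrow> fn h \<in> gfunctions n r"
  unfolding fn_def by (intro gfunctions_monomial) auto

lemma gfunctions_eta: "j < 2 * r \<Longrightarrow> eta j \<in> gfunctions n r"
  unfolding eta_def by (intro gfunctions_monomial) auto

lemma gfunctions_pvar: "i < n \<Longrightarrow> pvar i \<in> gfunctions n r"
  unfolding pvar_def by (intro gfunctions_monomial) auto

lemma gfunctions_tsum: "(\<And>a. \<phi> a \<in> gfunctions n r) \<Longrightarrow> tsum r \<phi> \<in> gfunctions n r"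
  unfolding tsum_def theta_eta by (intro gfunctions_sum gfunctions_gmul gfunctions_eta) auto

lemma gfunctions_psum: "(\<And>a. \<phi> a \<in> gfunctions n r) \<Longrightarrow> psum n \<phi> \<in> gfunctions n r"
  unfolding psum_def by (intro gfunctions_sum gfunctions_gmul gfunctions_pvar) auto

lemma gfunctions_fun_0: "fun_0 r f x \<in> gfunctions n r"
  unfolding fun_0_def xi_eta
  by (intro gfunctions_sum gfunctions_gmul gfunctions_eta gfunctions_fn) auto

lemma gfunctions_fun_m1: "fun_m1 m \<in> gfunctions n r"
  unfolding fun_m1_def by (intro gfunctions_fn smooth_blinfun_apply)

lemma has_type_zero: "has_type r C 0"
  by (simp add: has_type_def)

lemma has_type_minus: "has_type r C F \<Longrightarrow> has_type r C (- F)"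
  by (simp add: has_type_def)

lemma has_type_add: "has_type r C F \<Longrightarrow> has_type r C G \<Longrightarrow> has_type r C (F + G)"
proof -
  assume FG: "has_type r C F" "has_type r C G"
  show ?thesis
    unfolding has_type_def
  proof (intro allI impI)
    fix S K assume "(F + G) S K \<noteq> 0"
    then consider "F S K \<noteq> 0" | "G S K \<noteq> 0" by fastforce
    then show "(size K, card {a. a < r \<and> 2 * a \<in> S}, card {a. a < r \<and> 2 * a + 1 \<in> S}) \<in> C"
      by cases (rule FG[unfolded has_type_def, rule_format], assumption)+
  qed
qed

lemma has_type_sum: "(\<And>i. i \<in> I \<Longrightarrow> has_type r C (F i)) \<Longrightarrow> has_type r C (\<Sum>i\<in>I. F i)"
  by (induction I rule: infinite_finite_induct) (auto intro: has_type_add has_type_zero)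

lemma has_type_mono: "has_type r C F \<Longrightarrow> C \<subseteq> D \<Longrightarrow> has_type r D F"
  unfolding has_type_def by blast

text \<open>The index sets of the two factors are disjoint, so the counts add. Single types are
  tracked; the sets of several types come back through \<open>has_type_mono\<close>.\<close>

lemma has_type_gmul:
  assumes "has_type r {(i, j, k)} F" "has_type r {(i', j', k')} G"
  shows "has_type r {(i + i', j + j', k + k')} (F \<odot> G)"
  unfolding has_type_def
proof (intro allI impI)
  fix S K assume "(F \<odot> G) S K \<noteq> 0"
  then obtain T L where TL: "T \<subseteq> S" "L \<subseteq># K" "F T L \<noteq> 0" "G (S - T) (K - L) \<noteq> 0"
    by (rule gmul_nonzero)
  have card: "card {a. a < r \<and> g a \<in> S} = card {a. a < r \<and> g a \<in> T} + card {a. a < r \<and> g a \<in> S - T}"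
    for g :: "nat \<Rightarrow> nat"
  proof -
    have "{a. a < r \<and> g a \<in> S} = {a. a < r \<and> g a \<in> T} \<union> {a. a < r \<and> g a \<in> S - T}"
      using TL(1) by auto
    then show ?thesis by (simp only:) (rule card_Un_disjoint, auto)
  qed
  have "size K = size L + size (K - L)"
    using TL(2) by (metis size_union subset_mset.add_diff_inverse)
  moreover have "(size L, card {a. a < r \<and> 2 * a \<in> T}, card {a. a < r \<and> 2 * a + 1 \<in> T}) = (i, j, k)"
    using assms(1)[unfolded has_type_def, rule_format, OF TL(3)] by (rule singletonD)
  moreover have "(size (K - L), card {a. a < r \<and> 2 * a \<in> S - T}, card {a. a < r \<and> 2 * a + 1 \<in> S - T})
      = (i', j', k')"
    using assms(2)[unfolded has_type_def, rule_format, OF TL(4)] by (rule singletonD)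
  ultimately show "(size K, card {a. a < r \<and> 2 * a \<in> S}, card {a. a < r \<and> 2 * a + 1 \<in> S})
      \<in> {(i + i', j + j', k + k')}"
    unfolding card[of "\<lambda>a. 2 * a"] card[of "\<lambda>a. 2 * a + 1"] by (simp only: prod.inject singleton_iff)
qed

lemma has_type_monomial:
  "has_type r {(size K, card {a. a < r \<and> 2 * a \<in> S}, card {a. a < r \<and> 2 * a + 1 \<in> S})}
     (monomial S K h)"
  unfolding has_type_def monomial_def by (auto simp: zero_fun_def)

lemma has_type_fn: "has_type r {(0, 0, 0)} (fn h)"
  using has_type_monomial[of r "{#}" "{}" h] by (simp add: fn_def)

lemma has_type_pvar: "has_type r {(1, 0, 0)} (pvar i)"
  using has_type_monomial[of r "{#i#}" "{}"] by (simp add: pvar_def)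

lemma has_type_xi: "a < r \<Longrightarrow> has_type r {(0, 1, 0)} (xi a)"
proof -
  assume "a < r"
  then have A: "{b. b < r \<and> 2 * b \<in> {2 * a}} = {a}" and B: "{b. b < r \<and> 2 * b + 1 \<in> {2 * a}} = {}"
    by (auto; presburger)+
  show ?thesis
    using has_type_monomial[of r "{#}" "{2 * a}" "\<lambda>_. 1", unfolded A B] by (simp add: xi_def)
qed

lemma has_type_theta: "a < r \<Longrightarrow> has_type r {(0, 0, 1)} (theta a)"
proof -
  assume "a < r"
  then have A: "{b. b < r \<and> 2 * b + 1 \<in> {2 * a + 1}} = {a}" and B: "{b. b < r \<and> 2 * b \<in> {2 * a + 1}} = {}"
    by (auto; presburger)+
  show ?thesis
    using has_type_monomial[of r "{#}" "{2 * a + 1}" "\<lambda>_. 1", unfolded A B] by (simp add: theta_def)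
qed

lemma has_type_tsum:
  "(\<And>a. has_type r {(i, j, k)} (\<phi> a)) \<Longrightarrow> has_type r {(i, j, Suc k)} (tsum r \<phi>)"
  unfolding tsum_def
  by (intro has_type_sum) (use has_type_gmul[OF has_type_theta, of _ r i j k] in fastforce)

lemma has_type_psum:
  "(\<And>a. has_type r {(i, j, k)} (\<phi> a)) \<Longrightarrow> has_type r {(Suc i, j, k)} (psum n \<phi>)"
  unfolding psum_def
  by (intro has_type_sum) (use has_type_gmul[OF has_type_pvar, of r i j k] in fastforce)

lemma has_type_fun_0: "has_type r {(0, 1, 0)} (fun_0 r f x)"
  unfolding fun_0_def
  by (intro has_type_sum) (use has_type_gmul[OF has_type_fn has_type_xi] in fastforce)

lemma has_type_fun_m1: "has_type r {(0, 0, 0)} (fun_m1 m)"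
  unfolding fun_m1_def by (rule has_type_fn)

lemma big_bracket_minus_minus: "big_bracket n \<epsilon> r (- F) (- F) = big_bracket n \<epsilon> r F F"
  if "regular F"
proof -
  have "dright j (- F) = - dright j F" for j
    by (simp add: fun_eq_iff dright_def)
  moreover have "dx \<epsilon> i (- F) = - dx \<epsilon> i F" for i
    using dx_add[OF that regular_minus[OF that], of \<epsilon> i]
    by (simp add: eq_neg_iff_add_eq_0 add.commute)
  ultimately show ?thesis
    unfolding big_bracket_def dp_minus dleft_minus
    by (simp only: gmul_minus_left gmul_minus_right minus_minus)
qed

context based_Linf
begin

lemma lie_quasi_bialgebroid_Linf:
  "lie_quasi_bialgebroid n \<epsilon> r (- fun_l1 n e r f l1) (- fun_l20 r f l20 - fun_l21 n e r f l21)
     (- fun_l3 r f l3)"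
proof -
  note g = gfunctions_tsum gfunctions_psum gfunctions_fun_0 gfunctions_fun_m1
  note t = has_type_tsum has_type_psum has_type_fun_0 has_type_fun_m1
  have 1: "fun_l1 n e r f l1 \<in> gfunctions n r" "has_type r {(1, 1, 0)} (fun_l1 n e r f l1)"
    unfolding fun_l1_eq One_nat_def by (intro g t[unfolded One_nat_def])+
  have 20: "(fun_l20 r f l20 :: ('m \<Rightarrow>\<^sub>L real) gfun) \<in> gfunctions n r" "has_type r {(0, 1, 2)} (fun_l20 r f l20 :: ('m \<Rightarrow>\<^sub>L real) gfun)"
  proof -
    show "(fun_l20 r f l20 :: ('m \<Rightarrow>\<^sub>L real) gfun) \<in> gfunctions n r"
      unfolding fun_l20_eq by (intro g)
    have "has_type r {(0, 1, Suc (Suc 0))} (fun_l20 r f l20 :: ('m \<Rightarrow>\<^sub>L real) gfun)"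
      unfolding fun_l20_eq by (intro t)
    then show "has_type r {(0, 1, 2)} (fun_l20 r f l20 :: ('m \<Rightarrow>\<^sub>L real) gfun)" by (simp only: numeral_2_eq_2)
  qed
  have 21: "fun_l21 n e r f l21 \<in> gfunctions n r" "has_type r {(1, 0, 1)} (fun_l21 n e r f l21)"
    unfolding fun_l21_eq One_nat_def by (intro g t[unfolded One_nat_def])+
  have 3: "fun_l3 r f l3 \<in> gfunctions n r" "has_type r {(0, 0, 3)} (fun_l3 r f l3)"
    unfolding fun_l3_eq One_nat_def numeral_3_eq_3 by (intro g t[unfolded One_nat_def])+
  have "- fun_l1 n e r f l1 + (- fun_l20 r f l20 - fun_l21 n e r f l21) + - fun_l3 r f l3 = - L"
    by (simp only: fun_l_def minus_add_distrib diff_conv_add_uminus ac_simps)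
  then have "big_bracket n \<epsilon> r
      (- fun_l1 n e r f l1 + (- fun_l20 r f l20 - fun_l21 n e r f l21) + - fun_l3 r f l3)
      (- fun_l1 n e r f l1 + (- fun_l20 r f l20 - fun_l21 n e r f l21) + - fun_l3 r f l3) = 0"
    by (simp only: big_bracket_minus_minus[OF L_regular] master_equation)
  then show ?thesis
    unfolding lie_quasi_bialgebroid_def diff_conv_add_uminus
    by (intro conjI gfunctions_minus gfunctions_add has_type_minus has_type_add
        has_type_mono[OF 1(2)] has_type_mono[OF 20(2)] has_type_mono[OF 21(2)] 1 20 21 3) auto
qed

end

subsection \<open>Sections as functions of degree 1\<close>

lemma gmul_fn_commute: "parity b F \<Longrightarrow> F \<odot> fn h = fn h \<odot> F"
  using graded_commute[OF _ parity_fn, of b F h] by simp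

lemma eta_fn: "eta j \<odot> fn h = fn h \<odot> eta j"
  by (rule gmul_fn_commute[OF parity_eta])

lemma frechet_derivative_bounded_linear:
  assumes "bounded_linear g" "smooth h"
  shows "frechet_derivative (\<lambda>p. g (h p)) (at p) = (\<lambda>v. g (frechet_derivative h (at p) v))"
  by (intro frechet_derivativeI bounded_linear.has_derivative[OF assms(1)] has_derivative_frechet
      smooth_differentiable assms(2))

locale based_space =
  fixes r :: nat and f :: "nat \<Rightarrow> 'x::real_normed_vector"
  assumes f: "is_basis r f"
begin

abbreviation S :: "('b::real_normed_vector \<Rightarrow> ('x \<Rightarrow>\<^sub>L real) \<times> 'x) \<Rightarrow> 'b gfun" where
  "S \<equiv> section_gfun r f"

definition theta_coeff :: "nat \<Rightarrow> ('x \<Rightarrow>\<^sub>L real) \<times> 'x \<Rightarrow> real" where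
  "theta_coeff a v = blinfun_apply (fst v) (f a)"

definition xi_coeff :: "nat \<Rightarrow> ('x \<Rightarrow>\<^sub>L real) \<times> 'x \<Rightarrow> real" where
  "xi_coeff a v = coord r f (snd v) a"

lemma S_eq: "S s = (\<Sum>a<r. fn (\<lambda>p. theta_coeff a (s p)) \<odot> eta (Suc (2 * a)) + fn (\<lambda>p. xi_coeff a (s p)) \<odot> eta (2 * a))"
  by (simp only: section_gfun_def theta_coeff_def xi_coeff_def theta_eta xi_eta)

lemma bounded_linear_coord: "bounded_linear (\<lambda>x. coord r f x a)"
  by (rule linear_bounded_linear_basis[OF f coord_linear[OF f]])

lemma bounded_linear_theta_coeff: "bounded_linear (theta_coeff a)"
  unfolding theta_coeff_def[abs_def]
  by (rule bounded_linear_compose[OF blinfun.bounded_linear_left bounded_linear_fst])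

lemma bounded_linear_xi_coeff: "bounded_linear (xi_coeff a)"
  unfolding xi_coeff_def[abs_def]
  by (rule bounded_linear_compose[OF bounded_linear_coord bounded_linear_snd])

lemmas linear_theta_coeff = bounded_linear.linear[OF bounded_linear_theta_coeff]
lemmas linear_xi_coeff = bounded_linear.linear[OF bounded_linear_xi_coeff]

lemma S_add: "S (\<lambda>p. s p + t p) = S s + S t"
  unfolding S_eq
  by (simp add: linear_add[OF linear_theta_coeff] linear_add[OF linear_xi_coeff] fn_add gmul_add_left sum.distrib
      algebra_simps)

lemma S_scale: "S (\<lambda>p. h p *\<^sub>R s p) = fn h \<odot> S s"
  unfolding S_eq
  by (simp add: linear_scale[OF linear_theta_coeff] linear_scale[OF linear_xi_coeff] gmul_add_right
      gmul_sum_right flip: fn_fn gmul_assoc)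

lemma S_zero: "S (\<lambda>_. 0) = 0"
  using S_add[of "\<lambda>_. 0" "\<lambda>_. 0"] by simp

lemma S_minus: "S (\<lambda>p. - s p) = - S s"
  using S_add[of s "\<lambda>p. - s p"] by (simp add: S_zero eq_neg_iff_add_eq_0 add.commute)

lemma S_diff: "S (\<lambda>p. s p - t p) = S s - S t"
  using S_add[of s "\<lambda>p. - t p"] by (simp add: S_minus)

lemma S_sum: "S (\<lambda>p. \<Sum>i\<in>I. s i p) = (\<Sum>i\<in>I. S (s i))"
  by (induction I rule: infinite_finite_induct) (simp_all add: S_add S_zero)

lemma S_coefficients:
  assumes "a < r"
  shows "dleft (Suc (2 * a)) (S s) = fn (\<lambda>p. theta_coeff a (s p))"
    and "dleft (2 * a) (S s) = fn (\<lambda>p. xi_coeff a (s p))"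
proof -
  have ne: "Suc (2 * a) \<noteq> 2 * b" "2 * a \<noteq> Suc (2 * b)" for b by presburger+
  have eq: "(Suc (2 * a) = Suc (2 * b)) = (a = b)" "(2 * a = 2 * b) = (a = b)" for b by auto
  have if_zero: "F \<odot> (if c then G else 0) = (if c then F \<odot> G else 0)" for c and F G :: "'b gfun"
    by simp
  show "dleft (Suc (2 * a)) (S s) = fn (\<lambda>p. theta_coeff a (s p))"
    unfolding S_eq dleft_sum dleft_add dleft_fn_gmul dleft_eta eq if_zero fn_gmul_fn_one
    by (simp only: ne if_False gmul_zero_right add_0_right sum_if_eq_left[OF assms])
  show "dleft (2 * a) (S s) = fn (\<lambda>p. xi_coeff a (s p))"
    unfolding S_eq dleft_sum dleft_add dleft_fn_gmul dleft_eta eq if_zero fn_gmul_fn_one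
    by (simp only: ne if_False gmul_zero_right add_0_left sum_if_eq_left[OF assms])
qed

lemma fn_eq_iff: "fn g = fn h \<longleftrightarrow> g = h"
proof
  assume "fn g = fn h"
  then have "fn g {} {#} = fn h {} {#}" by simp
  then show "g = h" by (simp add: fn_def monomial_def)
qed simp

lemma section_eqI:
  assumes "\<And>a. a < r \<Longrightarrow> theta_coeff a v = theta_coeff a w" "\<And>a. a < r \<Longrightarrow> xi_coeff a v = xi_coeff a w"
  shows "v = w"
proof (rule prod_eqI)
  show "fst v = fst w"
    by (rule blinfun_eq_on_basis[OF f]) (use assms(1) in \<open>simp add: theta_coeff_def\<close>)
  show "snd v = snd w"
  proof -
    have "(\<Sum>a<r. coord r f (snd v) a *\<^sub>R f a) = (\<Sum>a<r. coord r f (snd w) a *\<^sub>R f a)"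
      by (intro sum.cong refl) (use assms(2) in \<open>simp add: xi_coeff_def\<close>)
    then show ?thesis unfolding coord_sum[OF f] .
  qed
qed

text \<open>Supplies the uniqueness behind the definite description in
  \<open>derived_bracket\<close>.\<close>

lemma S_inject: "S s = S t \<Longrightarrow> s = t"
proof -
  assume eq: "S s = S t"
  have "fn (\<lambda>p. theta_coeff a (s p)) = fn (\<lambda>p. theta_coeff a (t p))" "fn (\<lambda>p. xi_coeff a (s p)) = fn (\<lambda>p. xi_coeff a (t p))"
    if "a < r" for a
    using S_coefficients[OF that, of s] S_coefficients[OF that, of t] by (simp_all add: eq)
  then show "s = t"
    unfolding fn_eq_iff by (intro ext section_eqI) (auto dest: fun_cong)
qed

lemma parity_S: "parity False (S s)"
proof -
  have "parity False (fn h \<odot> eta j)" for h :: "'b \<Rightarrow> real" and j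
    using parity_gmul[OF parity_fn parity_eta] by simp
  then show ?thesis unfolding S_eq by (intro parity_sum parity_add)
qed

lemma smooth_theta_coeff: "smooth s \<Longrightarrow> smooth (\<lambda>p. theta_coeff a (s p))"
  by (rule bounded_linear.smooth_compose[OF bounded_linear_theta_coeff])

lemma smooth_xi_coeff: "smooth s \<Longrightarrow> smooth (\<lambda>p. xi_coeff a (s p))"
  by (rule bounded_linear.smooth_compose[OF bounded_linear_xi_coeff])

lemma dx_S:
  assumes s: "smooth s"
  shows "dx \<epsilon> i (S s) = S (dder (\<epsilon> i) s)"
proof -
  have 1: "dx \<epsilon> i (fn h \<odot> eta j) = fn (dder (\<epsilon> i) h) \<odot> eta j" if "smooth h" for h j
    by (simp only: dx_fn_gmul[OF regular_eta that] dx_eta gmul_zero_right add_0_right)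
  have reg: "regular (fn (\<lambda>p. theta_coeff a (s p)) \<odot> eta j)" "regular (fn (\<lambda>p. xi_coeff a (s p)) \<odot> eta j)" for a j
    by (intro regular_gmul regular_fn regular_eta smooth_theta_coeff smooth_xi_coeff s)+
  have "dx \<epsilon> i (S s) = (\<Sum>a<r. fn (dder (\<epsilon> i) (\<lambda>p. theta_coeff a (s p))) \<odot> eta (Suc (2 * a))
      + fn (dder (\<epsilon> i) (\<lambda>p. xi_coeff a (s p))) \<odot> eta (2 * a))"
    unfolding S_eq
    by (subst dx_sum) (auto intro!: regular_add reg sum.cong
        simp: dx_add[OF reg(1) reg(2)] 1 smooth_theta_coeff[OF s] smooth_xi_coeff[OF s])
  then show ?thesis
    unfolding S_eq
    by (simp only: frechet_derivative_bounded_linear[OF bounded_linear_theta_coeff s]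
        frechet_derivative_bounded_linear[OF bounded_linear_xi_coeff s])
qed

lemma dp_S_gmul: "dp i (S s \<odot> G) = S s \<odot> dp i G"
  unfolding S_eq gmul_sum_left gmul_add_left gmul_assoc dp_sum dp_add dp_fn_gmul dp_eta_gmul ..

lemma dp_S: "dp i (S s) = 0"
  unfolding S_eq dp_sum dp_add dp_fn_gmul by (simp only: dp_eta gmul_zero_right add_0_left sum.neutral_const)

lemma dleft_S_gmul:
  assumes G: "odd_finite G"
  shows "dleft j (S s \<odot> G) = dleft j (S s) \<odot> G - S s \<odot> dleft j G"
proof -
  have "dleft j ((fn h \<odot> eta k) \<odot> G) = dleft j (fn h \<odot> eta k) \<odot> G - (fn h \<odot> eta k) \<odot> dleft j G" for h k
  proof -
    have "(if j = k then fn (\<lambda>_. 1) else 0) \<odot> G = (if j = k then G else 0)"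
      by (simp add: fn_one_gmul[OF G])
    then show ?thesis
      by (simp only: gmul_assoc dleft_fn_gmul dleft_eta_gmul[OF G] dleft_eta gmul_diff_right)
  qed
  then show ?thesis
    unfolding S_eq
    by (simp only: gmul_sum_left gmul_add_left dleft_sum dleft_add sum_subtractf sum.distrib
        add_diff_add)
qed

lemma frame_expand: "(v :: ('x \<Rightarrow>\<^sub>L real) \<times> 'x)
    = (\<Sum>a<r. theta_coeff a v *\<^sub>R (dual_basis r f a, 0) + xi_coeff a v *\<^sub>R (0, f a))"
proof (rule prod_eqI)
  show "fst v = fst (\<Sum>a<r. theta_coeff a v *\<^sub>R (dual_basis r f a, 0) + xi_coeff a v *\<^sub>R (0, f a))"
    by (subst dual_basis_expand[OF f, of "fst v"]) (simp add: fst_sum theta_coeff_def)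
  show "snd v = snd (\<Sum>a<r. theta_coeff a v *\<^sub>R (dual_basis r f a, 0) + xi_coeff a v *\<^sub>R (0, f a))"
    by (subst coord_sum[OF f, of "snd v", symmetric]) (simp add: snd_sum xi_coeff_def)
qed

text \<open>Sends an algebraic functional to the dual space through its values on the frame;
  continuity is inherited from the dual basis.\<close>

definition dualf :: "('x \<Rightarrow> real) \<Rightarrow> ('x \<Rightarrow>\<^sub>L real)" where
  "dualf g = (\<Sum>b<r. g (f b) *\<^sub>R dual_basis r f b)"

lemma dualf_apply: "linear g \<Longrightarrow> blinfun_apply (dualf g) x = g x"
  unfolding dualf_def
  by (simp add: blinfun.sum_left blinfun.scaleR_left dual_basis_apply[OF f])
    (simp add: linear_basis_expand[OF f, of g x] mult.commute)

lemma theta_coeff_simps [simp]: "theta_coeff a (0, x) = 0" "theta_coeff a (\<alpha>, x) = blinfun_apply \<alpha> (f a)"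
  and xi_coeff_simps [simp]: "xi_coeff a (\<alpha>, 0) = 0" "xi_coeff a (\<alpha>, x) = coord r f x a"
  by (simp_all add: theta_coeff_def xi_coeff_def linear_0[OF coord_linear[OF f]])

text \<open>\<open>contract t F\<close> is \<open>{S t, F}\<close> up to the terms with derivatives along the base.\<close>

definition contract :: "('b::real_normed_vector \<Rightarrow> ('x \<Rightarrow>\<^sub>L real) \<times> 'x) \<Rightarrow> 'b gfun \<Rightarrow> 'b gfun" where
  "contract t F = (\<Sum>a<r. fn (\<lambda>p. xi_coeff a (t p)) \<odot> dleft (Suc (2 * a)) F
     + fn (\<lambda>p. theta_coeff a (t p)) \<odot> dleft (2 * a) F)"

lemma contract_add: "contract t (F + G) = contract t F + contract t G"
  by (simp add: contract_def dleft_add gmul_add_right sum.distrib algebra_simps)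

lemma contract_sum: "contract t (\<Sum>i\<in>I. F i) = (\<Sum>i\<in>I. contract t (F i))"
  by (rule additive_sum[where h = "contract t"]) (simp_all add: contract_add, simp add: contract_def)

lemma contract_fn_gmul: "contract t (fn h \<odot> F) = fn h \<odot> contract t F"
proof -
  have "fn g \<odot> (fn h \<odot> G) = fn h \<odot> (fn g \<odot> G)" for g :: "'a \<Rightarrow> real" and G
    by (simp add: fn_fn mult.commute flip: gmul_assoc)
  then show ?thesis
    by (simp add: contract_def dleft_fn_gmul gmul_sum_right gmul_add_right)
qed

lemma canonical_pairing_coords:
  "canonical_pairing v w = (\<Sum>a<r. xi_coeff a w * theta_coeff a v + theta_coeff a w * xi_coeff a v)"
proof -
  have "blinfun_apply (fst v) (snd w) = (\<Sum>a<r. xi_coeff a w * theta_coeff a v)"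
    "blinfun_apply (fst w) (snd v) = (\<Sum>a<r. theta_coeff a w * xi_coeff a v)"
    using linear_basis_expand[OF f bounded_linear.linear[OF blinfun.bounded_linear_right], of "fst v" "snd w"]
      linear_basis_expand[OF f bounded_linear.linear[OF blinfun.bounded_linear_right], of "fst w" "snd v"]
    by (simp_all add: xi_coeff_def theta_coeff_def mult.commute)
  then show ?thesis by (simp add: canonical_pairing_def sum.distrib)
qed

text \<open>The pairing of sections is the big bracket of the corresponding functions of degree 1:
  these contain no \<open>p\<close>, so the terms with base derivatives vanish.\<close>

lemma contract_S: "contract t (S s) = fn (\<lambda>p. canonical_pairing (s p) (t p))"
  unfolding canonical_pairing_coords fn_sum contract_def
  by (simp add: S_coefficients fn_fn fn_add)

text \<open>Contraction is an odd derivation; the sign comes from passing the odd function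
  \<open>S s\<close>.\<close>

lemma contract_S_gmul:
  assumes G: "odd_finite G"
  shows "contract t (S s \<odot> G) = contract t (S s) \<odot> G - S s \<odot> contract t G"
proof -
  have c: "fn h \<odot> (S s \<odot> F) = S s \<odot> (fn h \<odot> F)" for h F
    using gmul_fn_commute[OF parity_S[of s], of h] by (simp flip: gmul_assoc)
  show ?thesis
    by (simp add: contract_def dleft_S_gmul[OF G] gmul_diff_right c gmul_assoc gmul_sum_left
        gmul_add_left gmul_sum_right gmul_add_right sum_subtractf sum.distrib)
qed

text \<open>\<open>S s\<close> contains no \<open>p\<close>, so of the base part only its own
  derivatives along the base survive.\<close>

lemma big_bracket_section_left:
  assumes s: "smooth s"
  shows "big_bracket n \<epsilon> r (S s) F = (\<Sum>i<n. S (dder (\<epsilon> i) s) \<odot> dp i F) + contract s F"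
proof -
  have "(\<Sum>a<r. dright (2 * a) (S s) \<odot> dleft (2 * a + 1) F + dright (2 * a + 1) (S s) \<odot> dleft (2 * a) F)
      = contract s F"
    unfolding contract_def dright_parity[OF parity_S] if_False Suc_eq_plus1[symmetric]
    by (intro sum.cong refl) (simp add: S_coefficients)
  then show ?thesis
    unfolding big_bracket_def by (simp add: dx_S[OF s] dp_S)
qed

text \<open>Both terms carry a minus: the first from the antisymmetric base part of the bracket, the
  second because \<open>F\<close> is even and its right derivatives are minus the left ones.\<close>

lemma big_bracket_section_right:
  assumes t: "smooth t" and F: "parity True F"
  shows "big_bracket n \<epsilon> r F (S t) = - (\<Sum>i<n. dp i F \<odot> S (dder (\<epsilon> i) t)) - contract t F"
proof -
  have c: "dleft j F \<odot> fn h = fn h \<odot> dleft j F" for j h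
    by (rule gmul_fn_commute[OF parity_dleft[OF F]])
  have "(\<Sum>a<r. dright (2 * a) F \<odot> dleft (2 * a + 1) (S t) + dright (2 * a + 1) F \<odot> dleft (2 * a) (S t))
      = (\<Sum>a<r. - (fn (\<lambda>p. xi_coeff a (t p)) \<odot> dleft (Suc (2 * a)) F
          + fn (\<lambda>p. theta_coeff a (t p)) \<odot> dleft (2 * a) F))"
    unfolding dright_parity[OF F] if_True Suc_eq_plus1[symmetric]
    by (intro sum.cong refl) (simp add: S_coefficients c gmul_minus_left)
  also have "\<dots> = - contract t F"
    unfolding contract_def sum_negf ..
  finally show ?thesis
    unfolding big_bracket_def
    by (simp add: dx_S[OF t] dp_S sum_negf)
qed

lemma big_bracket_fn_right:
  "big_bracket n \<epsilon> r F (fn h) = - (\<Sum>i<n. dp i F \<odot> fn (dder (\<epsilon> i) h))"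
  unfolding big_bracket_def by (simp add: dx_fn sum_negf)

end

subsection \<open>The derived bracket in coordinates\<close>

context based_space
begin

lemma linear_frame_expand:
  assumes "linear g"
  shows "(\<Sum>a<r. xi_coeff a v *\<^sub>R g (0, f a) + theta_coeff a v *\<^sub>R g (dual_basis r f a, 0)) = g v"
proof -
  have "g v = g (\<Sum>a<r. theta_coeff a v *\<^sub>R (dual_basis r f a, 0) + xi_coeff a v *\<^sub>R (0, f a))"
    by (rule arg_cong[OF frame_expand])
  then show ?thesis
    by (simp only: linear_sum[OF assms] linear_add[OF assms] linear_scale[OF assms] add.commute)
qed

lemma S_dualf:
  assumes "\<And>p. linear (g p)"
  shows "S (\<lambda>p. (dualf (g p), y)) = tsum r (\<lambda>b. fn (\<lambda>p. g p (f b))) + fun_0 r f y"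
  unfolding S_eq fun_0_def tsum_def xi_eta theta_eta eta_fn sum.distrib
  by (simp add: dualf_apply[OF assms])

lemma contract_minus: "contract t (- F) = - contract t F"
  by (simp add: contract_def dleft_minus gmul_minus_right flip: sum_negf)

lemma parity_contract: "parity b F \<Longrightarrow> parity (\<not> b) (contract t F)"
proof -
  assume F: "parity b F"
  have "parity (\<not> b) (fn h \<odot> dleft j F)" for h j
    using parity_gmul[OF parity_fn parity_dleft[OF F]] by simp
  then show ?thesis unfolding contract_def by (intro parity_sum parity_add)
qed

end

sublocale based_Linf \<subseteq> based_space r f
  by unfold_locales (rule f)

context based_Linf
begin

text \<open>
  \<open>anchor_form p v\<close> is the tangent vector \<open>\<rho>(v)\<close> at \<open>p\<close>, an element of the dual of \<open>'m\<close>;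
  \<open>anchor_dual p\<close> is the adjoint of \<open>\<rho>\<close> with respect to the pairing, and \<open>const_bracket\<close> is the bracket
  of constant sections.
\<close>

definition anchor_form :: "('m \<Rightarrow>\<^sub>L real) \<Rightarrow> ('x \<Rightarrow>\<^sub>L real) \<times> 'x \<Rightarrow> 'm \<Rightarrow> real" where
  "anchor_form p v m = blinfun_apply p (l21 (snd v) m) + blinfun_apply (fst v) (l1 m)"

definition anchor_dual :: "('m \<Rightarrow>\<^sub>L real) \<Rightarrow> 'm \<Rightarrow> ('x \<Rightarrow>\<^sub>L real) \<times> 'x" where
  "anchor_dual p m = (dualf (\<lambda>x. blinfun_apply p (l21 x m)), l1 m)"

definition const_bracket ::
  "('m \<Rightarrow>\<^sub>L real) \<Rightarrow> ('x \<Rightarrow>\<^sub>L real) \<times> 'x \<Rightarrow> ('x \<Rightarrow>\<^sub>L real) \<times> 'x \<Rightarrow> ('x \<Rightarrow>\<^sub>L real) \<times> 'x" where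
  "const_bracket p v w = (dualf (\<lambda>x. blinfun_apply p (l3 (snd v) (snd w) x)
      - blinfun_apply (fst w) (l20 (snd v) x) + blinfun_apply (fst v) (l20 (snd w) x)),
    l20 (snd v) (snd w))"

lemma linear_blinfun: "linear (blinfun_apply q)"
  by (rule bounded_linear.linear[OF blinfun.bounded_linear_right])

lemmas linear_blinfun_o = linear_compose[OF _ linear_blinfun, unfolded o_def]

lemma linear_const_bracket_dual: "linear (\<lambda>x. blinfun_apply p (l3 y z x)
      - blinfun_apply \<beta> (l20 y x) + blinfun_apply \<alpha> (l20 z x))"
  by (intro linear_compose_add linear_compose_sub linear_blinfun_o l3_linear l20_linear)

lemma linear_anchor_dual_dual: "linear (\<lambda>x. blinfun_apply p (l21 x m))"
  by (intro linear_blinfun_o l21_linear)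

lemma fst_const_bracket: "blinfun_apply (fst (const_bracket p v w)) x = blinfun_apply p (l3 (snd v) (snd w) x)
      - blinfun_apply (fst w) (l20 (snd v) x) + blinfun_apply (fst v) (l20 (snd w) x)"
  by (simp add: const_bracket_def dualf_apply[OF linear_const_bracket_dual])

lemma snd_const_bracket: "snd (const_bracket p v w) = l20 (snd v) (snd w)"
  by (simp add: const_bracket_def)

lemma fst_anchor_dual: "blinfun_apply (fst (anchor_dual p m)) x = blinfun_apply p (l21 x m)"
  by (simp add: anchor_dual_def dualf_apply[OF linear_anchor_dual_dual])

lemma snd_anchor_dual: "snd (anchor_dual p m) = l1 m"
  by (simp add: anchor_dual_def)

lemmas blinfun_simps = blinfun.add_left blinfun.add_right blinfun.scaleR_left blinfun.scaleR_right
  blinfun.diff_left blinfun.diff_right blinfun.minus_left blinfun.minus_right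

lemma linear_const_bracket: "linear (const_bracket p v)" "linear (\<lambda>v. const_bracket p v w)"
  by (rule linearI; rule prod_eqI; (rule blinfun_eqI)?;
      simp add: fst_const_bracket snd_const_bracket blinfun_simps multilinear_add multilinear_scale algebra_simps)+

lemma linear_anchor_form: "linear (anchor_form p v)" "linear (\<lambda>v. anchor_form p v m)"
  by (rule linearI; simp add: anchor_form_def blinfun_simps multilinear_add multilinear_scale algebra_simps)+

lemma anchor_form_expand: "anchor_form p v m
    = (\<Sum>a<r. xi_coeff a v * blinfun_apply p (l21 (f a) m) + theta_coeff a v * coord r f (l1 m) a)"
proof -
  have "blinfun_apply p (l21 (snd v) m) = (\<Sum>a<r. xi_coeff a v * blinfun_apply p (l21 (f a) m))"
    using linear_basis_expand[OF f linear_anchor_dual_dual[of p m], of "snd v"] by (simp add: xi_coeff_def)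
  moreover have "blinfun_apply (fst v) (l1 m) = (\<Sum>a<r. theta_coeff a v * coord r f (l1 m) a)"
    using linear_basis_expand[OF f linear_blinfun, of "fst v" "l1 m"] by (simp add: theta_coeff_def mult.commute)
  ultimately show ?thesis by (simp add: anchor_form_def sum.distrib)
qed

lemma fn_anchor_form: "fn (\<lambda>p. anchor_form p (t p) m)
    = (\<Sum>a<r. fn (\<lambda>p. xi_coeff a (t p)) \<odot> M (l21 (f a) m) + fn (\<lambda>p. theta_coeff a (t p)) \<odot> fn (\<lambda>_. coord r f (l1 m) a))"
  by (simp add: anchor_form_expand fn_sum fn_add fn_fn fun_m1_def)

lemma contract_sigma: "contract t (sigma m) = fn (\<lambda>p. anchor_form p (t p) m)"
proof -
  have "dleft (Suc (2 * a)) (sigma m) = M (l21 (f a) m)"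
    "dleft (2 * a) (sigma m) = fn (\<lambda>_. coord r f (l1 m) a)" if "a < r" for a
    using that
    by (simp_all add: sigma_def dleft_add dleft_theta_fun_0 dleft_xi_fun_0 dleft_theta_tsum
        dleft_xi_tsum)
  then show ?thesis unfolding fn_anchor_form contract_def by (intro sum.cong) auto
qed

text \<open>The function \<open>{m, l}\<close> has degree 1 and hence is a section: the differential
  of the linear function \<open>m\<close>, transported by the adjoint of the anchor.\<close>

lemma sigma_S: "sigma m = S (\<lambda>p. anchor_dual p m)"
  unfolding anchor_dual_def sigma_def S_dualf[OF linear_anchor_dual_dual] fun_m1_def by (rule add.commute)

text \<open>Deriving \<open>l\<close> by \<open>theta\<close> in the directions \<open>x\<close> and
  \<open>f c\<close> gives their bracket as constant sections; skewness of \<open>l3\<close> doubles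
  the coefficient 1/2 to 1.\<close>

lemma dleft_theta_Psi:
  assumes c: "c < r"
  shows "dleft (Suc (2 * c)) (Psi x) = S (\<lambda>p. const_bracket p (0, x) (0, f c))"
proof -
  have eq: "M ((1/2) *\<^sub>R l3 x (f c) (f b)) - M ((1/2) *\<^sub>R l3 x (f b) (f c)) = M (l3 x (f c) (f b))" for b
  proof -
    have "l3 x (f b) (f c) = - l3 x (f c) (f b)" by (rule l3_skew(2))
    then show ?thesis
      unfolding glinear_diff[OF glinear_fun_m1, symmetric] by (simp flip: scaleR_add_left)
  qed
  have "dleft (Suc (2 * c)) (Psi x) = X (l20 x (f c))
      + tsum r (\<lambda>b. M ((1/2) *\<^sub>R l3 x (f c) (f b)) - M ((1/2) *\<^sub>R l3 x (f b) (f c)))"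
    by (simp add: Psi_def dleft_add dleft_theta_fun_0 dleft_theta_tsum dleft_psum c tsum_diff)
  also have "\<dots> = S (\<lambda>p. const_bracket p (0, x) (0, f c))"
    unfolding eq const_bracket_def S_dualf[OF linear_const_bracket_dual] by (simp add: fun_m1_def add.commute)
  finally show ?thesis .
qed

lemma dleft_xi_Psi:
  assumes c: "c < r"
  shows "dleft (2 * c) (Psi x) = S (\<lambda>p. const_bracket p (0, x) (dual_basis r f c, 0))"
proof -
  have "dleft (2 * c) (Psi x) = tsum r (\<lambda>b. - fn (\<lambda>_. coord r f (l20 x (f b)) c))"
    by (simp add: Psi_def dleft_add dleft_xi_fun_0 dleft_xi_tsum dleft_psum c tsum_minus)
  also have "\<dots> = S (\<lambda>p. const_bracket p (0, x) (dual_basis r f c, 0))"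
    unfolding const_bracket_def S_dualf[OF linear_const_bracket_dual]
    by (simp add: dual_basis_apply[OF f] linear_0[OF l20_linear(1)] linear_0[OF l20_linear(2)]
        linear_0[OF l3_linear(2)] glinear_zero[OF glinear_fun_0[OF f]] fn_minus)
  finally show ?thesis .
qed

text \<open>The derivative of \<open>l\<close> by the a-th \<open>xi\<close>, just as
  \<open>Psi (f a)\<close> is the one by the a-th \<open>theta\<close>.\<close>

abbreviation Lambda :: "nat \<Rightarrow> ('m \<Rightarrow>\<^sub>L real) gfun" where
  "Lambda a \<equiv> l_dxi (\<lambda>x. fn (\<lambda>_. coord r f x a))"

lemma dleft_theta_Lambda:
  assumes c: "c < r"
  shows "dleft (Suc (2 * c)) (Lambda a) = S (\<lambda>p. const_bracket p (dual_basis r f a, 0) (0, f c))"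
proof -
  have gl: "glinear (\<lambda>x. fn (\<lambda>_. coord r f x a) :: ('m \<Rightarrow>\<^sub>L real) gfun)"
    by (intro glinear_fn coord_linear[OF f])
  have eq: "fn (\<lambda>_. coord r f ((1/2) *\<^sub>R l20 (f c) (f b)) a) - fn (\<lambda>_. coord r f ((1/2) *\<^sub>R l20 (f b) (f c)) a)
      = (fn (\<lambda>_. coord r f (l20 (f c) (f b)) a) :: ('m \<Rightarrow>\<^sub>L real) gfun)" for b
  proof -
    have "l20 (f b) (f c) = - l20 (f c) (f b)" by (rule l20_skew)
    then show ?thesis
      unfolding glinear_diff[OF gl, symmetric] by (simp flip: scaleR_add_left)
  qed
  have "dleft (Suc (2 * c)) (Lambda a) = tsum r (\<lambda>b. fn (\<lambda>_. coord r f ((1/2) *\<^sub>R l20 (f c) (f b)) a)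
      - fn (\<lambda>_. coord r f ((1/2) *\<^sub>R l20 (f b) (f c)) a))"
    by (simp add: l_dxi_def dleft_add dleft_theta_tsum dleft_psum c tsum_diff)
  also have "\<dots> = S (\<lambda>p. const_bracket p (dual_basis r f a, 0) (0, f c))"
    unfolding eq const_bracket_def S_dualf[OF linear_const_bracket_dual]
    by (simp add: dual_basis_apply[OF f] linear_0[OF l20_linear(1)] linear_0[OF l20_linear(2)]
        linear_0[OF l3_linear(3)] glinear_zero[OF glinear_fun_0[OF f]])
  finally show ?thesis .
qed

text \<open>No monomial of \<open>l\<close> contains two \<open>xi\<close>; correspondingly the
  bracket of two constant covectors is 0.\<close>

lemma dleft_xi_Lambda:
  "dleft (2 * c) (Lambda a) = S (\<lambda>p. const_bracket p (dual_basis r f a, 0) (dual_basis r f c, 0))"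
proof -
  have "dleft (2 * c) (Lambda a) = 0"
    by (simp add: l_dxi_def dleft_add dleft_xi_tsum dleft_psum)
  also have "\<dots> = S (\<lambda>p. const_bracket p (dual_basis r f a, 0) (dual_basis r f c, 0))"
    unfolding const_bracket_def S_dualf[OF linear_const_bracket_dual]
    by (simp add: linear_0[OF l20_linear(1)] linear_0[OF l20_linear(2)]
        linear_0[OF l3_linear(3)] glinear_zero[OF glinear_fun_0[OF f]] fn_zero)
  finally show ?thesis .
qed

text \<open>Pointwise linearity of \<open>g p\<close> reduces the contraction to the frame, where it
  is a derivative by a single generator.\<close>

lemma contract_frame:
  assumes "\<And>c. c < r \<Longrightarrow> dleft (Suc (2 * c)) F = S (\<lambda>p. g p (0, f c))"
    and "\<And>c. c < r \<Longrightarrow> dleft (2 * c) F = S (\<lambda>p. g p (dual_basis r f c, 0))"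
    and "\<And>p. linear (g p)"
  shows "contract t F = S (\<lambda>p. g p (t p))"
proof -
  have "contract t F = (\<Sum>a<r. S (\<lambda>p. xi_coeff a (t p) *\<^sub>R g p (0, f a))
      + S (\<lambda>p. theta_coeff a (t p) *\<^sub>R g p (dual_basis r f a, 0)))"
    unfolding contract_def S_scale by (intro sum.cong refl) (simp add: assms(1,2))
  also have "\<dots> = S (\<lambda>p. \<Sum>a<r. xi_coeff a (t p) *\<^sub>R g p (0, f a) + theta_coeff a (t p) *\<^sub>R g p (dual_basis r f a, 0))"
    unfolding S_add[symmetric] S_sum ..
  finally show ?thesis unfolding linear_frame_expand[OF assms(3)] .
qed

lemma contract_L: "contract s L = (\<Sum>a<r. fn (\<lambda>p. xi_coeff a (s p)) \<odot> Psi (f a) + fn (\<lambda>p. theta_coeff a (s p)) \<odot> Lambda a)"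
  unfolding contract_def by (intro sum.cong refl) (simp add: dleft_theta_L dleft_xi_L)

lemma contract_contract_L: "contract t (contract s L) = S (\<lambda>p. const_bracket p (s p) (t p))"
proof -
  have 1: "contract t (Psi x) = S (\<lambda>p. const_bracket p (0, x) (t p))" for x
    by (rule contract_frame[OF dleft_theta_Psi dleft_xi_Psi linear_const_bracket(1)])
  have 2: "contract t (Lambda a) = S (\<lambda>p. const_bracket p (dual_basis r f a, 0) (t p))" for a
    by (rule contract_frame[OF dleft_theta_Lambda dleft_xi_Lambda linear_const_bracket(1)])
  show ?thesis
    unfolding contract_L contract_sum contract_add contract_fn_gmul 1 2
    unfolding S_scale[symmetric] S_add[symmetric] S_sum[symmetric]
      linear_frame_expand[OF linear_const_bracket(2)] ..
qed

section \<open>Explicit formulas for the anchor and the Dorfman bracket\<close>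

definition bracket_gfun :: "(('m \<Rightarrow>\<^sub>L real) \<Rightarrow> ('x \<Rightarrow>\<^sub>L real) \<times> 'x) \<Rightarrow> ('m \<Rightarrow>\<^sub>L real) gfun" where
  "bracket_gfun s = (\<Sum>i<n. S (dder (\<epsilon> i) s) \<odot> sigma (e i)) + contract s L"

text \<open>The minus sign of \<open>- l\<close> seen here cancels against those of
  \<open>big_bracket_section_right\<close>, so the final formulas carry no global sign.\<close>

lemma big_bracket_S_L: "smooth s \<Longrightarrow> big_bracket n \<epsilon> r (S s) (- L) = - bracket_gfun s"
  unfolding bracket_gfun_def
  by (simp add: big_bracket_section_left dp_minus dp_L gmul_minus_right contract_minus sum_negf)

lemma parity_bracket_gfun: "parity True (bracket_gfun s)"
proof -
  have "parity True (S (dder (\<epsilon> i) s) \<odot> sigma (e i))" for i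
    unfolding sigma_S using parity_gmul[OF parity_S parity_S] by simp
  then show ?thesis
    unfolding bracket_gfun_def using parity_contract[OF parity_L] by (intro parity_add parity_sum) auto
qed

lemma dp_bracket_gfun:
  assumes i: "i < n"
  shows "dp i (bracket_gfun s) = fn (\<lambda>p. anchor_form p (s p) (e i))"
proof -
  have "dp i (Psi x) = M (l21 x (e i))" "dp i (Lambda a) = fn (\<lambda>_. coord r f (l1 (e i)) a)" for x a
    using i by (simp_all add: Psi_def l_dxi_def dp_add dp_tsum dp_psum)
  then show ?thesis
    unfolding bracket_gfun_def contract_L dp_add dp_sum dp_S_gmul dp_fn_gmul fn_anchor_form
    by (simp add: sigma_S dp_S)
qed

text \<open>The derivation rule splits each product of a derivative of \<open>s\<close> with
  \<open>sigma (e i)\<close> into a pairing term and, with a minus sign, a derivative of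
  \<open>s\<close> along the anchor of \<open>t\<close>.\<close>

lemma contract_bracket_gfun: "contract t (bracket_gfun s) = S (\<lambda>p.
    (\<Sum>i<n. canonical_pairing (dder (\<epsilon> i) s p) (t p) *\<^sub>R anchor_dual p (e i)
      - anchor_form p (t p) (e i) *\<^sub>R dder (\<epsilon> i) s p) + const_bracket p (s p) (t p))"
proof -
  have c: "S u \<odot> fn h = fn h \<odot> S u" for u h
    by (rule gmul_fn_commute[OF parity_S])
  have "contract t (S u \<odot> sigma m) = S (\<lambda>p. canonical_pairing (u p) (t p) *\<^sub>R anchor_dual p m
      - anchor_form p (t p) m *\<^sub>R u p)" for u m
  proof -
    have o: "odd_finite (sigma m)" by (simp add: sigma_def)
    show ?thesis
      unfolding S_diff S_scale sigma_S[symmetric] contract_S_gmul[OF o] contract_sigma contract_S c ..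
  qed
  then show ?thesis
    unfolding bracket_gfun_def contract_add contract_sum contract_contract_L S_add S_sum by simp
qed

text \<open>The usual local form of a Dorfman bracket on a trivial bundle with its flat connection:
  \<open>t\<close> derived along the anchor of \<open>s\<close>, minus \<open>s\<close> derived
  along the anchor of \<open>t\<close>, plus the adjoint of the anchor applied to the pairing of the
  derivative of \<open>s\<close> with \<open>t\<close>, plus a pointwise term.\<close>

definition dorfman :: "(('m \<Rightarrow>\<^sub>L real) \<Rightarrow> ('x \<Rightarrow>\<^sub>L real) \<times> 'x) \<Rightarrow> (('m \<Rightarrow>\<^sub>L real) \<Rightarrow> ('x \<Rightarrow>\<^sub>L real) \<times> 'x)
    \<Rightarrow> ('m \<Rightarrow>\<^sub>L real) \<Rightarrow> ('x \<Rightarrow>\<^sub>L real) \<times> 'x" where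
  "dorfman s t p = (\<Sum>i<n. anchor_form p (s p) (e i) *\<^sub>R dder (\<epsilon> i) t p)
    + ((\<Sum>i<n. canonical_pairing (dder (\<epsilon> i) s p) (t p) *\<^sub>R anchor_dual p (e i)
        - anchor_form p (t p) (e i) *\<^sub>R dder (\<epsilon> i) s p) + const_bracket p (s p) (t p))"

definition anchor :: "(('m \<Rightarrow>\<^sub>L real) \<Rightarrow> ('x \<Rightarrow>\<^sub>L real) \<times> 'x) \<Rightarrow> (('m \<Rightarrow>\<^sub>L real) \<Rightarrow> real)
    \<Rightarrow> ('m \<Rightarrow>\<^sub>L real) \<Rightarrow> real" where
  "anchor s h p = (\<Sum>i<n. anchor_form p (s p) (e i) * dder (\<epsilon> i) h p)"

lemma derived_bracket_eq:
  assumes s: "smooth s" and t: "smooth t"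
  shows "derived_bracket n \<epsilon> r f (- L) s t = dorfman s t"
proof -
  have "big_bracket n \<epsilon> r (big_bracket n \<epsilon> r (S s) (- L)) (S t)
      = (\<Sum>i<n. dp i (bracket_gfun s) \<odot> S (dder (\<epsilon> i) t)) + contract t (bracket_gfun s)"
    unfolding big_bracket_S_L[OF s]
    using big_bracket_section_right[OF t parity_minus[OF parity_bracket_gfun]]
    by (simp add: dp_minus contract_minus gmul_minus_left sum_negf)
  also have "\<dots> = S (dorfman s t)"
    unfolding contract_bracket_gfun dorfman_def[abs_def]
    by (subst (2) S_add) (simp add: dp_bracket_gfun S_sum S_scale)
  finally have "big_bracket n \<epsilon> r (big_bracket n \<epsilon> r (S s) (- L)) (S t) = S (dorfman s t)" .
  then show ?thesis
    unfolding derived_bracket_def by (intro the_equality) (auto dest: S_inject)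
qed

lemma derived_anchor_eq:
  assumes s: "smooth s"
  shows "derived_anchor n \<epsilon> r f (- L) s h = anchor s h"
proof -
  have "big_bracket n \<epsilon> r (big_bracket n \<epsilon> r (S s) (- L)) (fn h)
      = (\<Sum>i<n. dp i (bracket_gfun s) \<odot> fn (dder (\<epsilon> i) h))"
    unfolding big_bracket_S_L[OF s] big_bracket_fn_right
    by (simp add: dp_minus gmul_minus_left sum_negf)
  also have "\<dots> = fn (anchor s h)"
    unfolding anchor_def[abs_def] fn_sum by (simp add: dp_bracket_gfun fn_fn)
  finally have "big_bracket n \<epsilon> r (big_bracket n \<epsilon> r (S s) (- L)) (fn h) = fn (anchor s h)" .
  then show ?thesis
    unfolding derived_anchor_def by (intro the_equality) (auto simp: fn_eq_iff)
qed

end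

subsection \<open>Derivatives of sections\<close>

lemma dder_add:
  "smooth g \<Longrightarrow> smooth h \<Longrightarrow> dder v (\<lambda>p. g p + h p) p = dder v g p + dder v h p"
  by (subst frechet_derivativeI[OF has_derivative_add[OF has_derivative_frechet has_derivative_frechet]])
    (auto intro: smooth_differentiable)

lemma dder_sum:
  "(\<And>i. i \<in> I \<Longrightarrow> smooth (g i)) \<Longrightarrow> dder v (\<lambda>p. \<Sum>i\<in>I. g i p) p = (\<Sum>i\<in>I. dder v (g i) p)"
  by (induction I rule: infinite_finite_induct) (simp_all add: dder_add smooth_sum)

lemma dder_scaleR:
  "smooth g \<Longrightarrow> smooth h \<Longrightarrow> dder v (\<lambda>p. g p *\<^sub>R h p) p = g p *\<^sub>R dder v h p + dder v g p *\<^sub>R h p"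
  by (subst frechet_derivativeI[OF has_derivative_scaleR[OF has_derivative_frechet has_derivative_frechet]])
    (auto intro: smooth_differentiable)

lemma dder_cscaleR: "smooth h \<Longrightarrow> dder v (\<lambda>p. c *\<^sub>R h p) p = c *\<^sub>R dder v h p"
  using dder_scaleR[OF smooth_const[of c], where h = h and p = p and v = v] by simp

lemma dder_mult:
  fixes g h :: "'b::real_normed_vector \<Rightarrow> real"
  shows "smooth g \<Longrightarrow> smooth h \<Longrightarrow> dder v (\<lambda>p. g p * h p) p = g p * dder v h p + dder v g p * h p"
  using dder_scaleR[where g = g and h = h and p = p and v = v] by simp

lemma dder_blinfun:
  assumes "smooth g" "smooth h"
  shows "dder v (\<lambda>p. blinfun_apply (g p) (h p)) p
    = blinfun_apply (g p) (dder v h p) + blinfun_apply (dder v g p) (h p)"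
  by (subst frechet_derivativeI[OF bounded_bilinear.FDERIV[OF bounded_bilinear_blinfun_apply
        has_derivative_frechet has_derivative_frechet]])
    (auto intro: smooth_differentiable assms)

lemma dder_fst: "smooth s \<Longrightarrow> dder v (\<lambda>p. fst (s p)) p = fst (dder v s p)"
  and dder_snd: "smooth s \<Longrightarrow> dder v (\<lambda>p. snd (s p)) p = snd (dder v s p)"
  by (simp_all add: frechet_derivative_bounded_linear[OF bounded_linear_fst]
      frechet_derivative_bounded_linear[OF bounded_linear_snd])

lemma canonical_pairing_commute: "canonical_pairing v w = canonical_pairing w v"
  by (simp add: canonical_pairing_def)

lemma linear_canonical_pairing:
  "linear (canonical_pairing v)" "linear (\<lambda>v. canonical_pairing v w)"
  by (rule linearI; simp add: canonical_pairing_def blinfun.add_left blinfun.add_right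
      blinfun.scaleR_left blinfun.scaleR_right algebra_simps)+

lemmas pairing_simps = linear_add[OF linear_canonical_pairing(1)] linear_add[OF linear_canonical_pairing(2)]
  linear_diff[OF linear_canonical_pairing(1)] linear_diff[OF linear_canonical_pairing(2)]
  linear_scale[OF linear_canonical_pairing(1)] linear_scale[OF linear_canonical_pairing(2)]
  linear_sum[OF linear_canonical_pairing(1)] linear_sum[OF linear_canonical_pairing(2)]

lemma dder_canonical_pairing:
  assumes s: "smooth s" and t: "smooth t"
  shows "dder v (\<lambda>p. canonical_pairing (s p) (t p)) p
    = canonical_pairing (dder v s p) (t p) + canonical_pairing (s p) (dder v t p)"
  unfolding canonical_pairing_def
  by (subst dder_add)
    (simp_all add: dder_blinfun dder_fst dder_snd smooth_fst smooth_snd s t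
      bounded_bilinear.smooth_prod[OF bounded_bilinear_blinfun_apply])

lemma smooth_canonical_pairing:
  "smooth s \<Longrightarrow> smooth t \<Longrightarrow> smooth (\<lambda>p. canonical_pairing (s p) (t p))"
  unfolding canonical_pairing_def
  by (intro smooth_add bounded_bilinear.smooth_prod[OF bounded_bilinear_blinfun_apply]
      smooth_fst smooth_snd)

subsection \<open>The Courant algebroid axioms\<close>

context based_Linf
begin

lemma pairing_nondegenerate:
  fixes v v' :: "('x \<Rightarrow>\<^sub>L real) \<times> 'x"
  assumes "\<And>w. canonical_pairing v w = canonical_pairing v' w"
  shows "v = v'"
proof (rule section_eqI)
  fix a assume a: "a < r"
  show "theta_coeff a v = theta_coeff a v'"
    using assms[of "(0, f a)"] by (simp add: canonical_pairing_def theta_coeff_def)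
  show "xi_coeff a v = xi_coeff a v'"
    using assms[of "(dual_basis r f a, 0)"]
    by (simp add: canonical_pairing_def xi_coeff_def dual_basis_apply[OF f])
qed

lemma fibre_metric_canonical: "fibre_metric (\<lambda>_ :: 'm \<Rightarrow>\<^sub>L real. canonical_pairing :: ('x \<Rightarrow>\<^sub>L real) \<times> 'x \<Rightarrow> _)"
  unfolding fibre_metric_def
proof (intro conjI allI impI)
  show "bilinear (canonical_pairing :: ('x \<Rightarrow>\<^sub>L real) \<times> 'x \<Rightarrow> _)"
    unfolding bilinear_def by (intro conjI allI linear_canonical_pairing)
  show "canonical_pairing v w = canonical_pairing w v" for v w :: "('x \<Rightarrow>\<^sub>L real) \<times> 'x"
    by (rule canonical_pairing_commute)
  show "v = 0" if "\<forall>w. canonical_pairing v w = 0" for v :: "('x \<Rightarrow>\<^sub>L real) \<times> 'x"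
    by (rule pairing_nondegenerate) (use that in \<open>simp add: canonical_pairing_def\<close>)
  show "smooth (\<lambda>_ :: 'm \<Rightarrow>\<^sub>L real. canonical_pairing v w)" for v w :: "('x \<Rightarrow>\<^sub>L real) \<times> 'x"
    by simp
qed

lemma smooth_frame:
  fixes s :: "'b::real_normed_vector \<Rightarrow> ('x \<Rightarrow>\<^sub>L real) \<times> 'x"
  assumes "\<And>a. smooth (\<lambda>p. theta_coeff a (s p))" "\<And>a. smooth (\<lambda>p. xi_coeff a (s p))"
  shows "smooth s"
proof -
  have "s = (\<lambda>p. \<Sum>a<r. theta_coeff a (s p) *\<^sub>R (dual_basis r f a, 0) + xi_coeff a (s p) *\<^sub>R (0, f a))"
    by (rule ext) (rule frame_expand)
  moreover have "smooth \<dots>"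
    by (intro smooth_sum smooth_add smooth_scaleR smooth_const assms)
  ultimately show ?thesis by simp
qed

lemma smooth_anchor_form: "smooth s \<Longrightarrow> smooth (\<lambda>p. anchor_form p (s p) m)"
  unfolding anchor_form_expand
  by (intro smooth_sum smooth_add smooth_mult smooth_const smooth_theta_coeff smooth_xi_coeff smooth_blinfun_apply)

lemma smooth_anchor_dual: "smooth (\<lambda>p. anchor_dual p m)"
  by (rule smooth_frame) (simp_all add: theta_coeff_def xi_coeff_def fst_anchor_dual snd_anchor_dual smooth_blinfun_apply)

text \<open>For constant arguments the coefficients are affine in \<open>p\<close>; frame expansion
  of \<open>t\<close>, then of \<open>s\<close>, gives the general case.\<close>

lemma smooth_const_bracket:
  assumes s: "smooth s" and t: "smooth t"
  shows "smooth (\<lambda>p. const_bracket p (s p) (t p))"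
proof -
  have 0: "smooth (\<lambda>p. const_bracket p v w)" for v w
    by (rule smooth_frame) (auto simp: theta_coeff_def xi_coeff_def fst_const_bracket snd_const_bracket
        intro!: smooth_add smooth_diff smooth_blinfun_apply)
  have "smooth (\<lambda>p. const_bracket p v (t p))" for v
    unfolding linear_frame_expand[OF linear_const_bracket(1), symmetric, where v = "t _"]
    by (intro smooth_sum smooth_add smooth_scaleR smooth_theta_coeff smooth_xi_coeff t 0)
  then show ?thesis
    unfolding linear_frame_expand[OF linear_const_bracket(2), symmetric, where v = "s _"]
    by (intro smooth_sum smooth_add smooth_scaleR smooth_theta_coeff smooth_xi_coeff s)
qed

lemma smooth_dorfman: "smooth s \<Longrightarrow> smooth t \<Longrightarrow> smooth (dorfman s t)"
  unfolding dorfman_def[abs_def]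
  by (intro smooth_add smooth_sum smooth_diff smooth_scaleR smooth_anchor_form smooth_const_bracket smooth_anchor_dual
      smooth_frechet_derivative smooth_canonical_pairing)

lemma smooth_anchor: "smooth s \<Longrightarrow> smooth h \<Longrightarrow> smooth (anchor s h)"
  unfolding anchor_def[abs_def]
  by (intro smooth_sum smooth_mult smooth_anchor_form smooth_frechet_derivative)

lemmas anchor_form_simps = linear_add[OF linear_anchor_form(1)] linear_add[OF linear_anchor_form(2)]
  linear_scale[OF linear_anchor_form(1)] linear_scale[OF linear_anchor_form(2)]
  linear_diff[OF linear_anchor_form(2)] linear_sum[OF linear_anchor_form(2)]

lemmas const_bracket_simps = linear_add[OF linear_const_bracket(1)] linear_add[OF linear_const_bracket(2)]
  linear_scale[OF linear_const_bracket(1)] linear_scale[OF linear_const_bracket(2)]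

lemma bundle_anchor_dorfman:
  assumes "\<And>s h. smooth s \<Longrightarrow> smooth h \<Longrightarrow> \<rho> s h = anchor s h"
  shows "bundle_anchor \<rho>"
  unfolding bundle_anchor_def
proof (intro exI[of _ "\<lambda>p v. \<Sum>i<n. anchor_form p v (e i) *\<^sub>R \<epsilon> i"] conjI allI impI)
  show "linear (\<lambda>v. \<Sum>i<n. anchor_form p v (e i) *\<^sub>R \<epsilon> i)" for p
    by (rule linearI) (simp_all add: anchor_form_simps scaleR_add_left sum.distrib scaleR_sum_right)
  show "smooth (\<lambda>p. \<Sum>i<n. anchor_form p v (e i) *\<^sub>R \<epsilon> i)" for v
    by (intro smooth_sum smooth_scaleR smooth_anchor_form smooth_const)
  show "\<rho> s h = (\<lambda>p. frechet_derivative h (at p) (\<Sum>i<n. anchor_form p (s p) (e i) *\<^sub>R \<epsilon> i))"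
    if "smooth s" "smooth h" for s h
  proof
    fix p
    have "linear (frechet_derivative h (at p))"
      by (intro linear_frechet_derivative smooth_differentiable that)
    then show "\<rho> s h p = frechet_derivative h (at p) (\<Sum>i<n. anchor_form p (s p) (e i) *\<^sub>R \<epsilon> i)"
      by (simp add: assms that anchor_def linear_sum linear_scale)
  qed
qed

section \<open>Leibniz rule, gradients and compatibility with the metric\<close>

lemma dorfman_add_left: "smooth s \<Longrightarrow> smooth s' \<Longrightarrow> dorfman (\<lambda>p. s p + s' p) t = (\<lambda>p. dorfman s t p + dorfman s' t p)"
  by (rule ext) (simp add: dorfman_def dder_add anchor_form_simps const_bracket_simps pairing_simps algebra_simps sum.distrib
      sum_subtractf)

lemma dorfman_add_right: "smooth t \<Longrightarrow> smooth t' \<Longrightarrow> dorfman s (\<lambda>p. t p + t' p) = (\<lambda>p. dorfman s t p + dorfman s t' p)"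
  by (rule ext) (simp add: dorfman_def dder_add anchor_form_simps const_bracket_simps pairing_simps algebra_simps sum.distrib
      sum_subtractf)

lemma dorfman_scale_left: "smooth s \<Longrightarrow> dorfman (\<lambda>p. c *\<^sub>R s p) t = (\<lambda>p. c *\<^sub>R dorfman s t p)"
  by (rule ext) (simp add: dorfman_def dder_cscaleR anchor_form_simps const_bracket_simps pairing_simps scaleR_add_right
      scaleR_sum_right scaleR_diff_right mult.commute)

lemma dorfman_leibniz:
  assumes "smooth t" "smooth h"
  shows "dorfman s (\<lambda>p. h p *\<^sub>R t p) = (\<lambda>p. h p *\<^sub>R dorfman s t p + anchor s h p *\<^sub>R t p)"
  by (rule ext) (simp add: dorfman_def anchor_def dder_scaleR assms anchor_form_simps const_bracket_simps pairing_simps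
      scaleR_add_right scaleR_sum_right scaleR_sum_left scaleR_diff_right sum.distrib mult.commute)

lemma dorfman_scale_right: "smooth t \<Longrightarrow> dorfman s (\<lambda>p. c *\<^sub>R t p) = (\<lambda>p. c *\<^sub>R dorfman s t p)"
  using dorfman_leibniz[of t "\<lambda>_. c" s] by (simp add: anchor_def)

text \<open>The adjoint of the anchor applied to the differential of \<open>h\<close>, made a
  section by the pairing: the operator usually called D of a Courant algebroid.\<close>

definition gradient :: "(('m \<Rightarrow>\<^sub>L real) \<Rightarrow> real) \<Rightarrow> ('m \<Rightarrow>\<^sub>L real) \<Rightarrow> ('x \<Rightarrow>\<^sub>L real) \<times> 'x" where
  "gradient h p = (\<Sum>i<n. dder (\<epsilon> i) h p *\<^sub>R anchor_dual p (e i))"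

lemma smooth_gradient: "smooth h \<Longrightarrow> smooth (gradient h)"
  unfolding gradient_def[abs_def]
  by (intro smooth_sum smooth_scaleR smooth_anchor_dual smooth_frechet_derivative)

lemma pairing_anchor_dual: "canonical_pairing (anchor_dual p m) v = anchor_form p v m"
  by (simp add: canonical_pairing_def anchor_form_def fst_anchor_dual snd_anchor_dual)

lemma pairing_gradient: "canonical_pairing (gradient h p) (s p) = anchor s h p"
  by (simp add: gradient_def pairing_simps pairing_anchor_dual anchor_def mult.commute)

lemma const_bracket_skew: "const_bracket p w v = - const_bracket p v w"
proof (rule prod_eqI)
  show "snd (const_bracket p w v) = snd (- const_bracket p v w)"
    unfolding snd_const_bracket snd_uminus by (rule l20_skew)
  have "l3 (snd w) (snd v) x = - l3 (snd v) (snd w) x" for x by (rule l3_skew)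
  then show "fst (const_bracket p w v) = fst (- const_bracket p v w)"
    by (intro blinfun_eqI) (simp add: fst_const_bracket blinfun_simps)
qed

text \<open>The trilinear form obtained by pairing the bracket with a third vector is
  \<open>l3\<close> plus one \<open>l20\<close> term for each covector component, and it is totally
  skew.\<close>

lemma pairing_const_bracket: "canonical_pairing (const_bracket p v w) z = - canonical_pairing w (const_bracket p v z)"
proof -
  have "l3 (snd v) (snd z) (snd w) = - l3 (snd v) (snd w) (snd z)"
    "l20 (snd z) (snd w) = - l20 (snd w) (snd z)" by (rule l3_skew l20_skew)+
  then show ?thesis
    by (simp add: canonical_pairing_def fst_const_bracket snd_const_bracket blinfun_simps)
qed

text \<open>In the sum the derivatives along anchors and the pointwise terms cancel; the two adjoint
  terms combine to the differential of the pairing.\<close>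

lemma dorfman_symmetric_part:
  assumes "smooth s" "smooth t"
  shows "(\<lambda>p. dorfman s t p + dorfman t s p) = gradient (\<lambda>p. canonical_pairing (s p) (t p))"
proof
  fix p
  show "dorfman s t p + dorfman t s p = gradient (\<lambda>p. canonical_pairing (s p) (t p)) p"
    by (simp add: dorfman_def gradient_def dder_canonical_pairing[OF assms] const_bracket_skew[of p "t p" "s p"]
        canonical_pairing_commute[of "s p"] sum.distrib sum_subtractf scaleR_add_left)
qed

text \<open>The terms with derivatives of \<open>s\<close> cancel crosswise, and
  \<open>pairing_const_bracket\<close> removes the pointwise ones; what remains is the product
  rule.\<close>

lemma anchor_pairing:
  assumes "smooth t" "smooth u"
  shows "anchor s (\<lambda>p. canonical_pairing (t p) (u p)) p
    = canonical_pairing (dorfman s t p) (u p) + canonical_pairing (t p) (dorfman s u p)"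
proof -
  have 1: "canonical_pairing (dorfman s t p) (u p)
     = (\<Sum>i<n. anchor_form p (s p) (e i) * canonical_pairing (dder (\<epsilon> i) t p) (u p))
      + (\<Sum>i<n. canonical_pairing (dder (\<epsilon> i) s p) (t p) * anchor_form p (u p) (e i))
      - (\<Sum>i<n. canonical_pairing (dder (\<epsilon> i) s p) (u p) * anchor_form p (t p) (e i))
      + canonical_pairing (const_bracket p (s p) (t p)) (u p)" for t u
    by (simp add: dorfman_def pairing_simps pairing_anchor_dual sum.distrib sum_subtractf mult.commute)
  have 2: "canonical_pairing (t p) (dorfman s u p) = canonical_pairing (dorfman s u p) (t p)"
    by (rule canonical_pairing_commute)
  have 3: "canonical_pairing (const_bracket p (s p) (u p)) (t p) = - canonical_pairing (const_bracket p (s p) (t p)) (u p)"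
    using pairing_const_bracket[of p "s p" "t p" "u p"] by (simp add: canonical_pairing_commute[of "t p"])
  show ?thesis
    unfolding 2 1 3 anchor_def dder_canonical_pairing[OF assms]
      canonical_pairing_commute[of "t p" "dder _ u p"]
    by (simp add: distrib_left sum.distrib)
qed

text \<open>The anchor vanishes on the image of its adjoint; this is the axiom
  \<open>l2_l1\<close>.\<close>

lemma anchor_form_anchor_dual: "anchor_form p (anchor_dual p m) m' = 0"
  using l2_l1[of m m'] by (simp add: anchor_form_def fst_anchor_dual snd_anchor_dual blinfun_simps)

text \<open>The homotopy \<open>l3 x y (l1 m)\<close> in \<open>jacobi1'\<close> is supplied by the
  \<open>l3\<close> term of \<open>const_bracket\<close>, while \<open>l1_l2\<close> matches the
  covector parts. The right-hand side is what the commutator of two affine vector fields on the base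
  yields.\<close>

lemma anchor_form_const_bracket: "anchor_form p (const_bracket p v w) m = anchor_form p v (l21 (snd w) m) - anchor_form p w (l21 (snd v) m)"
proof -
  have "blinfun_apply p (l21 (snd v) (l21 (snd w) m)) = blinfun_apply p (l21 (l20 (snd v) (snd w)) m)
      + blinfun_apply p (l21 (snd w) (l21 (snd v) m)) + blinfun_apply p (l3 (snd v) (snd w) (l1 m))"
    by (simp add: jacobi1'[of "snd v" "snd w" m] blinfun_simps)
  then show ?thesis
    by (simp add: anchor_form_def fst_const_bracket snd_const_bracket l1_l2)
qed

text \<open>The second summand comes from differentiating the base point \<open>p\<close>, which is
  itself an argument of the form.\<close>

lemma dder_anchor_form:
  assumes s: "smooth s"
  shows "dder (\<epsilon> i) (\<lambda>p. anchor_form p (s p) m) p = anchor_form p (dder (\<epsilon> i) s p) m + coord n e (l21 (snd (s p)) m) i"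
proof -
  have b: "bounded_linear (\<lambda>x. l21 x m)"
    by (rule linear_bounded_linear_basis[OF f l21_linear(2)])
  have g: "smooth (\<lambda>p. l21 (snd (s p)) m)"
    by (rule bounded_linear.smooth_compose[OF b smooth_snd[OF s]])
  have d: "dder v (\<lambda>p. l21 (snd (s p)) m) p = l21 (snd (dder v s p)) m" for v
    by (simp add: frechet_derivative_bounded_linear[OF b smooth_snd[OF s]] dder_snd[OF s])
  have "smooth (\<lambda>p. blinfun_apply p (l21 (snd (s p)) m))" "smooth (\<lambda>p. blinfun_apply (fst (s p)) (l1 m))"
    by (intro bounded_bilinear.smooth_prod[OF bounded_bilinear_blinfun_apply] smooth_ident g smooth_fst s
        smooth_const)+
  then show ?thesis
    unfolding anchor_form_def
    by (simp add: dder_add dder_blinfun smooth_ident g d smooth_fst s dder_fst dual_basis_apply[OF e])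
qed

lemma sum_anchor_form_coord: "(\<Sum>i<n. anchor_form p v (e i) * coord n e m i) = anchor_form p v m"
  using linear_basis_expand[OF e linear_anchor_form(1)[of p v], of m] by (simp add: mult.commute)

text \<open>The adjoint term of \<open>dorfman\<close> drops out by
  \<open>anchor_form_anchor_dual\<close>.\<close>

lemma anchor_form_dorfman: "anchor_form p (dorfman s t p) m =
    (\<Sum>i<n. anchor_form p (s p) (e i) * (anchor_form p (dder (\<epsilon> i) t p) m + coord n e (l21 (snd (t p)) m) i))
  - (\<Sum>i<n. anchor_form p (t p) (e i) * (anchor_form p (dder (\<epsilon> i) s p) m + coord n e (l21 (snd (s p)) m) i))"
  by (simp add: dorfman_def anchor_form_simps anchor_form_anchor_dual anchor_form_const_bracket distrib_left sum.distrib sum_subtractf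
      sum_anchor_form_coord sum_negf)

text \<open>Splits the composite of two vector fields into its first-order and second-order part;
  the latter will cancel in the commutator.\<close>

lemma anchor_anchor:
  assumes "smooth t" "smooth h"
  shows "anchor s (anchor t h) p = (\<Sum>j<n. (\<Sum>i<n. anchor_form p (s p) (e i) *
        (anchor_form p (dder (\<epsilon> i) t p) (e j) + coord n e (l21 (snd (t p)) (e j)) i)) * dder (\<epsilon> j) h p)
    + (\<Sum>i<n. \<Sum>j<n. anchor_form p (s p) (e i) * anchor_form p (t p) (e j) * dder (\<epsilon> i) (dder (\<epsilon> j) h) p)"
proof -
  define C where "C i j = anchor_form p (dder (\<epsilon> i) t p) (e j) + coord n e (l21 (snd (t p)) (e j)) i" for i j
  have "dder (\<epsilon> i) (anchor t h) p = (\<Sum>j<n. anchor_form p (t p) (e j) * dder (\<epsilon> i) (dder (\<epsilon> j) h) p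
      + C i j * dder (\<epsilon> j) h p)" for i
    unfolding C_def anchor_def[abs_def]
    by (subst dder_sum) (auto intro!: sum.cong smooth_mult smooth_anchor_form smooth_frechet_derivative assms
        simp: dder_mult smooth_anchor_form smooth_frechet_derivative assms dder_anchor_form)
  then have "anchor s (anchor t h) p = (\<Sum>i<n. \<Sum>j<n. anchor_form p (s p) (e i) * C i j * dder (\<epsilon> j) h p)
    + (\<Sum>i<n. \<Sum>j<n. anchor_form p (s p) (e i) * anchor_form p (t p) (e j) * dder (\<epsilon> i) (dder (\<epsilon> j) h) p)"
    by (simp add: anchor_def[of s] sum_distrib_left distrib_left sum.distrib mult.assoc)
  also have "(\<Sum>i<n. \<Sum>j<n. anchor_form p (s p) (e i) * C i j * dder (\<epsilon> j) h p)
    = (\<Sum>j<n. (\<Sum>i<n. anchor_form p (s p) (e i) * C i j) * dder (\<epsilon> j) h p)"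
    unfolding sum_distrib_right by (rule sum.swap)
  finally show ?thesis unfolding C_def .
qed

lemma anchor_dorfman:
  assumes "smooth s" "smooth t" "smooth h"
  shows "anchor (dorfman s t) h p = anchor s (anchor t h) p - anchor t (anchor s h) p"
proof -
  have "(\<Sum>i<n. \<Sum>j<n. anchor_form p (s p) (e i) * anchor_form p (t p) (e j) * dder (\<epsilon> i) (dder (\<epsilon> j) h) p)
      = (\<Sum>i<n. \<Sum>j<n. anchor_form p (t p) (e i) * anchor_form p (s p) (e j) * dder (\<epsilon> i) (dder (\<epsilon> j) h) p)"
    by (subst sum.swap, intro sum.cong refl, subst second_derivative_symmetric[OF assms(3)])
      (simp add: mult.commute)
  then show ?thesis
    unfolding anchor_anchor[OF assms(2,3)] anchor_anchor[OF assms(1,3)]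
    by (simp add: anchor_def[of "dorfman s t"] anchor_form_dorfman left_diff_distrib sum_subtractf)
qed

text \<open>Pairing with a constant section \<open>w\<close> turns the claim into a combination of
  \<open>anchor_pairing\<close> and \<open>anchor_dorfman\<close>.\<close>

lemma dorfman_gradient:
  assumes s: "smooth s" and h: "smooth h"
  shows "dorfman s (gradient h) = gradient (anchor s h)"
proof
  fix p
  show "dorfman s (gradient h) p = gradient (anchor s h) p"
  proof (rule pairing_nondegenerate)
    fix w :: "('x \<Rightarrow>\<^sub>L real) \<times> 'x"
    let ?w = "\<lambda>_. w"
    have "anchor s (anchor ?w h) p = canonical_pairing (dorfman s (gradient h) p) w + canonical_pairing (gradient h p) (dorfman s ?w p)"
      using anchor_pairing[OF smooth_gradient[OF h] smooth_const[of w], of s p]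
      by (simp add: pairing_gradient[of h _ ?w])
    then have "canonical_pairing (dorfman s (gradient h) p) w = anchor s (anchor ?w h) p - anchor (dorfman s ?w) h p"
      by (simp add: pairing_gradient)
    also have "\<dots> = anchor ?w (anchor s h) p"
      using anchor_dorfman[OF s smooth_const[of w] h, of p] by simp
    finally show "canonical_pairing (dorfman s (gradient h) p) w = canonical_pairing (gradient (anchor s h) p) w"
      by (simp add: pairing_gradient[of "anchor s h" p ?w])
  qed
qed

text \<open>By \<open>dorfman_symmetric_part\<close> the bracket is the gradient of
  \<open>anchor s h\<close> minus \<open>dorfman s (gradient h)\<close>, and these agree by
  \<open>dorfman_gradient\<close>.\<close>

lemma gradient_dorfman:
  assumes s: "smooth s" and h: "smooth h"
  shows "dorfman (gradient h) s = (\<lambda>_. 0)"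
proof
  fix p
  have "dorfman (gradient h) s p + dorfman s (gradient h) p = gradient (\<lambda>p. canonical_pairing (gradient h p) (s p)) p"
    using dorfman_symmetric_part[OF smooth_gradient[OF h] s] by (rule fun_cong)
  then show "dorfman (gradient h) s p = 0"
    by (simp add: dorfman_gradient[OF s h] pairing_gradient)
qed

section \<open>The Jacobi identity on constant sections\<close>

lemma dorfman_const_const: "dorfman (\<lambda>_. v) (\<lambda>_. w) = (\<lambda>p. const_bracket p v w)"
  by (rule ext) (simp add: dorfman_def linear_0[OF linear_canonical_pairing(2)])

lemma dder_const_bracket:
  "dder (\<epsilon> i) (\<lambda>p. const_bracket p v w) p = (dualf (\<lambda>x. coord n e (l3 (snd v) (snd w) x) i), 0)"
proof (rule section_eqI)
  have s: "smooth (\<lambda>p. const_bracket p v w)" by (intro smooth_const_bracket smooth_const)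
  have lin: "linear (\<lambda>x. coord n e (l3 (snd v) (snd w) x) i)"
    using linear_compose[OF l3_linear(1) coord_linear[OF e]] by (simp add: o_def)
  \<comment> \<open>Only the \<open>l3\<close> part of \<open>const_bracket\<close> involves the
    base point, so each coefficient is affine in \<open>p\<close>.\<close>
  have d: "dder q (\<lambda>p. blinfun_apply p m + c) p = blinfun_apply q m" for q :: "'m \<Rightarrow>\<^sub>L real" and m c
    by (subst dder_add) (simp_all add: smooth_blinfun_apply dder_blinfun smooth_ident)
  fix a
  show "theta_coeff a (dder (\<epsilon> i) (\<lambda>p. const_bracket p v w) p) = theta_coeff a (dualf (\<lambda>x. coord n e (l3 (snd v) (snd w) x) i), 0)"
    unfolding fun_cong[OF frechet_derivative_bounded_linear[OF bounded_linear_theta_coeff s], symmetric]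
    using d[of "l3 (snd v) (snd w) (f a)"
        "blinfun_apply (fst v) (l20 (snd w) (f a)) - blinfun_apply (fst w) (l20 (snd v) (f a))" "\<epsilon> i"]
    by (simp add: theta_coeff_def fst_const_bracket dualf_apply[OF lin] dual_basis_apply[OF e] algebra_simps)
  show "xi_coeff a (dder (\<epsilon> i) (\<lambda>p. const_bracket p v w) p) = xi_coeff a (dualf (\<lambda>x. coord n e (l3 (snd v) (snd w) x) i), 0)"
    unfolding fun_cong[OF frechet_derivative_bounded_linear[OF bounded_linear_xi_coeff s], symmetric]
    by (simp add: xi_coeff_def snd_const_bracket linear_0[OF coord_linear[OF f]])
qed

lemma fst_sum_dder_const_bracket:
  "blinfun_apply (fst (\<Sum>i<n. anchor_form p v (e i) *\<^sub>R dder (\<epsilon> i) (\<lambda>p. const_bracket p w z) p)) x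
    = anchor_form p v (l3 (snd w) (snd z) x)"
proof -
  have lin: "linear (\<lambda>x. coord n e (l3 (snd w) (snd z) x) i)" for i
    using linear_compose[OF l3_linear(1) coord_linear[OF e]] by (simp add: o_def)
  show ?thesis
    by (simp add: dder_const_bracket fst_sum blinfun.sum_left blinfun.scaleR_left dualf_apply[OF lin] sum_anchor_form_coord)
qed

lemma snd_sum_dder_const_bracket: "snd (\<Sum>i<n. c i *\<^sub>R dder (\<epsilon> i) (\<lambda>p. const_bracket p w z) p) = 0"
  by (simp add: dder_const_bracket snd_sum)

lemma sum_coord_anchor_dual: "(\<Sum>i<n. coord n e m i *\<^sub>R anchor_dual p (e i)) = anchor_dual p m"
proof (rule section_eqI)
  fix a
  show "theta_coeff a (\<Sum>i<n. coord n e m i *\<^sub>R anchor_dual p (e i)) = theta_coeff a (anchor_dual p m)"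
    using linear_basis_expand[OF e linear_blinfun_o[OF l21_linear(1)], of p "f a" m]
    by (simp add: linear_sum[OF linear_theta_coeff] linear_scale[OF linear_theta_coeff]) (simp add: theta_coeff_def fst_anchor_dual)
  show "xi_coeff a (\<Sum>i<n. coord n e m i *\<^sub>R anchor_dual p (e i)) = xi_coeff a (anchor_dual p m)"
    using linear_basis_expand[OF e linear_compose[OF l1_linear coord_linear[OF f, of a]], of m]
    by (simp add: linear_sum[OF linear_xi_coeff] linear_scale[OF linear_xi_coeff]) (simp add: xi_coeff_def snd_anchor_dual)
qed

lemma dorfman_const_const_bracket: "dorfman (\<lambda>_. v) (\<lambda>p. const_bracket p w z) p
    = (\<Sum>i<n. anchor_form p v (e i) *\<^sub>R dder (\<epsilon> i) (\<lambda>p. const_bracket p w z) p) + const_bracket p v (const_bracket p w z)"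
  by (simp add: dorfman_def linear_0[OF linear_canonical_pairing(2)])

text \<open>The inner bracket varies with \<open>p\<close> through \<open>l3\<close>, so the adjoint
  term survives and becomes \<open>anchor_dual\<close> of \<open>l3\<close> of the three
  arguments.\<close>

lemma dorfman_const_bracket_const: "dorfman (\<lambda>p. const_bracket p v w) (\<lambda>_. z) p
    = anchor_dual p (l3 (snd v) (snd w) (snd z))
      - (\<Sum>i<n. anchor_form p z (e i) *\<^sub>R dder (\<epsilon> i) (\<lambda>p. const_bracket p v w) p) + const_bracket p (const_bracket p v w) z"
proof -
  have lin: "linear (\<lambda>x. coord n e (l3 (snd v) (snd w) x) i)" for i
    using linear_compose[OF l3_linear(1) coord_linear[OF e]] by (simp add: o_def)
  have "canonical_pairing (dder (\<epsilon> i) (\<lambda>p. const_bracket p v w) p) z = coord n e (l3 (snd v) (snd w) (snd z)) i" for i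
    by (simp add: dder_const_bracket canonical_pairing_def dualf_apply[OF lin])
  then show ?thesis
    by (simp add: dorfman_def sum_subtractf sum_coord_anchor_dual)
qed

text \<open>The second component is \<open>jacobi0'\<close>. The covector component, evaluated on
  \<open>u\<close>, splits into a part with \<open>p\<close>, which is \<open>jacobi3\<close> on
  four vectors, and one part for each of the covectors \<open>\<alpha>\<close>,
  \<open>\<beta>\<close>, \<open>\<gamma>\<close>, an instance of \<open>jacobi0'\<close> in each
  case.\<close>

lemma dorfman_jacobi_const:
  "dorfman (\<lambda>_. v) (dorfman (\<lambda>_. w) (\<lambda>_. z)) p
    = dorfman (dorfman (\<lambda>_. v) (\<lambda>_. w)) (\<lambda>_. z) p + dorfman (\<lambda>_. w) (dorfman (\<lambda>_. v) (\<lambda>_. z)) p"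
  unfolding dorfman_const_const dorfman_const_const_bracket dorfman_const_bracket_const
proof (rule prod_eqI)
  let ?D = "\<lambda>u w z. \<Sum>i<n. anchor_form p u (e i) *\<^sub>R dder (\<epsilon> i) (\<lambda>p. const_bracket p w z) p"
  show "snd (?D v w z + const_bracket p v (const_bracket p w z))
    = snd (anchor_dual p (l3 (snd v) (snd w) (snd z)) - ?D z v w + const_bracket p (const_bracket p v w) z
        + (?D w v z + const_bracket p w (const_bracket p v z)))"
    using jacobi0'[of "snd v" "snd w" "snd z"]
    by (simp only: snd_add snd_diff snd_sum_dder_const_bracket snd_const_bracket snd_anchor_dual) simp
  show "fst (?D v w z + const_bracket p v (const_bracket p w z))
    = fst (anchor_dual p (l3 (snd v) (snd w) (snd z)) - ?D z v w + const_bracket p (const_bracket p v w) z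
        + (?D w v z + const_bracket p w (const_bracket p v z)))"
  proof (rule blinfun_eqI)
    fix u
    obtain \<alpha> x \<beta> y \<gamma> z' where vwz: "v = (\<alpha>, x)" "w = (\<beta>, y)" "z = (\<gamma>, z')"
      by (cases v, cases w, cases z) auto
    \<comment> \<open>Brings every \<open>l3\<close> to the argument order of
      \<open>jacobi3\<close>, so that \<open>linarith\<close> sees the same atoms on both
      sides.\<close>
    have skew: "l3 x (l20 y z') u = - l3 (l20 y z') x u" "l3 y (l20 x z') u = - l3 (l20 x z') y u"
      "l3 x y (l20 z' u) = l3 (l20 z' u) x y" "l3 x z' (l20 y u) = l3 (l20 y u) x z'"
      "l3 y z' (l20 x u) = l3 (l20 x u) y z'"
      using l3_skew by metis+
    have p: "blinfun_apply p (l3 (l20 x y) z' u) - blinfun_apply p (l3 (l20 x z') y u)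
        + blinfun_apply p (l3 (l20 x u) y z') + blinfun_apply p (l3 (l20 y z') x u)
        - blinfun_apply p (l3 (l20 y u) x z') + blinfun_apply p (l3 (l20 z' u) x y)
      = - blinfun_apply p (l21 u (l3 x y z')) + blinfun_apply p (l21 z' (l3 x y u))
        - blinfun_apply p (l21 y (l3 x z' u)) + blinfun_apply p (l21 x (l3 y z' u))"
      using arg_cong[OF jacobi3[of x y z' u], of "blinfun_apply p"] by (simp add: blinfun_simps)
    have j: "blinfun_apply q (l20 a (l20 b c)) = blinfun_apply q (l20 (l20 a b) c)
        + blinfun_apply q (l20 b (l20 a c)) + blinfun_apply q (l1 (l3 a b c))" for q a b c
      by (simp add: jacobi0'[of a b c] blinfun_simps)
    show "blinfun_apply (fst (?D v w z + const_bracket p v (const_bracket p w z))) u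
      = blinfun_apply (fst (anchor_dual p (l3 (snd v) (snd w) (snd z)) - ?D z v w + const_bracket p (const_bracket p v w) z
        + (?D w v z + const_bracket p w (const_bracket p v z)))) u"
      using p j[of \<alpha> y z' u] j[of \<beta> x z' u] j[of \<gamma> x y u]
      unfolding fst_add fst_diff blinfun.add_left blinfun.diff_left fst_sum_dder_const_bracket fst_const_bracket snd_const_bracket
        fst_anchor_dual
      unfolding anchor_form_def vwz fst_conv snd_conv skew blinfun.minus_right
      by linarith
  qed
qed

section \<open>The Jacobiator as a skew tensor\<close>

definition jacobiator where
  "jacobiator s t u = (\<lambda>p. dorfman s (dorfman t u) p - dorfman (dorfman s t) u p - dorfman t (dorfman s u) p)"

lemma jacobiator_add:
  assumes "smooth s" "smooth t" "smooth u" "smooth u'"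
  shows "jacobiator s t (\<lambda>p. u p + u' p) = (\<lambda>p. jacobiator s t u p + jacobiator s t u' p)"
  by (rule ext) (simp add: jacobiator_def dorfman_add_right assms smooth_dorfman)

text \<open>The terms with derivatives of \<open>h\<close> cancel: the mixed first-order ones in
  pairs, those multiplying \<open>u\<close> by \<open>anchor_dorfman\<close>.\<close>

lemma jacobiator_scale:
  assumes s: "smooth s" and t: "smooth t" and u: "smooth u" and h: "smooth h"
  shows "jacobiator s t (\<lambda>p. h p *\<^sub>R u p) = (\<lambda>p. h p *\<^sub>R jacobiator s t u p)"
proof
  fix p
  have *: "dorfman a (dorfman b (\<lambda>p. h p *\<^sub>R u p)) p = h p *\<^sub>R dorfman a (dorfman b u) p + anchor a h p *\<^sub>R dorfman b u p
      + (anchor b h p *\<^sub>R dorfman a u p + anchor a (anchor b h) p *\<^sub>R u p)" if "smooth a" "smooth b" for a b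
    using that u h by (simp add: dorfman_leibniz dorfman_add_right smooth_dorfman smooth_anchor smooth_scaleR)
  show "jacobiator s t (\<lambda>p. h p *\<^sub>R u p) p = h p *\<^sub>R jacobiator s t u p"
    unfolding jacobiator_def *[OF s t] *[OF t s]
    unfolding dorfman_leibniz[OF u h] anchor_dorfman[OF s t h]
    by (simp add: algebra_simps)
qed

text \<open>The symmetric part of the inner bracket is a gradient, and gradients act as zero from
  the left.\<close>

lemma jacobiator_swap12:
  assumes s: "smooth s" and t: "smooth t" and u: "smooth u"
  shows "jacobiator t s u p = - jacobiator s t u p"
proof -
  have "dorfman (\<lambda>p. dorfman s t p + dorfman t s p) u p = 0"
    unfolding dorfman_symmetric_part[OF s t]
    by (simp add: gradient_dorfman[OF u smooth_canonical_pairing[OF s t]])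
  then have "dorfman (dorfman s t) u p + dorfman (dorfman t s) u p = 0"
    by (simp add: dorfman_add_left smooth_dorfman s t)
  then show ?thesis by (simp add: jacobiator_def algebra_simps)
qed

text \<open>The bracket of \<open>s\<close> with the gradient of the pairing of \<open>t\<close> and
  \<open>u\<close> is evaluated by \<open>dorfman_gradient\<close> and
  \<open>anchor_pairing\<close>; the two resulting gradients are again symmetric parts of
  brackets.\<close>

lemma jacobiator_swap23:
  assumes s: "smooth s" and t: "smooth t" and u: "smooth u"
  shows "jacobiator s u t p = - jacobiator s t u p"
proof -
  have sym: "dorfman a b p + dorfman b a p = gradient (\<lambda>p. canonical_pairing (a p) (b p)) p"
    if "smooth a" "smooth b" for a b
    using dorfman_symmetric_part[OF that] by (rule fun_cong)
  have "dorfman s (dorfman t u) p + dorfman s (dorfman u t) p = dorfman s (\<lambda>p. dorfman t u p + dorfman u t p) p"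
    by (simp add: dorfman_add_right smooth_dorfman t u)
  also have "\<dots> = gradient (anchor s (\<lambda>p. canonical_pairing (t p) (u p))) p"
    unfolding dorfman_symmetric_part[OF t u] by (simp add: dorfman_gradient[OF s smooth_canonical_pairing[OF t u]])
  also have "anchor s (\<lambda>p. canonical_pairing (t p) (u p))
      = (\<lambda>p. canonical_pairing (dorfman s t p) (u p) + canonical_pairing (t p) (dorfman s u p))"
    by (rule ext) (rule anchor_pairing[OF t u])
  also have "gradient \<dots> p = gradient (\<lambda>p. canonical_pairing (dorfman s t p) (u p)) p
      + gradient (\<lambda>p. canonical_pairing (t p) (dorfman s u p)) p"
    unfolding gradient_def
    by (subst dder_add) (auto intro!: smooth_canonical_pairing smooth_dorfman s t u
        simp: scaleR_add_left sum.distrib)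
  also have "\<dots> = (dorfman (dorfman s t) u p + dorfman u (dorfman s t) p) + (dorfman t (dorfman s u) p + dorfman (dorfman s u) t p)"
    by (simp add: sym smooth_dorfman s t u)
  finally show ?thesis by (simp add: jacobiator_def algebra_simps)
qed

text \<open>Linearity over functions in the last argument reduces \<open>u\<close> to the frame,
  whose members are constant.\<close>

lemma jacobiator_zero_if_const:
  assumes s: "smooth s" and t: "smooth t" and u: "smooth u" and c: "\<And>v p. jacobiator s t (\<lambda>_. v) p = 0"
  shows "jacobiator s t u p = 0"
proof -
  let ?U = "\<lambda>a p. theta_coeff a (u p) *\<^sub>R (dual_basis r f a, 0) + xi_coeff a (u p) *\<^sub>R (0, f a)"
  have sm: "smooth (?U a)" for a
    by (intro smooth_add smooth_scaleR smooth_const smooth_theta_coeff smooth_xi_coeff u)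
  have U: "jacobiator s t (?U a) p = 0" for a p
    unfolding jacobiator_add[OF s t smooth_scaleR[OF smooth_theta_coeff[OF u] smooth_const]
        smooth_scaleR[OF smooth_xi_coeff[OF u] smooth_const]]
      jacobiator_scale[OF s t smooth_const smooth_theta_coeff[OF u]] jacobiator_scale[OF s t smooth_const smooth_xi_coeff[OF u]] c
    by simp
  have zero: "jacobiator s t (\<lambda>_. 0) p = 0" by (rule c)
  have "jacobiator s t (\<lambda>p. \<Sum>a\<in>A. ?U a p) p = 0" if "finite A" for A :: "nat set"
    using that
  proof (induction A rule: finite_induct)
    case (insert a A)
    have "(\<lambda>p. \<Sum>a\<in>insert a A. ?U a p) = (\<lambda>p. ?U a p + (\<Sum>a\<in>A. ?U a p))"
      by (intro ext) (simp only: sum.insert[OF insert.hyps(1,2)])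
    then show ?case
      using jacobiator_add[OF s t sm smooth_sum[of A ?U, OF sm]] insert.IH by (simp only: U add_0_left)
  qed (simp only: sum.empty zero)
  from this[of "{..<r}"] show ?thesis
    by (simp only: frame_expand[symmetric] finite_lessThan)
qed

text \<open>By total skew-symmetry, constants may be replaced by arbitrary sections one argument at a time.\<close>

lemma jacobiator_zero:
  assumes s: "smooth s" and t: "smooth t" and u: "smooth u"
  shows "jacobiator s t u p = 0"
proof -
  have "jacobiator (\<lambda>_. v) (\<lambda>_. w) (\<lambda>_. z) p = 0" for v w z p
    using dorfman_jacobi_const[of v w z p] by (simp add: jacobiator_def)
  then have 1: "jacobiator (\<lambda>_. v) (\<lambda>_. w) u p = 0" if "smooth u" for v w u p
    by (rule jacobiator_zero_if_const[OF smooth_const smooth_const that])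
  have "jacobiator (\<lambda>_. v) t (\<lambda>_. w) p = 0" if "smooth t" for v w t p
    using jacobiator_swap23[OF smooth_const smooth_const that, of v w p] 1[OF that] by simp
  then have 2: "jacobiator (\<lambda>_. v) t u p = 0" if "smooth t" "smooth u" for v t u p
    by (rule jacobiator_zero_if_const[OF smooth_const that]) (rule that(1))
  have "jacobiator s t (\<lambda>_. v) p = 0" for v p
  proof -
    have "jacobiator s (\<lambda>_. v) t p = 0"
      using jacobiator_swap12[OF smooth_const s t, of v p] 2[OF s t] by simp
    then show ?thesis
      using jacobiator_swap23[OF s smooth_const t, of v p] by simp
  qed
  then show ?thesis by (rule jacobiator_zero_if_const[OF s t u])
qed

lemma dorfman_jacobi:
  assumes "smooth s" "smooth t" "smooth u"
  shows "dorfman s (dorfman t u) = (\<lambda>p. dorfman (dorfman s t) u p + dorfman t (dorfman s u) p)"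
  using jacobiator_zero[OF assms] by (intro ext) (simp add: jacobiator_def algebra_simps)

lemma courant_algebroid_Linf: "courant_algebroid (associated_courant n e r f l1 l20 l21 l3)"
proof -
  have B: "derived_bracket n \<epsilon> r f (- L) s t = dorfman s t" if "smooth s" "smooth t" for s t
    by (rule derived_bracket_eq[OF that])
  have A: "derived_anchor n \<epsilon> r f (- L) s h = anchor s h" if "smooth s" for s h
    by (rule derived_anchor_eq[OF that])
  have anchor: "bundle_anchor (derived_anchor n \<epsilon> r f (- L))"
    by (rule bundle_anchor_dorfman) (rule A)
  have self: "canonical_pairing (dorfman s s p) (t p)
      = 1/2 * anchor t (\<lambda>p. canonical_pairing (s p) (s p)) p" if "smooth s" for s t p
  proof -
    have "dorfman s s p + dorfman s s p = gradient (\<lambda>p. canonical_pairing (s p) (s p)) p"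
      using dorfman_symmetric_part[OF that that] by (rule fun_cong)
    then have "canonical_pairing (dorfman s s p) (t p) + canonical_pairing (dorfman s s p) (t p)
        = anchor t (\<lambda>p. canonical_pairing (s p) (s p)) p"
      by (simp add: pairing_gradient flip: pairing_simps(2))
    then show ?thesis by simp
  qed
  have invariance: "derived_anchor n \<epsilon> r f (- L) s (\<lambda>p. canonical_pairing (t p) (u p))
    = (\<lambda>p. canonical_pairing (derived_bracket n \<epsilon> r f (- L) s t p) (u p)
        + canonical_pairing (t p) (derived_bracket n \<epsilon> r f (- L) s u p))"
    if "smooth s" "smooth t" "smooth u" for s t u
    unfolding A[OF that(1)] B[OF that(1,2)] B[OF that(1,3)] by (rule ext) (rule anchor_pairing[OF that(2,3)])
  have jacobi: "derived_bracket n \<epsilon> r f (- L) s (derived_bracket n \<epsilon> r f (- L) t u)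
    = (\<lambda>p. derived_bracket n \<epsilon> r f (- L) (derived_bracket n \<epsilon> r f (- L) s t) u p
        + derived_bracket n \<epsilon> r f (- L) t (derived_bracket n \<epsilon> r f (- L) s u) p)"
    if "smooth s" "smooth t" "smooth u" for s t u
    \<comment> \<open>The derived brackets are known only on smooth sections, so
      \<open>smooth_dorfman\<close> is needed to rewrite the outer ones.\<close>
    using dorfman_jacobi[OF that] by (simp only: B that smooth_dorfman)
  show ?thesis
    unfolding courant_algebroid_def associated_courant_def courant_data.simps Let_def
    by (intro conjI allI impI fibre_metric_canonical anchor)
      ((rule jacobi invariance, assumption+) | (simp add: A B smooth_dorfman smooth_add smooth_scaleR dorfman_add_left
        dorfman_add_right dorfman_scale_left dorfman_scale_right self; fail))+
qed

end

theorem theorem5p1: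
  fixes l1 :: "'m::real_normed_vector \<Rightarrow> 'x::real_normed_vector"
    and l20 :: "'x \<Rightarrow> 'x \<Rightarrow> 'x"
    and l21 :: "'x \<Rightarrow> 'm \<Rightarrow> 'm"
    and l3 :: "'x \<Rightarrow> 'x \<Rightarrow> 'x \<Rightarrow> 'm"
    and n r :: nat
    and e :: "nat \<Rightarrow> 'm"
    and f :: "nat \<Rightarrow> 'x"
  assumes "is_basis n e"
    and "is_basis r f"
    and "two_term_Linf l1 l20 l21 l3"
  defines "\<mu> \<equiv> - fun_l1 n e r f l1"
    and "\<gamma> \<equiv> - fun_l20 r f l20 - fun_l21 n e r f l21"
    and "\<phi> \<equiv> - fun_l3 r f l3"
    and "E \<equiv> associated_courant n e r f l1 l20 l21 l3"
  shows "- fun_l n e r f l1 l20 l21 l3 = \<mu> + \<gamma> + \<phi>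
    \<and> lie_quasi_bialgebroid n (dual_basis n e) r \<mu> \<gamma> \<phi>
    \<and> courant_algebroid E
    \<and> E = double n (dual_basis n e) r f \<mu> \<gamma> \<phi>"
proof -
  interpret based_Linf l1 l20 l21 l3 n r e f
    using assms(1-3) by (simp add: based_Linf_def based_Linf_axioms_def)
  have \<Theta>: "- fun_l n e r f l1 l20 l21 l3 = \<mu> + \<gamma> + \<phi>"
    unfolding \<mu>_def \<gamma>_def \<phi>_def fun_l_def minus_add_distrib diff_conv_add_uminus
    by (simp only: ac_simps)
  \<comment> \<open>\<open>double\<close> and \<open>associated_courant\<close> differ only in how
    the degree 3 function is written.\<close>
  moreover have "E = double n (dual_basis n e) r f \<mu> \<gamma> \<phi>"
    unfolding E_def associated_courant_def double_def \<Theta> ..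
  ultimately show ?thesis
    using lie_quasi_bialgebroid_Linf courant_algebroid_Linf
    unfolding \<mu>_def \<gamma>_def \<phi>_def E_def by blast
qed

end
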